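(* The 1-category $\mathbf{CxlCat}$ of contextual categories and homomorphisms is equivalent to the 1-category $\mathbf{CwA}^{\mathrm{str1}}_{\mathrm{cxl}}$ of contextual categories with attributes and strict maps, and hence to the 1-category $\mathbf{CompCat}^{\mathrm{str1}}_{\mathrm{disc},\mathrm{cxl}}$ of discrete, contextual comprehension categories and strict maps.
   Context: **Contextual categories.** A contextual category consists of (1) a category $\mathcal C$ with a distinguished terminal object $1$; (2) a (rooted, finite-height) tree structure on $\mathrm{ob}\,\mathcal C$ with root $1$; (3) for each non-root object $A$, a projection map $p_A$ from $A$ to its parent; and (4) chosen pullbacks of projections along arbitrary maps, which are again projections, $f^*p_A=p_{f^*A}$ (so for $f:\Delta\to\Gamma$ with $\Gamma$ the parent of $A$, $f^*A$ has parent $\Delta$), strictly functorial in that $\mathrm{id}^*A=A$, $(fg)^*A=g^*f^*A$ (and likewise for the chosen top maps $f^*A\to A$ of the pullback squares). A homomorphism is a functor commuting on the nose with all the given structure. **Categories with attributes.** A category with attributes (CwA) consists of a category $\mathcal C$; a presheaf $\mathrm{Ty}:\mathcal C^{\mathrm{op}}\to\mathbf{Set}$; a functor $(-.-):\int_{\mathcal C}\mathrm{Ty}\to\mathcal C$; and a natural transformation $p:(-.-)\to\pi_1$ (with $\pi_1:\int_{\mathcal C}\mathrm{Ty}\to\mathcal C$ the projection) whose naturality squares are pullbacks. A strict map is a functor $F:\mathcal C\to\mathcal C'$ and natural transformation $\bar F:\mathrm{Ty}\to\mathrm{Ty}'\cdot F$ commuting on the nose with $(-.-)$ and $p$. **Comprehension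 categories.** A comprehension category $(\mathcal C,\mathcal T,p,\chi)$ is a category $\mathcal C$, a fibration $p:\mathcal T\to\mathcal C$, and a functor $\chi:\mathcal T\to\mathcal C^{\to}$ with $\mathrm{cod}\circ\chi=p$ strictly, sending $p$-cartesian maps to pullback squares. For $A\in\mathcal T_\Gamma=p^{-1}(\Gamma)$ the domain of $\chi(A)$ is written $\Gamma.A$. A strict map is a pair of functors $F:\mathcal C\to\mathcal C'$, $\bar F:\mathcal T\to\mathcal T'$ with $\bar F$ strictly over $F$, preserving cartesian maps, and $\chi'\bar F=F^{\to}\chi$. It is *discrete* if $p$ is a discrete fibration; a CwA is regarded as a discrete comprehension category with $\mathcal T=\int_{\mathcal C}\mathrm{Ty}$. A comprehension category (or CwA) is *contextual* if equipped with a distinguished terminal object $1$ such that every object is uniquely expressible as an iterated context extension $1.A_0\ldots A_{n-1}$, $n\ge0$, with each $A_k\in\mathcal T_{1.A_0\ldots A_{k-1}}$. Strict maps of contextual CwA's and of contextual comprehension categories are moreover required to preserve $1$ on the nose. *)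

theory Defs
  imports Main "HOL-Library.FuncSet"
begin

section \<open>Categories, functors, natural transformations, equivalences\<close>

text \<open>
  The objects and the arrows of a category form sets in given types, so that a type plays the
  role of the universe with respect to which small structures are small. Here, and in all
  the structures below, operations take the value \<^const>\<open>undefined\<close> outside their intended domain, so that
  equality of records and of functions is equality of structures and of maps between them.
  \<open>Comp C g f\<close> is written \<open>g \<cdot>\<^bsub>C\<^esub> f\<close> and is composition in the usual order (first \<open>f\<close>, then \<open>g\<close>).
\<close>

record ('o, 'm) cat =
  Obj :: "'o set"
  Arr :: "'m set"
  Dom :: "'m \<Rightarrow> 'o"
  Cod :: "'m \<Rightarrow> 'o"
  Id :: "'o \<Rightarrow> 'm"
  Comp :: "'m \<Rightarrow> 'm \<Rightarrow> 'm"  (infixl \<open>\<cdot>\<index>\<close> 70)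

definition hom :: "('o, 'm) cat \<Rightarrow> 'o \<Rightarrow> 'o \<Rightarrow> 'm set" where
  "hom C a b = {f \<in> Arr C. Dom C f = a \<and> Cod C f = b}"

locale category =
  fixes C :: "('o, 'm) cat"
  assumes Dom_type: "Dom C \<in> Arr C \<rightarrow>\<^sub>E Obj C"
    and Cod_type: "Cod C \<in> Arr C \<rightarrow>\<^sub>E Obj C"
    and Id_ext: "Id C \<in> extensional (Obj C)"
    and Id_type: "a \<in> Obj C \<Longrightarrow> Id C a \<in> hom C a a"
    and Comp_ext: "\<not> (f \<in> Arr C \<and> g \<in> Arr C \<and> Cod C f = Dom C g) \<Longrightarrow> g \<cdot>\<^bsub>C\<^esub> f = undefined"
    and Comp_type: "f \<in> hom C a b \<Longrightarrow> g \<in> hom C b c \<Longrightarrow> g \<cdot>\<^bsub>C\<^esub> f \<in> hom C a c"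
    and Id_left: "f \<in> hom C a b \<Longrightarrow> Id C b \<cdot>\<^bsub>C\<^esub> f = f"
    and Id_right: "f \<in> hom C a b \<Longrightarrow> f \<cdot>\<^bsub>C\<^esub> Id C a = f"
    and Comp_assoc: "f \<in> hom C a b \<Longrightarrow> g \<in> hom C b c \<Longrightarrow> h \<in> hom C c d \<Longrightarrow>
      (h \<cdot>\<^bsub>C\<^esub> g) \<cdot>\<^bsub>C\<^esub> f = h \<cdot>\<^bsub>C\<^esub> (g \<cdot>\<^bsub>C\<^esub> f)"

definition terminal :: "('o, 'm) cat \<Rightarrow> 'o \<Rightarrow> bool" where
  "terminal C t \<longleftrightarrow> t \<in> Obj C \<and> (\<forall>a \<in> Obj C. \<exists>!f. f \<in> hom C a t)"

definition isomorphism :: "('o, 'm) cat \<Rightarrow> 'm \<Rightarrow> bool" where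
  "isomorphism C f \<longleftrightarrow> f \<in> Arr C \<and>
    (\<exists>g \<in> hom C (Cod C f) (Dom C f). g \<cdot>\<^bsub>C\<^esub> f = Id C (Dom C f) \<and> f \<cdot>\<^bsub>C\<^esub> g = Id C (Cod C f))"

text \<open>
  \<open>pullback_square C h k f g\<close> says that the following square commutes and is a pullback:
  \<open>h\<close> is on top, \<open>k\<close> on the left, \<open>f\<close> on the right (parallel to \<open>k\<close>), and \<open>g\<close> at the bottom.
\<close>

definition pullback_square :: "('o, 'm) cat \<Rightarrow> 'm \<Rightarrow> 'm \<Rightarrow> 'm \<Rightarrow> 'm \<Rightarrow> bool" where
  "pullback_square C h k f g \<longleftrightarrow>
    {h, k, f, g} \<subseteq> Arr C \<and> Dom C h = Dom C k \<and> Cod C h = Dom C f \<and> Cod C k = Dom C g \<and>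
    Cod C f = Cod C g \<and> f \<cdot>\<^bsub>C\<^esub> h = g \<cdot>\<^bsub>C\<^esub> k \<and>
    (\<forall>z \<in> Obj C. \<forall>x \<in> hom C z (Dom C f). \<forall>y \<in> hom C z (Dom C g). f \<cdot>\<^bsub>C\<^esub> x = g \<cdot>\<^bsub>C\<^esub> y \<longrightarrow>
      (\<exists>!u. u \<in> hom C z (Dom C h) \<and> h \<cdot>\<^bsub>C\<^esub> u = x \<and> k \<cdot>\<^bsub>C\<^esub> u = y))"

record ('o, 'm, 'p, 'n) ftr =
  fobj :: "'o \<Rightarrow> 'p"
  farr :: "'m \<Rightarrow> 'n"

locale cat_functor = source: category C + target: category D
  for C :: "('o, 'm) cat" and D :: "('p, 'n) cat" +
  fixes F :: "('o, 'm, 'p, 'n) ftr"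
  assumes fobj_type: "fobj F \<in> Obj C \<rightarrow>\<^sub>E Obj D"
    and farr_ext: "farr F \<in> extensional (Arr C)"
    and farr_type: "f \<in> hom C a b \<Longrightarrow> farr F f \<in> hom D (fobj F a) (fobj F b)"
    and farr_Id: "a \<in> Obj C \<Longrightarrow> farr F (Id C a) = Id D (fobj F a)"
    and farr_Comp: "f \<in> hom C a b \<Longrightarrow> g \<in> hom C b c \<Longrightarrow>
      farr F (g \<cdot>\<^bsub>C\<^esub> f) = farr F g \<cdot>\<^bsub>D\<^esub> farr F f"

definition id_functor :: "('o, 'm) cat \<Rightarrow> ('o, 'm, 'o, 'm) ftr" where
  "id_functor C = \<lparr>fobj = (\<lambda>a \<in> Obj C. a), farr = (\<lambda>f \<in> Arr C. f)\<rparr>"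

text \<open>\<open>comp_functor C G F\<close> is \<open>G\<close> after \<open>F\<close>, where \<open>C\<close> is the source category of \<open>F\<close>.\<close>

definition comp_functor ::
    "('o, 'm) cat \<Rightarrow> ('p, 'n, 'q, 'k) ftr \<Rightarrow> ('o, 'm, 'p, 'n) ftr \<Rightarrow> ('o, 'm, 'q, 'k) ftr" where
  "comp_functor C G F =
    \<lparr>fobj = compose (Obj C) (fobj G) (fobj F), farr = compose (Arr C) (farr G) (farr F)\<rparr>"

locale natural_transformation = F: cat_functor C D F + G: cat_functor C D G
  for C :: "('o, 'm) cat" and D :: "('p, 'n) cat"
    and F :: "('o, 'm, 'p, 'n) ftr" and G :: "('o, 'm, 'p, 'n) ftr" +
  fixes t :: "'o \<Rightarrow> 'n"
  assumes component_ext: "t \<in> extensional (Obj C)"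
    and component_type: "a \<in> Obj C \<Longrightarrow> t a \<in> hom D (fobj F a) (fobj G a)"
    and naturality: "f \<in> hom C a b \<Longrightarrow> t b \<cdot>\<^bsub>D\<^esub> farr F f = farr G f \<cdot>\<^bsub>D\<^esub> t a"

locale natural_isomorphism = natural_transformation +
  assumes component_iso: "a \<in> Obj C \<Longrightarrow> isomorphism D (t a)"

definition equivalent_categories :: "('o, 'm) cat \<Rightarrow> ('p, 'n) cat \<Rightarrow> bool" where
  "equivalent_categories C D \<longleftrightarrow> category C \<and> category D \<and>
    (\<exists>F G \<eta> \<epsilon>. cat_functor C D F \<and> cat_functor D C G \<and>
      natural_isomorphism C C (id_functor C) (comp_functor C G F) \<eta> \<and>
      natural_isomorphism D D (comp_functor D F G) (id_functor D) \<epsilon>)"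

text \<open>
  The category whose objects are the structures in \<open>S\<close>, given the set \<open>H X Y\<close> of homomorphisms
  from \<open>X\<close> to \<open>Y\<close>, the identities \<open>e X\<close>, and the composite \<open>c X k h\<close> of \<open>h\<close> (with source \<open>X\<close>)
  followed by \<open>k\<close>.
\<close>

definition structure_category ::
    "'s set \<Rightarrow> ('s \<Rightarrow> 's \<Rightarrow> 'h set) \<Rightarrow> ('s \<Rightarrow> 'h) \<Rightarrow> ('s \<Rightarrow> 'h \<Rightarrow> 'h \<Rightarrow> 'h) \<Rightarrow> ('s, 's \<times> 'h \<times> 's) cat" where
  "structure_category S H e c =
    (let A = {(X, h, Y). X \<in> S \<and> Y \<in> S \<and> h \<in> H X Y} in
     \<lparr>Obj = S,
      Arr = A,
      Dom = (\<lambda>(X, h, Y) \<in> A. X),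
      Cod = (\<lambda>(X, h, Y) \<in> A. Y),
      Id = (\<lambda>X \<in> S. (X, e X, X)),
      Comp = (\<lambda>(Y', k, Z) (X, h, Y).
        if (X, h, Y) \<in> A \<and> (Y', k, Z) \<in> A \<and> Y = Y' then (X, c X k h, Z) else undefined)\<rparr>)"


section \<open>Contextual categories\<close>

text \<open>
  \<open>subst A f\<close> is the chosen pullback \<open>f\<^sup>*A\<close>, and \<open>lift A f : f\<^sup>*A \<rightarrow> A\<close> the top map of the
  chosen pullback square.
\<close>

record ('o, 'm) cxl =
  base :: "('o, 'm) cat"
  one :: 'o
  parent :: "'o \<Rightarrow> 'o"
  prj :: "'o \<Rightarrow> 'm"
  subst :: "'o \<Rightarrow> 'm \<Rightarrow> 'o"
  lift :: "'o \<Rightarrow> 'm \<Rightarrow> 'm"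

definition nonroot :: "('o, 'm) cxl \<Rightarrow> 'o set" where
  "nonroot X = Obj (base X) - {one X}"

definition into_parent :: "('o, 'm) cxl \<Rightarrow> 'o \<Rightarrow> 'm set" where
  "into_parent X A = {f \<in> Arr (base X). Cod (base X) f = parent X A}"

text \<open>
  The tree structure is given by the parent function on non-root objects. Every object reaches the
  root in finitely many steps; its height is finite, but heights need not be bounded.
\<close>

locale contextual_category = category "base X" for X :: "('o, 'm) cxl" +
  assumes one_terminal: "terminal (base X) (one X)"
    and parent_type: "parent X \<in> nonroot X \<rightarrow>\<^sub>E Obj (base X)"
    and finite_height:
      "A \<in> Obj (base X) \<Longrightarrow> (A, one X) \<in> {(B, parent X B) | B. B \<in> nonroot X}\<^sup>*"
    and prj_ext: "prj X \<in> extensional (nonroot X)"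
    and prj_type: "A \<in> nonroot X \<Longrightarrow> prj X A \<in> hom (base X) A (parent X A)"
    and subst_ext: "subst X \<in> extensional (nonroot X)"
    and subst_type: "A \<in> nonroot X \<Longrightarrow> subst X A \<in> into_parent X A \<rightarrow>\<^sub>E nonroot X"
    and parent_subst: "A \<in> nonroot X \<Longrightarrow> f \<in> into_parent X A \<Longrightarrow>
      parent X (subst X A f) = Dom (base X) f"
    and lift_ext: "lift X \<in> extensional (nonroot X)"
      "A \<in> nonroot X \<Longrightarrow> lift X A \<in> extensional (into_parent X A)"
    and lift_type: "A \<in> nonroot X \<Longrightarrow> f \<in> into_parent X A \<Longrightarrow>
      lift X A f \<in> hom (base X) (subst X A f) A"
    and chosen_pullback: "A \<in> nonroot X \<Longrightarrow> f \<in> into_parent X A \<Longrightarrow>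
      pullback_square (base X) (lift X A f) (prj X (subst X A f)) (prj X A) f"
    and subst_Id: "A \<in> nonroot X \<Longrightarrow> subst X A (Id (base X) (parent X A)) = A"
    and lift_Id: "A \<in> nonroot X \<Longrightarrow> lift X A (Id (base X) (parent X A)) = Id (base X) A"
    and subst_Comp: "A \<in> nonroot X \<Longrightarrow> f \<in> into_parent X A \<Longrightarrow>
      g \<in> Arr (base X) \<Longrightarrow> Cod (base X) g = Dom (base X) f \<Longrightarrow>
      subst X A (f \<cdot>\<^bsub>base X\<^esub> g) = subst X (subst X A f) g"
    and lift_Comp: "A \<in> nonroot X \<Longrightarrow> f \<in> into_parent X A \<Longrightarrow>
      g \<in> Arr (base X) \<Longrightarrow> Cod (base X) g = Dom (base X) f \<Longrightarrow>
      lift X A (f \<cdot>\<^bsub>base X\<^esub> g) = lift X A f \<cdot>\<^bsub>base X\<^esub> lift X (subst X A f) g"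

locale cxl_homomorphism = X: contextual_category X + Y: contextual_category Y +
    cat_functor "base X" "base Y" F
  for X :: "('o, 'm) cxl" and Y :: "('p, 'n) cxl" and F :: "('o, 'm, 'p, 'n) ftr" +
  assumes preserves_one: "fobj F (one X) = one Y"
    and preserves_nonroot: "A \<in> nonroot X \<Longrightarrow> fobj F A \<in> nonroot Y"
    and preserves_parent: "A \<in> nonroot X \<Longrightarrow> fobj F (parent X A) = parent Y (fobj F A)"
    and preserves_prj: "A \<in> nonroot X \<Longrightarrow> farr F (prj X A) = prj Y (fobj F A)"
    and preserves_subst: "A \<in> nonroot X \<Longrightarrow> f \<in> into_parent X A \<Longrightarrow>
      fobj F (subst X A f) = subst Y (fobj F A) (farr F f)"
    and preserves_lift: "A \<in> nonroot X \<Longrightarrow> f \<in> into_parent X A \<Longrightarrow>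
      farr F (lift X A f) = lift Y (fobj F A) (farr F f)"

type_synonym ('o, 'm) cxl_map = "('o, 'm, 'o, 'm) ftr"

type_synonym ('o, 'm) cxl_cat =
  "(('o, 'm) cxl, ('o, 'm) cxl \<times> ('o, 'm) cxl_map \<times> ('o, 'm) cxl) cat"

definition CxlCat :: "('o, 'm) cxl_cat" where
  "CxlCat = structure_category
    {X. contextual_category X}
    (\<lambda>X Y. {F. cxl_homomorphism X Y F})
    (\<lambda>X. id_functor (base X))
    (\<lambda>X. comp_functor (base X))"


section \<open>Iterated context extensions\<close>

text \<open>
  \<open>iterated_ext ty ext \<Gamma> [A\<^sub>0, \<dots>, A\<^sub>n\<^sub>-\<^sub>1] \<Delta>\<close> says that each \<open>A\<^sub>k\<close> is a type over
  \<open>\<Gamma>.A\<^sub>0\<dots>A\<^sub>k\<^sub>-\<^sub>1\<close> and \<open>\<Delta> = \<Gamma>.A\<^sub>0\<dots>A\<^sub>n\<^sub>-\<^sub>1\<close>.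
\<close>

fun iterated_ext ::
    "('o \<Rightarrow> 't set) \<Rightarrow> ('o \<Rightarrow> 't \<Rightarrow> 'o) \<Rightarrow> 'o \<Rightarrow> 't list \<Rightarrow> 'o \<Rightarrow> bool" where
  "iterated_ext ty ext \<Gamma> [] \<Delta> \<longleftrightarrow> \<Delta> = \<Gamma>"
| "iterated_ext ty ext \<Gamma> (A # As) \<Delta> \<longleftrightarrow> A \<in> ty \<Gamma> \<and> iterated_ext ty ext (ext \<Gamma> A) As \<Delta>"


section \<open>Categories with attributes\<close>

text \<open>A presheaf of sets: \<open>sec P a\<close> is the set \<open>P(a)\<close>, and \<open>res P f\<close> the action of \<open>f\<close>.\<close>

record ('o, 'm, 't) psh =
  sec :: "'o \<Rightarrow> 't set"
  res :: "'m \<Rightarrow> 't \<Rightarrow> 't"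

locale presheaf = category C for C :: "('o, 'm) cat" +
  fixes P :: "('o, 'm, 't) psh"
  assumes sec_ext: "sec P \<in> extensional (Obj C)"
    and res_ext: "res P \<in> extensional (Arr C)"
    and res_type: "f \<in> hom C a b \<Longrightarrow> res P f \<in> sec P b \<rightarrow>\<^sub>E sec P a"
    and res_Id: "a \<in> Obj C \<Longrightarrow> x \<in> sec P a \<Longrightarrow> res P (Id C a) x = x"
    and res_Comp: "f \<in> hom C a b \<Longrightarrow> g \<in> hom C b c \<Longrightarrow> x \<in> sec P c \<Longrightarrow>
      res P (g \<cdot>\<^bsub>C\<^esub> f) x = res P f (res P g x)"

text \<open>\<open>precomp_presheaf C Q F\<close> is \<open>Q \<circ> F\<^sup>o\<^sup>p\<close>, for a functor \<open>F\<close> out of \<open>C\<close>.\<close>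

definition precomp_presheaf ::
    "('o, 'm) cat \<Rightarrow> ('p, 'n, 't) psh \<Rightarrow> ('o, 'm, 'p, 'n) ftr \<Rightarrow> ('o, 'm, 't) psh" where
  "precomp_presheaf C Q F =
    \<lparr>sec = compose (Obj C) (sec Q) (fobj F), res = compose (Arr C) (res Q) (farr F)\<rparr>"

locale presheaf_map = P: presheaf C P + Q: presheaf C Q
  for C :: "('o, 'm) cat" and P :: "('o, 'm, 't) psh" and Q :: "('o, 'm, 's) psh" +
  fixes t :: "'o \<Rightarrow> 't \<Rightarrow> 's"
  assumes map_ext: "t \<in> extensional (Obj C)"
    and map_type: "a \<in> Obj C \<Longrightarrow> t a \<in> sec P a \<rightarrow>\<^sub>E sec Q a"
    and map_natural: "f \<in> hom C a b \<Longrightarrow> x \<in> sec P b \<Longrightarrow> t a (res P f x) = res Q f (t b x)"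

text \<open>
  The category of elements: an arrow from \<open>(a, y)\<close> to \<open>(b, x)\<close> is an \<open>f : a \<rightarrow> b\<close> with
  \<open>res P f x = y\<close>, and is represented by the pair \<open>(f, x)\<close>.
\<close>

definition elements :: "('o, 'm) cat \<Rightarrow> ('o, 'm, 't) psh \<Rightarrow> ('o \<times> 't, 'm \<times> 't) cat" where
  "elements C P =
    (let A = {(f, x). f \<in> Arr C \<and> x \<in> sec P (Cod C f)} in
     \<lparr>Obj = {(a, x). a \<in> Obj C \<and> x \<in> sec P a},
      Arr = A,
      Dom = (\<lambda>(f, x) \<in> A. (Dom C f, res P f x)),
      Cod = (\<lambda>(f, x) \<in> A. (Cod C f, x)),
      Id = (\<lambda>(a, x) \<in> {(a, x). a \<in> Obj C \<and> x \<in> sec P a}. (Id C a, x)),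
      Comp = (\<lambda>(g, y) (f, x).
        if (f, x) \<in> A \<and> (g, y) \<in> A \<and> Cod C f = Dom C g \<and> x = res P g y
        then (g \<cdot>\<^bsub>C\<^esub> f, y) else undefined)\<rparr>)"

definition elements_proj ::
    "('o, 'm) cat \<Rightarrow> ('o, 'm, 't) psh \<Rightarrow> ('o \<times> 't, 'm \<times> 't, 'o, 'm) ftr" where
  "elements_proj C P =
    \<lparr>fobj = restrict fst (Obj (elements C P)), farr = restrict fst (Arr (elements C P))\<rparr>"

text \<open>The functor between categories of elements induced by \<open>F : C \<rightarrow> C'\<close> and \<open>t : P \<rightarrow> P' \<circ> F\<^sup>o\<^sup>p\<close>.\<close>

definition elements_functor ::
    "('o, 'm) cat \<Rightarrow> ('o, 'm, 't) psh \<Rightarrow> ('o, 'm, 'p, 'n) ftr \<Rightarrow> ('o \<Rightarrow> 't \<Rightarrow> 's) \<Rightarrow>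
      ('o \<times> 't, 'm \<times> 't, 'p \<times> 's, 'n \<times> 's) ftr" where
  "elements_functor C P F t =
    \<lparr>fobj = (\<lambda>(a, x) \<in> Obj (elements C P). (fobj F a, t a x)),
     farr = (\<lambda>(f, x) \<in> Arr (elements C P). (farr F f, t (Cod C f) x))\<rparr>"

record ('o, 'm, 't) cwa =
  cbase :: "('o, 'm) cat"
  cty :: "('o, 'm, 't) psh"
  cext :: "('o \<times> 't, 'm \<times> 't, 'o, 'm) ftr"
  cprj :: "'o \<times> 't \<Rightarrow> 'm"

locale category_with_attributes =
  ty: presheaf "cbase X" "cty X" +
  ext: cat_functor "elements (cbase X) (cty X)" "cbase X" "cext X" +
  prj: natural_transformation "elements (cbase X) (cty X)" "cbase X"
    "cext X" "elements_proj (cbase X) (cty X)" "cprj X"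
  for X :: "('o, 'm, 't, 'z) cwa_scheme" +
  assumes naturality_square_pullback: "u \<in> hom (elements (cbase X) (cty X)) v w \<Longrightarrow>
    pullback_square (cbase X) (farr (cext X) u) (cprj X v) (cprj X w)
      (farr (elements_proj (cbase X) (cty X)) u)"

type_synonym ('o, 'm, 't, 'p, 'n, 's) cwa_map = "('o, 'm, 'p, 'n) ftr \<times> ('o \<Rightarrow> 't \<Rightarrow> 's)"

locale cwa_strict_map =
  X: category_with_attributes X + Y: category_with_attributes Y +
  base: cat_functor "cbase X" "cbase Y" "fst F" +
  types: presheaf_map "cbase X" "cty X" "precomp_presheaf (cbase X) (cty Y) (fst F)" "snd F"
  for X :: "('o, 'm, 't, 'z) cwa_scheme" and Y :: "('p, 'n, 's, 'y) cwa_scheme"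
    and F :: "('o, 'm, 't, 'p, 'n, 's) cwa_map" +
  assumes preserves_ext:
      "comp_functor (elements (cbase X) (cty X)) (cext Y)
         (elements_functor (cbase X) (cty X) (fst F) (snd F)) =
       comp_functor (elements (cbase X) (cty X)) (fst F) (cext X)"
    and preserves_prj: "v \<in> Obj (elements (cbase X) (cty X)) \<Longrightarrow>
      cprj Y (fobj (elements_functor (cbase X) (cty X) (fst F) (snd F)) v) =
      farr (fst F) (cprj X v)"

record ('o, 'm, 't) cxl_cwa = "('o, 'm, 't) cwa" +
  cone :: 'o

locale contextual_cwa = category_with_attributes X for X :: "('o, 'm, 't) cxl_cwa" +
  assumes one_terminal: "terminal (cbase X) (cone X)"
    and unique_iterated_ext: "\<Gamma> \<in> Obj (cbase X) \<Longrightarrow>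
      \<exists>!As. iterated_ext (sec (cty X)) (\<lambda>\<Gamma> A. fobj (cext X) (\<Gamma>, A)) (cone X) As \<Gamma>"

locale cxl_cwa_strict_map = X: contextual_cwa X + Y: contextual_cwa Y + cwa_strict_map X Y F
  for X :: "('o, 'm, 't) cxl_cwa" and Y :: "('p, 'n, 's) cxl_cwa"
    and F :: "('o, 'm, 't, 'p, 'n, 's) cwa_map" +
  assumes preserves_one: "fobj (fst F) (cone X) = cone Y"

definition id_cwa_map :: "('o, 'm, 't, 'z) cwa_scheme \<Rightarrow> ('o, 'm, 't, 'o, 'm, 't) cwa_map" where
  "id_cwa_map X =
    (id_functor (cbase X), \<lambda>a \<in> Obj (cbase X). \<lambda>A \<in> sec (cty X) a. A)"

definition comp_cwa_map ::
    "('o, 'm, 't, 'z) cwa_scheme \<Rightarrow> ('p, 'n, 's, 'q, 'k, 'r) cwa_map \<Rightarrow>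
      ('o, 'm, 't, 'p, 'n, 's) cwa_map \<Rightarrow> ('o, 'm, 't, 'q, 'k, 'r) cwa_map" where
  "comp_cwa_map X G F =
    (comp_functor (cbase X) (fst G) (fst F),
     \<lambda>a \<in> Obj (cbase X). \<lambda>A \<in> sec (cty X) a. snd G (fobj (fst F) a) (snd F a A))"

type_synonym ('o, 'm, 't) cxl_cwa_cat =
  "(('o, 'm, 't) cxl_cwa,
    ('o, 'm, 't) cxl_cwa \<times> ('o, 'm, 't, 'o, 'm, 't) cwa_map \<times> ('o, 'm, 't) cxl_cwa) cat"

definition CwA_cxl :: "('o, 'm, 't) cxl_cwa_cat" where
  "CwA_cxl = structure_category
    {X. contextual_cwa X}
    (\<lambda>X Y. {F. cxl_cwa_strict_map X Y F})
    id_cwa_map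
    comp_cwa_map"


section \<open>Comprehension categories\<close>

text \<open>
  In the arrow category, \<open>(f, (h, k), g)\<close> is the square from \<open>f\<close> to \<open>g\<close> with
  \<open>h : Dom f \<rightarrow> Dom g\<close>, \<open>k : Cod f \<rightarrow> Cod g\<close>, and \<open>g \<cdot> h = k \<cdot> f\<close>.
\<close>

type_synonym 'm square = "'m \<times> ('m \<times> 'm) \<times> 'm"

definition arrow_category :: "('o, 'm) cat \<Rightarrow> ('m, 'm square) cat" where
  "arrow_category C = structure_category
    (Arr C)
    (\<lambda>f g. {(h, k). h \<in> hom C (Dom C f) (Dom C g) \<and> k \<in> hom C (Cod C f) (Cod C g) \<and>
      g \<cdot>\<^bsub>C\<^esub> h = k \<cdot>\<^bsub>C\<^esub> f})
    (\<lambda>f. (Id C (Dom C f), Id C (Cod C f)))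
    (\<lambda>f (h', k') (h, k). (h' \<cdot>\<^bsub>C\<^esub> h, k' \<cdot>\<^bsub>C\<^esub> k))"

definition cod_functor :: "('o, 'm) cat \<Rightarrow> ('m, 'm square, 'o, 'm) ftr" where
  "cod_functor C =
    \<lparr>fobj = (\<lambda>f \<in> Obj (arrow_category C). Cod C f),
     farr = (\<lambda>(f, (h, k), g) \<in> Arr (arrow_category C). k)\<rparr>"

text \<open>\<open>arrow_functor C F : C\<^sup>\<rightarrow> \<rightarrow> D\<^sup>\<rightarrow>\<close> is induced by \<open>F : C \<rightarrow> D\<close>.\<close>

definition arrow_functor ::
    "('o, 'm) cat \<Rightarrow> ('o, 'm, 'p, 'n) ftr \<Rightarrow> ('m, 'm square, 'n, 'n square) ftr" where
  "arrow_functor C F =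
    \<lparr>fobj = restrict (farr F) (Obj (arrow_category C)),
     farr = (\<lambda>(f, (h, k), g) \<in> Arr (arrow_category C).
       (farr F f, (farr F h, farr F k), farr F g))\<rparr>"

definition is_pullback_square :: "('o, 'm) cat \<Rightarrow> 'm square \<Rightarrow> bool" where
  "is_pullback_square C = (\<lambda>(f, (h, k), g). pullback_square C h f g k)"

definition cartesian ::
    "('a, 'b) cat \<Rightarrow> ('o, 'm) cat \<Rightarrow> ('a, 'b, 'o, 'm) ftr \<Rightarrow> 'b \<Rightarrow> bool" where
  "cartesian T C p u \<longleftrightarrow> u \<in> Arr T \<and>
    (\<forall>Z \<in> Obj T. \<forall>v \<in> hom T Z (Cod T u). \<forall>w \<in> hom C (fobj p Z) (fobj p (Dom T u)).
      farr p v = farr p u \<cdot>\<^bsub>C\<^esub> w \<longrightarrow>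
      (\<exists>!w'. w' \<in> hom T Z (Dom T u) \<and> u \<cdot>\<^bsub>T\<^esub> w' = v \<and> farr p w' = w))"

locale fibration = cat_functor T C p
  for T :: "('a, 'b) cat" and C :: "('o, 'm) cat" and p :: "('a, 'b, 'o, 'm) ftr" +
  assumes cartesian_lift: "A \<in> Obj T \<Longrightarrow> f \<in> Arr C \<Longrightarrow> Cod C f = fobj p A \<Longrightarrow>
    \<exists>u. cartesian T C p u \<and> Cod T u = A \<and> farr p u = f"

locale discrete_fibration = cat_functor T C p
  for T :: "('a, 'b) cat" and C :: "('o, 'm) cat" and p :: "('a, 'b, 'o, 'm) ftr" +
  assumes unique_lift: "A \<in> Obj T \<Longrightarrow> f \<in> Arr C \<Longrightarrow> Cod C f = fobj p A \<Longrightarrow>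
    \<exists>!u. u \<in> Arr T \<and> Cod T u = A \<and> farr p u = f"

record ('o, 'm, 'a, 'b) compcat =
  kbase :: "('o, 'm) cat"
  ktotal :: "('a, 'b) cat"
  kfib :: "('a, 'b, 'o, 'm) ftr"
  kchi :: "('a, 'b, 'm, 'm square) ftr"

locale comprehension_category =
  fib: fibration "ktotal X" "kbase X" "kfib X" +
  chi: cat_functor "ktotal X" "arrow_category (kbase X)" "kchi X"
  for X :: "('o, 'm, 'a, 'b, 'z) compcat_scheme" +
  assumes cod_chi: "comp_functor (ktotal X) (cod_functor (kbase X)) (kchi X) = kfib X"
    and chi_cartesian: "cartesian (ktotal X) (kbase X) (kfib X) u \<Longrightarrow>
      is_pullback_square (kbase X) (farr (kchi X) u)"

type_synonym ('o, 'm, 'a, 'b, 'p, 'n, 'c, 'd) compcat_map =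
  "('o, 'm, 'p, 'n) ftr \<times> ('a, 'b, 'c, 'd) ftr"

locale compcat_strict_map =
  X: comprehension_category X + Y: comprehension_category Y +
  base: cat_functor "kbase X" "kbase Y" "fst F" +
  total: cat_functor "ktotal X" "ktotal Y" "snd F"
  for X :: "('o, 'm, 'a, 'b, 'z) compcat_scheme" and Y :: "('p, 'n, 'c, 'd, 'y) compcat_scheme"
    and F :: "('o, 'm, 'a, 'b, 'p, 'n, 'c, 'd) compcat_map" +
  assumes over_base: "comp_functor (ktotal X) (kfib Y) (snd F) = comp_functor (ktotal X) (fst F) (kfib X)"
    and preserves_cartesian: "cartesian (ktotal X) (kbase X) (kfib X) u \<Longrightarrow>
      cartesian (ktotal Y) (kbase Y) (kfib Y) (farr (snd F) u)"
    and preserves_chi: "comp_functor (ktotal X) (kchi Y) (snd F) =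
      comp_functor (ktotal X) (arrow_functor (kbase X) (fst F)) (kchi X)"

record ('o, 'm, 'a, 'b) cxl_compcat = "('o, 'm, 'a, 'b) compcat" +
  kone :: 'o

locale contextual_compcat = comprehension_category X
  for X :: "('o, 'm, 'a, 'b) cxl_compcat" +
  assumes one_terminal: "terminal (kbase X) (kone X)"
    and unique_iterated_ext: "\<Gamma> \<in> Obj (kbase X) \<Longrightarrow>
      \<exists>!As. iterated_ext (\<lambda>\<Gamma>. {A \<in> Obj (ktotal X). fobj (kfib X) A = \<Gamma>})
        (\<lambda>\<Gamma> A. Dom (kbase X) (fobj (kchi X) A)) (kone X) As \<Gamma>"

locale discrete_contextual_compcat = contextual_compcat X +
    discrete_fibration "ktotal X" "kbase X" "kfib X"
  for X :: "('o, 'm, 'a, 'b) cxl_compcat"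

locale cxl_compcat_strict_map =
    X: contextual_compcat X + Y: contextual_compcat Y + compcat_strict_map X Y F
  for X :: "('o, 'm, 'a, 'b) cxl_compcat" and Y :: "('p, 'n, 'c, 'd) cxl_compcat"
    and F :: "('o, 'm, 'a, 'b, 'p, 'n, 'c, 'd) compcat_map" +
  assumes preserves_one: "fobj (fst F) (kone X) = kone Y"

definition id_compcat_map ::
    "('o, 'm, 'a, 'b, 'z) compcat_scheme \<Rightarrow> ('o, 'm, 'a, 'b, 'o, 'm, 'a, 'b) compcat_map" where
  "id_compcat_map X = (id_functor (kbase X), id_functor (ktotal X))"

definition comp_compcat_map ::
    "('o, 'm, 'a, 'b, 'z) compcat_scheme \<Rightarrow> ('p, 'n, 'c, 'd, 'q, 'k, 'e, 'f) compcat_map \<Rightarrow>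
      ('o, 'm, 'a, 'b, 'p, 'n, 'c, 'd) compcat_map \<Rightarrow>
      ('o, 'm, 'a, 'b, 'q, 'k, 'e, 'f) compcat_map" where
  "comp_compcat_map X G F =
    (comp_functor (kbase X) (fst G) (fst F), comp_functor (ktotal X) (snd G) (snd F))"

type_synonym ('o, 'm, 'a, 'b) cxl_compcat_cat =
  "(('o, 'm, 'a, 'b) cxl_compcat,
    ('o, 'm, 'a, 'b) cxl_compcat \<times> ('o, 'm, 'a, 'b, 'o, 'm, 'a, 'b) compcat_map \<times>
      ('o, 'm, 'a, 'b) cxl_compcat) cat"

definition CompCat_disc_cxl :: "('o, 'm, 'a, 'b) cxl_compcat_cat" where
  "CompCat_disc_cxl = structure_category
    {X. discrete_contextual_compcat X}
    (\<lambda>X Y. {F. cxl_compcat_strict_map X Y F})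
    id_compcat_map
    comp_compcat_map"

end

theory Submission
  imports Defs
begin

text \<open>
  A contextual category determines types \<open>{A. parent A = \<Gamma>}\<close> over \<open>\<Gamma>\<close> with \<open>\<Gamma>.A = A\<close>. Conversely, in a
  contextual category with attributes, uniqueness of iterated context extensions makes every object
  other than \<open>1\<close> a context extension \<open>\<Gamma>.A\<close> for exactly one \<open>\<Gamma>\<close> and \<open>A\<close>, and \<open>\<Gamma>\<close> is taken as its parent.
  Forgetting the names of the types is then a functor to contextual categories; it is full and faithful
  because the action of a strict map on types is determined by its action on context extensions, and it is
  surjective on objects. A discrete comprehension category is treated in the same way, the types over
  \<open>\<Gamma>\<close> being the objects of the fibre, and substitution being given by the unique lifts. For surjectivity
  on objects in that case, the arrows of the total category, which are pairs of an arrow and an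
  object, have to be coded by single elements of the given type: a contextual category with a non-root
  object has infinitely many objects, which leaves room for them.
\<close>

section \<open>Functors and structure categories\<close>

text \<open>A contextual category does not remember how types are named, so the comparison is an
  equivalence and not an isomorphism of categories: its inverse picks one preimage of every
  contextual category. The preimages give the contextual category back exactly, not just up to
  isomorphism; hence one composite is the identity functor, and only the other needs a nontrivial
  natural isomorphism. What uniqueness of iterated extensions supplies is that context extension is
  injective and never yields \<open>1\<close>. The image of a type under a map can therefore be read
  off from the image of its extension, which gives both fullness and faithfulness. For comprehension
  categories, uniqueness of lifts takes over the part of the presheaf laws: it makes substitution
  strictly functorial and every arrow of the total category cartesian. The price is that a map also
  acts on arrows of the total category, and this action has to be rebuilt from lifts. A type serving
  as universe may be finite and thus not closed under pairs; hence the distinction by whether a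
  non-root object exists.\<close>

lemma homD:
  assumes "f \<in> hom C a b"
  shows "f \<in> Arr C" "Dom C f = a" "Cod C f = b"
  using assms by (simp_all add: hom_def)

context category
begin

lemma Dom_in: "f \<in> Arr C \<Longrightarrow> Dom C f \<in> Obj C"
  using Dom_type by auto

lemma Cod_in: "f \<in> Arr C \<Longrightarrow> Cod C f \<in> Obj C"
  using Cod_type by auto

lemma in_hom: "f \<in> Arr C \<Longrightarrow> f \<in> hom C (Dom C f) (Cod C f)"
  by (simp add: hom_def)

lemma hom_Obj:
  assumes "f \<in> hom C a b"
  shows "a \<in> Obj C" "b \<in> Obj C"
  using assms Dom_in Cod_in by (auto simp: hom_def)

lemma Id_simps:
  assumes "a \<in> Obj C"
  shows "Id C a \<in> Arr C" "Dom C (Id C a) = a" "Cod C (Id C a) = a"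
  using Id_type[OF assms] by (simp_all add: hom_def)

lemma Comp_simps:
  assumes "f \<in> Arr C" "g \<in> Arr C" "Cod C f = Dom C g"
  shows "g \<cdot>\<^bsub>C\<^esub> f \<in> Arr C" "Dom C (g \<cdot>\<^bsub>C\<^esub> f) = Dom C f" "Cod C (g \<cdot>\<^bsub>C\<^esub> f) = Cod C g"
  using Comp_type[of f "Dom C f" "Cod C f" g "Cod C g"] assms by (simp_all add: hom_def)

end

context cat_functor
begin

lemma fobj_in: "a \<in> Obj C \<Longrightarrow> fobj F a \<in> Obj D"
  using fobj_type by auto

lemma fobj_ext: "fobj F \<in> extensional (Obj C)"
  using fobj_type by (auto simp: PiE_def)

lemma farr_simps:
  assumes "f \<in> Arr C"
  shows "farr F f \<in> Arr D" "Dom D (farr F f) = fobj F (Dom C f)" "Cod D (farr F f) = fobj F (Cod C f)"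
  using farr_type[OF source.in_hom[OF assms]] by (simp_all add: hom_def)

lemma farr_Comp': "f \<in> Arr C \<Longrightarrow> g \<in> Arr C \<Longrightarrow> Cod C f = Dom C g \<Longrightarrow>
    farr F (g \<cdot>\<^bsub>C\<^esub> f) = farr F g \<cdot>\<^bsub>D\<^esub> farr F f"
  using farr_Comp source.in_hom by metis

end

text \<open>Functors are \<open>undefined\<close> off their source, so agreement on its objects and
  arrows is equality of records. The targets may differ, because the record does not mention
  them.\<close>

lemma functor_eqI:
  assumes "cat_functor C D F" "cat_functor C D' G"
    and "\<And>a. a \<in> Obj C \<Longrightarrow> fobj F a = fobj G a" "\<And>f. f \<in> Arr C \<Longrightarrow> farr F f = farr G f"
  shows "F = G"
proof -
  have "fobj F = fobj G"
    using assms(3) cat_functor.fobj_ext[OF assms(1)] cat_functor.fobj_ext[OF assms(2)]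
    by (meson extensionalityI)
  moreover have "farr F = farr G"
    using assms(4) cat_functor.farr_ext[OF assms(1)] cat_functor.farr_ext[OF assms(2)]
    by (meson extensionalityI)
  ultimately show ?thesis by simp
qed

lemma id_functor_simps [simp]:
  "a \<in> Obj C \<Longrightarrow> fobj (id_functor C) a = a"
  "f \<in> Arr C \<Longrightarrow> farr (id_functor C) f = f"
  by (simp_all add: id_functor_def)

lemma comp_functor_simps [simp]:
  "a \<in> Obj C \<Longrightarrow> fobj (comp_functor C G F) a = fobj G (fobj F a)"
  "f \<in> Arr C \<Longrightarrow> farr (comp_functor C G F) f = farr G (farr F f)"
  by (simp_all add: comp_functor_def compose_def)

lemma cat_functor_id:
  assumes "category C"
  shows "cat_functor C C (id_functor C)"
proof -
  interpret category C by fact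
  show ?thesis
  proof
    show "fobj (id_functor C) \<in> Obj C \<rightarrow>\<^sub>E Obj C" "farr (id_functor C) \<in> extensional (Arr C)"
      by (auto simp: id_functor_def)
  next
    fix f a b assume "f \<in> hom C a b"
    then show "farr (id_functor C) f \<in> hom C (fobj (id_functor C) a) (fobj (id_functor C) b)"
      using hom_Obj[of f a b] by (simp add: homD)
  next
    fix a assume "a \<in> Obj C"
    then show "farr (id_functor C) (Id C a) = Id C (fobj (id_functor C) a)"
      by (simp add: Id_simps)
  next
    fix f a b g c assume "f \<in> hom C a b" "g \<in> hom C b c"
    then show "farr (id_functor C) (g \<cdot>\<^bsub>C\<^esub> f) = farr (id_functor C) g \<cdot>\<^bsub>C\<^esub> farr (id_functor C) f"
      by (simp add: homD Comp_simps)
  qed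
qed

lemma cat_functor_comp:
  assumes "cat_functor C D F" "cat_functor D E G"
  shows "cat_functor C E (comp_functor C G F)"
proof -
  interpret F: cat_functor C D F by fact
  interpret G: cat_functor D E G by fact
  show ?thesis
  proof
    show "fobj (comp_functor C G F) \<in> Obj C \<rightarrow>\<^sub>E Obj E"
      using F.fobj_in G.fobj_in by (auto simp: comp_functor_def compose_def)
    show "farr (comp_functor C G F) \<in> extensional (Arr C)"
      by (simp add: comp_functor_def)
  next
    fix f a b assume f: "f \<in> hom C a b"
    then show "farr (comp_functor C G F) f \<in> hom E (fobj (comp_functor C G F) a) (fobj (comp_functor C G F) b)"
      using F.source.hom_Obj[OF f] F.farr_type G.farr_type by (simp add: homD(1))
  next
    fix a assume "a \<in> Obj C"
    then show "farr (comp_functor C G F) (Id C a) = Id E (fobj (comp_functor C G F) a)"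
      by (simp add: F.source.Id_simps F.farr_Id G.farr_Id F.fobj_in)
  next
    fix f a b g c assume fg: "f \<in> hom C a b" "g \<in> hom C b c"
    then show "farr (comp_functor C G F) (g \<cdot>\<^bsub>C\<^esub> f)
        = farr (comp_functor C G F) g \<cdot>\<^bsub>E\<^esub> farr (comp_functor C G F) f"
      using F.farr_Comp[OF fg] G.farr_Comp[OF F.farr_type F.farr_type, OF fg]
      by (simp add: homD F.source.Comp_simps)
  qed
qed

lemma comp_functor_id_left:
  assumes "cat_functor C D F"
  shows "comp_functor C (id_functor D) F = F"
proof (rule functor_eqI)
  interpret cat_functor C D F by fact
  show "cat_functor C D (comp_functor C (id_functor D) F)"
    by (rule cat_functor_comp[OF assms cat_functor_id]) (rule target.category_axioms)
  show "cat_functor C D F" by fact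
qed (use cat_functor.fobj_in[OF assms] cat_functor.farr_simps[OF assms] in simp_all)

lemma comp_functor_id_right:
  assumes "cat_functor C D F"
  shows "comp_functor C F (id_functor C) = F"
proof (rule functor_eqI)
  interpret cat_functor C D F by fact
  show "cat_functor C D (comp_functor C F (id_functor C))"
    by (rule cat_functor_comp[OF cat_functor_id assms]) (rule source.category_axioms)
  show "cat_functor C D F" by fact
qed (simp_all)

lemma comp_functor_assoc:
  assumes "cat_functor C D F" "cat_functor D E G" "cat_functor E B K"
  shows "comp_functor C (comp_functor D K G) F = comp_functor C K (comp_functor C G F)"
  by (rule functor_eqI[where C = C])
    (use assms cat_functor.fobj_in[OF assms(1)] cat_functor.farr_simps[OF assms(1)]
      in \<open>auto intro!: cat_functor_comp\<close>)

section \<open>Categories of structures, and a criterion for their equivalence\<close>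

lemma structure_category_simps:
  "Obj (structure_category S H e c) = S"
  "(X, h, Y) \<in> Arr (structure_category S H e c) \<longleftrightarrow> X \<in> S \<and> Y \<in> S \<and> h \<in> H X Y"
  "X \<in> S \<Longrightarrow> Y \<in> S \<Longrightarrow> h \<in> H X Y \<Longrightarrow> Dom (structure_category S H e c) (X, h, Y) = X"
  "X \<in> S \<Longrightarrow> Y \<in> S \<Longrightarrow> h \<in> H X Y \<Longrightarrow> Cod (structure_category S H e c) (X, h, Y) = Y"
  "X \<in> S \<Longrightarrow> Id (structure_category S H e c) X = (X, e X, X)"
  "X \<in> S \<Longrightarrow> Y \<in> S \<Longrightarrow> Z \<in> S \<Longrightarrow> h \<in> H X Y \<Longrightarrow> k \<in> H Y Z \<Longrightarrow>
    Comp (structure_category S H e c) (Y, k, Z) (X, h, Y) = (X, c X k h, Z)"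
  by (simp_all add: structure_category_def Let_def)

lemma structure_category_hom:
  "u \<in> hom (structure_category S H e c) X Y \<longleftrightarrow> X \<in> S \<and> Y \<in> S \<and> (\<exists>h \<in> H X Y. u = (X, h, Y))"
  by (auto simp: hom_def structure_category_def Let_def)

text \<open>Serves for the three categories of the theorem and also for arrow categories, so that
  source and target bookkeeping is done once.\<close>

lemma structure_category_category:
  assumes "\<And>X. X \<in> S \<Longrightarrow> e X \<in> H X X"
    and "\<And>X Y Z h k. X \<in> S \<Longrightarrow> Y \<in> S \<Longrightarrow> Z \<in> S \<Longrightarrow> h \<in> H X Y \<Longrightarrow> k \<in> H Y Z \<Longrightarrow> c X k h \<in> H X Z"
    and "\<And>X Y h. X \<in> S \<Longrightarrow> Y \<in> S \<Longrightarrow> h \<in> H X Y \<Longrightarrow> c X (e Y) h = h"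
    and "\<And>X Y h. X \<in> S \<Longrightarrow> Y \<in> S \<Longrightarrow> h \<in> H X Y \<Longrightarrow> c X h (e X) = h"
    and "\<And>X Y Z W h k l. X \<in> S \<Longrightarrow> Y \<in> S \<Longrightarrow> Z \<in> S \<Longrightarrow> W \<in> S \<Longrightarrow> h \<in> H X Y \<Longrightarrow> k \<in> H Y Z \<Longrightarrow>
      l \<in> H Z W \<Longrightarrow> c X (c Y l k) h = c X l (c X k h)"
  shows "category (structure_category S H e c)"
proof
  show "Dom (structure_category S H e c) \<in> Arr (structure_category S H e c) \<rightarrow>\<^sub>E Obj (structure_category S H e c)"
    "Cod (structure_category S H e c) \<in> Arr (structure_category S H e c) \<rightarrow>\<^sub>E Obj (structure_category S H e c)"
    "Id (structure_category S H e c) \<in> extensional (Obj (structure_category S H e c))"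
    by (auto simp: structure_category_def Let_def)
next
  fix f g assume "\<not> (f \<in> Arr (structure_category S H e c) \<and> g \<in> Arr (structure_category S H e c) \<and>
    Cod (structure_category S H e c) f = Dom (structure_category S H e c) g)"
  then show "Comp (structure_category S H e c) g f = undefined"
    by (cases f; cases g) (auto simp: structure_category_def Let_def)
qed (auto simp: structure_category_hom structure_category_simps assms)

text \<open>Full, faithful and surjective on objects implies equivalence. A single \<open>m\<close>
  for all hom-sets is enough because it will be \<open>fst\<close>, the passage to the base functor.
  Surjectivity on the nose gives a section \<open>r\<close> of \<open>q\<close>, whence
  \<open>comp_functor ?D G F\<close> is the identity.\<close>

lemma equivalent_if_fully_faithful_surjective:
  fixes S :: "'s set" and S' :: "'t set"
  assumes cat: "category (structure_category S H e c)" 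
    and cat': "category (structure_category S' H' e' c')" 
    and q: "q ` S = S'"
    and m: "\<And>X Y. X \<in> S \<Longrightarrow> Y \<in> S \<Longrightarrow> bij_betw m (H X Y) (H' (q X) (q Y))"
    and m_id: "\<And>X. X \<in> S \<Longrightarrow> m (e X) = e' (q X)"
    and m_comp: "\<And>X Y Z h k. X \<in> S \<Longrightarrow> Y \<in> S \<Longrightarrow> Z \<in> S \<Longrightarrow> h \<in> H X Y \<Longrightarrow> k \<in> H Y Z \<Longrightarrow>
      m (c X k h) = c' (q X) (m k) (m h)"
  shows "equivalent_categories (structure_category S' H' e' c') (structure_category S H e c)"
proof -
  let ?C = "structure_category S H e c"
  let ?D = "structure_category S' H' e' c'"
  interpret C: category ?C by fact
  interpret D: category ?D by fact
  define r where "r = inv_into S q"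
  have r: "r V \<in> S" "q (r V) = V" if "V \<in> S'" for V
    using that q by (auto simp: r_def inv_into_into f_inv_into_f)
  have qS: "q X \<in> S'" if "X \<in> S" for X using that q by auto
  define n where "n X Y = inv_into (H X Y) m" for X Y
  have n: "n X Y h \<in> H X Y" "m (n X Y h) = h" if "X \<in> S" "Y \<in> S" "h \<in> H' (q X) (q Y)" for X Y h
    using m[OF that(1,2)] that(3) by (auto simp: n_def bij_betw_def inv_into_into f_inv_into_f)
  have mH: "m h \<in> H' (q X) (q Y)" if "X \<in> S" "Y \<in> S" "h \<in> H X Y" for X Y h
    using m[OF that(1,2)] that(3) by (auto simp: bij_betw_def)
  have m_inj: "h = k" if "m h = m k" "X \<in> S" "Y \<in> S" "h \<in> H X Y" "k \<in> H X Y" for X Y h k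
    using m[OF that(2,3)] that by (auto simp: bij_betw_def inj_on_def)
  \<comment> \<open>The typing and unit laws of \<open>e\<close>, \<open>c\<close>,
    \<open>e'\<close> and \<open>c'\<close> are extracted from the assumption that the two structure
    categories are categories.\<close>
  have e: "e X \<in> H X X" if "X \<in> S" for X
    using C.Id_type[of X] that by (simp add: structure_category_simps structure_category_hom)
  have e': "e' X \<in> H' X X" if "X \<in> S'" for X
    using D.Id_type[of X] that by (simp add: structure_category_simps structure_category_hom)
  have c: "c X k h \<in> H X Z" if "X \<in> S" "Y \<in> S" "Z \<in> S" "h \<in> H X Y" "k \<in> H Y Z" for X Y Z h k
    using C.Comp_type[of "(X, h, Y)" X Y "(Y, k, Z)" Z] that
    by (simp add: structure_category_simps structure_category_hom)
  have c': "c' X k h \<in> H' X Z" if "X \<in> S'" "Y \<in> S'" "Z \<in> S'" "h \<in> H' X Y" "k \<in> H' Y Z" for X Y Z h k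
    using D.Comp_type[of "(X, h, Y)" X Y "(Y, k, Z)" Z] that
    by (simp add: structure_category_simps structure_category_hom)
  have eL: "c' X (e' Y) h = h" "c' X h (e' X) = h" if "X \<in> S'" "Y \<in> S'" "h \<in> H' X Y" for X Y h
    using D.Id_left[of "(X, h, Y)" X Y] D.Id_right[of "(X, h, Y)" X Y] that e'
    by (simp_all add: structure_category_simps structure_category_hom)
  define G where "G = \<lparr>fobj = (\<lambda>X \<in> S. q X), farr = (\<lambda>(X, h, Y) \<in> Arr ?C. (q X, m h, q Y))\<rparr>"
  define F where "F = \<lparr>fobj = (\<lambda>V \<in> S'. r V),
    farr = (\<lambda>(V, h, W) \<in> Arr ?D. (r V, n (r V) (r W) h, r W))\<rparr>"
  \<comment> \<open>Both \<open>r (q X)\<close> and \<open>X\<close> lie over \<open>q X\<close>, so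
    the identity of \<open>q X\<close> has preimages under \<open>m\<close> in both directions.
    These are \<epsilon> and its inverse \<epsilon>'.\<close>
  define \<epsilon> where "\<epsilon> = (\<lambda>X \<in> S. (r (q X), n (r (q X)) X (e' (q X)), X))"
  define \<epsilon>' where "\<epsilon>' X = (X, n X (r (q X)) (e' (q X)), r (q X))" for X
  define \<eta> where "\<eta> = (\<lambda>V \<in> S'. Id ?D V)"
  \<comment> \<open>By faithfulness, preimages under \<open>m\<close> compose as their images do.
    Functoriality of \<open>F\<close> and naturality and invertibility of \<epsilon> all reduce to
    this.\<close>
  have nc: "n X Z (c' (q X) k h) = c X (n Y Z k) (n X Y h)"
    if "X \<in> S" "Y \<in> S" "Z \<in> S" "h \<in> H' (q X) (q Y)" "k \<in> H' (q Y) (q Z)" for X Y Z h k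
  proof (rule m_inj[of _ _ X Z])
    have "c' (q X) k h \<in> H' (q X) (q Z)"
      using c'[of "q X" "q Y" "q Z"] that qS by auto
    then show "n X Z (c' (q X) k h) \<in> H X Z" "m (n X Z (c' (q X) k h)) = m (c X (n Y Z k) (n X Y h))"
      using n that m_comp[of X Y Z "n X Y h" "n Y Z k"] by auto
    show "c X (n Y Z k) (n X Y h) \<in> H X Z"
      using c[of X Y Z] n that by auto
  qed (use that in auto)
  have ne: "n X X (e' (q X)) = e X" if "X \<in> S" for X
    by (rule m_inj[of _ _ X X]) (use that n e e' qS m_id in auto)
  have ner: "n (r V) (r V) (e' V) = e (r V)" if "V \<in> S'" for V
    using ne[of "r V"] r that by simp
  have nm: "n X Y (m h) = h" if "X \<in> S" "Y \<in> S" "h \<in> H X Y" for X Y h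
    by (rule m_inj[of _ _ X Y]) (use that n mH in auto)
  have G: "cat_functor ?C ?D G"
  proof
    show "fobj G \<in> Obj ?C \<rightarrow>\<^sub>E Obj ?D" "farr G \<in> extensional (Arr ?C)"
      using qS by (auto simp: G_def structure_category_simps)
  qed (auto simp: G_def structure_category_simps structure_category_hom qS mH e c m_id m_comp)
  have F: "cat_functor ?D ?C F"
  proof
    show "fobj F \<in> Obj ?D \<rightarrow>\<^sub>E Obj ?C" "farr F \<in> extensional (Arr ?D)"
      using r by (auto simp: F_def structure_category_simps)
  next
    fix f g a b d assume "f \<in> hom ?D a b" "g \<in> hom ?D b d"
    then show "farr F (Comp ?D g f) = Comp ?C (farr F g) (farr F f)"
      using r n nc[of "r a" "r b" "r d"] c'
      by (auto simp: F_def structure_category_simps structure_category_hom)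
  qed (use r n ner in \<open>auto simp: F_def structure_category_simps structure_category_hom e'\<close>)
  have GF: "comp_functor ?D G F = id_functor ?D"
  proof (rule functor_eqI[OF cat_functor_comp[OF F G] cat_functor_id[OF cat']])
    fix f assume "f \<in> Arr ?D"
    then show "farr (comp_functor ?D G F) f = farr (id_functor ?D) f"
      using r n by (cases f) (auto simp: structure_category_simps G_def F_def)
  qed (use r in \<open>auto simp: structure_category_simps G_def F_def\<close>)
  have \<eta>: "natural_isomorphism ?D ?D (id_functor ?D) (comp_functor ?D G F) \<eta>"
    unfolding GF
  proof (intro_locales; (rule cat_functor.axioms[OF cat_functor_id[OF cat']])?)
    show "natural_transformation_axioms ?D ?D (id_functor ?D) (id_functor ?D) \<eta>"
      by standard (auto simp: \<eta>_def structure_category_simps structure_category_hom e' eL)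
    show "natural_isomorphism_axioms ?D ?D \<eta>"
    proof
      fix V assume "V \<in> Obj ?D"
      then show "isomorphism ?D (\<eta> V)"
        unfolding isomorphism_def
        by (auto intro!: bexI[of _ "Id ?D V"]
            simp: \<eta>_def structure_category_simps structure_category_hom e' eL)
    qed
  qed
  have rq: "r (q X) \<in> S" "q (r (q X)) = q X" if "X \<in> S" for X using that r qS by auto
  have \<epsilon>: "natural_isomorphism ?C ?C (comp_functor ?C F G) (id_functor ?C) \<epsilon>"
  proof (intro_locales; (rule cat_functor.axioms[OF cat_functor_id[OF cat]]
        cat_functor.axioms[OF cat_functor_comp[OF G F]])?)
    show "natural_transformation_axioms ?C ?C (comp_functor ?C F G) (id_functor ?C) \<epsilon>"
    proof
      show "\<epsilon> \<in> extensional (Obj ?C)" by (auto simp: \<epsilon>_def structure_category_simps)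
    next
      fix X assume "X \<in> Obj ?C"
      then show "\<epsilon> X \<in> hom ?C (fobj (comp_functor ?C F G) X) (fobj (id_functor ?C) X)"
        using rq[of X] n(1)[of "r (q X)" X "e' (q X)"] e' qS
        by (auto simp: \<epsilon>_def F_def G_def structure_category_simps structure_category_hom)
    next
      fix f X Y assume "f \<in> hom ?C X Y"
      then obtain h where f: "f = (X, h, Y)" "X \<in> S" "Y \<in> S" "h \<in> H X Y"
        by (auto simp: structure_category_hom)
      have 1: "n (r (q X)) X (e' (q X)) \<in> H (r (q X)) X" "n (r (q Y)) Y (e' (q Y)) \<in> H (r (q Y)) Y"
        "n (r (q X)) (r (q Y)) (m h) \<in> H (r (q X)) (r (q Y))"
        using f n(1) rq e' qS mH by auto
      have "c (r (q X)) (n (r (q Y)) Y (e' (q Y))) (n (r (q X)) (r (q Y)) (m h))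
        = n (r (q X)) Y (c' (q X) (e' (q Y)) (m h))"
        using nc[of "r (q X)" "r (q Y)" Y "m h" "e' (q Y)"] f rq e' qS mH by auto
      moreover have "c (r (q X)) h (n (r (q X)) X (e' (q X)))
        = n (r (q X)) Y (c' (q X) (m h) (e' (q X)))"
        using nc[of "r (q X)" X Y "e' (q X)" "m h"] nm[of X Y h] f rq e' qS mH by auto
      ultimately show "\<epsilon> Y \<cdot>\<^bsub>?C\<^esub> farr (comp_functor ?C F G) f = farr (id_functor ?C) f \<cdot>\<^bsub>?C\<^esub> \<epsilon> X"
        using f 1 rq qS mH eL[of "q X" "q Y" "m h"]
        by (simp add: \<epsilon>_def F_def G_def structure_category_simps)
    qed
    show "natural_isomorphism_axioms ?C ?C \<epsilon>"
    proof
      fix X assume "X \<in> Obj ?C"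
      then have X: "X \<in> S" by (simp add: structure_category_simps)
      have 1: "n (r (q X)) X (e' (q X)) \<in> H (r (q X)) X" "n X (r (q X)) (e' (q X)) \<in> H X (r (q X))"
        using X n(1) rq e' qS by auto
      have "c X (n (r (q X)) X (e' (q X))) (n X (r (q X)) (e' (q X))) = e X"
        using nc[of X "r (q X)" X "e' (q X)" "e' (q X)"] X rq e' qS eL(1)[of "q X" "q X" "e' (q X)"] ne
        by simp
      moreover have "c (r (q X)) (n X (r (q X)) (e' (q X))) (n (r (q X)) X (e' (q X))) = e (r (q X))"
        using nc[of "r (q X)" X "r (q X)" "e' (q X)" "e' (q X)"] X rq e' qS
          eL(1)[of "q X" "q X" "e' (q X)"] ne[of "r (q X)"]
        by simp
      ultimately show "isomorphism ?C (\<epsilon> X)"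
        unfolding isomorphism_def using X 1 rq
        by (intro conjI bexI[of _ "\<epsilon>' X"])
          (auto simp: \<epsilon>_def \<epsilon>'_def structure_category_simps structure_category_hom)
    qed
  qed
  show ?thesis
    unfolding equivalent_categories_def using cat cat' F G \<eta> \<epsilon> by blast
qed

section \<open>Unpacked attribute structures\<close>

text \<open>\<open>iterated_ext\<close> recurses from the root end of the list, whereas the parent
  of an object is found by removing the last type.\<close>

lemma iterated_ext_snoc:
  "iterated_ext ty ext a (As @ [A]) b \<longleftrightarrow> (\<exists>c. iterated_ext ty ext a As c \<and> A \<in> ty c \<and> b = ext c A)"
  by (induction As arbitrary: a) auto

lemma iterated_ext_functional:
  "iterated_ext ty ext a As b \<Longrightarrow> iterated_ext ty ext a As c \<Longrightarrow> b = c"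
  by (induction As arbitrary: a) auto

lemma iterated_ext_closed:
  assumes "\<And>a A. a \<in> S \<Longrightarrow> A \<in> ty a \<Longrightarrow> ext a A \<in> S"
  shows "iterated_ext ty ext a As b \<Longrightarrow> a \<in> S \<Longrightarrow> b \<in> S"
  by (induction As arbitrary: a) (use assms in auto)

text \<open>
  Both categories with attributes and discrete comprehension categories are turned into the
  elementary form below, in which neither a category of elements nor a total category occurs.
\<close>

record ('o, 'm, 't) attr =
  abase :: "('o, 'm) cat"
  aone :: 'o
  aty :: "'o \<Rightarrow> 't set"
  ares :: "'m \<Rightarrow> 't \<Rightarrow> 't"
  aext :: "'o \<Rightarrow> 't \<Rightarrow> 'o"
  aprj :: "'o \<Rightarrow> 't \<Rightarrow> 'm"
  alift :: "'m \<Rightarrow> 't \<Rightarrow> 'm"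

text \<open>No extensionality is imposed: only values on the intended domains matter here, and
  \<open>cxl_of\<close> restricts its operations again.\<close>

locale attributes = category "abase D" for D :: "('o, 'm, 't) attr" +
  assumes terminal_one: "terminal (abase D) (aone D)"
    and ext_in: "a \<in> Obj (abase D) \<Longrightarrow> A \<in> aty D a \<Longrightarrow> aext D a A \<in> Obj (abase D)"
    and prj_in: "a \<in> Obj (abase D) \<Longrightarrow> A \<in> aty D a \<Longrightarrow> aprj D a A \<in> hom (abase D) (aext D a A) a"
    and res_in: "f \<in> hom (abase D) a b \<Longrightarrow> A \<in> aty D b \<Longrightarrow> ares D f A \<in> aty D a"
    and res_Id: "a \<in> Obj (abase D) \<Longrightarrow> A \<in> aty D a \<Longrightarrow> ares D (Id (abase D) a) A = A"
    and res_Comp: "f \<in> hom (abase D) a b \<Longrightarrow> g \<in> hom (abase D) b c \<Longrightarrow> A \<in> aty D c \<Longrightarrow>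
      ares D (g \<cdot>\<^bsub>abase D\<^esub> f) A = ares D f (ares D g A)"
    and lift_in: "f \<in> hom (abase D) a b \<Longrightarrow> A \<in> aty D b \<Longrightarrow>
      alift D f A \<in> hom (abase D) (aext D a (ares D f A)) (aext D b A)"
    and lift_Id: "a \<in> Obj (abase D) \<Longrightarrow> A \<in> aty D a \<Longrightarrow>
      alift D (Id (abase D) a) A = Id (abase D) (aext D a A)"
    and lift_Comp: "f \<in> hom (abase D) a b \<Longrightarrow> g \<in> hom (abase D) b c \<Longrightarrow> A \<in> aty D c \<Longrightarrow>
      alift D (g \<cdot>\<^bsub>abase D\<^esub> f) A = alift D g A \<cdot>\<^bsub>abase D\<^esub> alift D f (ares D g A)"
    and pullback: "f \<in> hom (abase D) a b \<Longrightarrow> A \<in> aty D b \<Longrightarrow>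
      pullback_square (abase D) (alift D f A) (aprj D a (ares D f A)) (aprj D b A) f"
    and unique_ext: "a \<in> Obj (abase D) \<Longrightarrow> \<exists>!As. iterated_ext (aty D) (aext D) (aone D) As a"
begin

lemma one_in: "aone D \<in> Obj (abase D)"
  using terminal_one by (simp add: terminal_def)

lemma list_Obj: "iterated_ext (aty D) (aext D) (aone D) As a \<Longrightarrow> a \<in> Obj (abase D)"
  by (rule iterated_ext_closed[where S = "Obj (abase D)"]) (use ext_in one_in in auto)

text \<open>Append \<open>A\<close> and \<open>B\<close> to the lists reaching \<open>a\<close> and
  \<open>b\<close>. Both results reach the same object, so they are the same list; its last entry is
  \<open>A = B\<close>, and its initial part reaches both \<open>a\<close> and
  \<open>b\<close>.\<close>

lemma ext_inject:
  assumes "a \<in> Obj (abase D)" "A \<in> aty D a" "b \<in> Obj (abase D)" "B \<in> aty D b"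
    and eq: "aext D a A = aext D b B"
  shows "a = b \<and> A = B"
proof -
  obtain As Bs where l: "iterated_ext (aty D) (aext D) (aone D) As a"
    "iterated_ext (aty D) (aext D) (aone D) Bs b"
    using unique_ext assms(1,3) by blast
  then have "iterated_ext (aty D) (aext D) (aone D) (As @ [A]) (aext D a A)"
    "iterated_ext (aty D) (aext D) (aone D) (Bs @ [B]) (aext D a A)"
    using assms by (auto simp: iterated_ext_snoc)
  then have "As @ [A] = Bs @ [B]"
    using unique_ext[OF ext_in[OF assms(1,2)]] by blast
  then show ?thesis
    using l iterated_ext_functional by fastforce
qed

text \<open>Otherwise \<open>aone D\<close> would be reached by a nonempty list as well as by the
  empty one.\<close>

lemma ext_not_one:
  assumes "a \<in> Obj (abase D)" "A \<in> aty D a"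
  shows "aext D a A \<noteq> aone D"
proof
  assume eq: "aext D a A = aone D"
  obtain As where "iterated_ext (aty D) (aext D) (aone D) As a"
    using unique_ext assms(1) by blast
  then have "iterated_ext (aty D) (aext D) (aone D) (As @ [A]) (aone D)"
    using assms eq by (auto simp: iterated_ext_snoc)
  moreover have "iterated_ext (aty D) (aext D) (aone D) [] (aone D)" by simp
  ultimately show False using unique_ext[OF one_in] by blast
qed

lemma nonroot_cases:
  assumes "B \<in> Obj (abase D)" "B \<noteq> aone D"
  obtains a A where "a \<in> Obj (abase D)" "A \<in> aty D a" "B = aext D a A"
proof -
  obtain As where As: "iterated_ext (aty D) (aext D) (aone D) As B"
    using unique_ext assms(1) by blast
  moreover have "As \<noteq> []" using As assms(2) by auto
  ultimately obtain As' A where "iterated_ext (aty D) (aext D) (aone D) (As' @ [A]) B"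
    by (metis append_butlast_last_id)
  then show ?thesis using that list_Obj by (auto simp: iterated_ext_snoc)
qed

end

section \<open>The contextual category of an attribute structure\<close>

definition last_ext :: "('o, 'm, 't) attr \<Rightarrow> 'o \<Rightarrow> 'o \<times> 't" where
  "last_ext D B = (THE v. fst v \<in> Obj (abase D) \<and> snd v \<in> aty D (fst v) \<and> aext D (fst v) (snd v) = B)"

text \<open>Injectivity of extension makes the description unique. On \<open>aone D\<close> the
  description is unspecified, but \<open>cxl_of\<close> consults \<open>last_ext\<close> only within
  restrictions to the other objects.\<close>

lemma (in attributes) last_ext:
  assumes "a \<in> Obj (abase D)" "A \<in> aty D a"
  shows "last_ext D (aext D a A) = (a, A)"
  unfolding last_ext_def by (rule the_equality) (use assms ext_inject in force)+

text \<open>\<open>I B\<close> is the set of arrows into the parent of \<open>B\<close>. All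
  operations are restricted to their intended domains, so that equality with a given contextual
  category can hold literally.\<close>

definition cxl_of :: "('o, 'm, 't) attr \<Rightarrow> ('o, 'm) cxl" where
  "cxl_of D = (let N = Obj (abase D) - {aone D};
      I = (\<lambda>B. {f \<in> Arr (abase D). Cod (abase D) f = fst (last_ext D B)}) in
    \<lparr>base = abase D,
     one = aone D,
     parent = (\<lambda>B \<in> N. fst (last_ext D B)),
     prj = (\<lambda>B \<in> N. case_prod (aprj D) (last_ext D B)),
     subst = (\<lambda>B \<in> N. \<lambda>f \<in> I B. aext D (Dom (abase D) f) (ares D f (snd (last_ext D B)))),
     lift = (\<lambda>B \<in> N. \<lambda>f \<in> I B. alift D f (snd (last_ext D B)))\<rparr>)"

lemma cxl_of_simps:
  "base (cxl_of D) = abase D"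
  "one (cxl_of D) = aone D"
  "nonroot (cxl_of D) = Obj (abase D) - {aone D}"
  by (simp_all add: cxl_of_def Let_def nonroot_def)

context attributes
begin

lemma cxl_of_ext_simps:
  assumes "b \<in> Obj (abase D)" "A \<in> aty D b"
  shows "parent (cxl_of D) (aext D b A) = b"
    and "prj (cxl_of D) (aext D b A) = aprj D b A"
    and "into_parent (cxl_of D) (aext D b A) = {f \<in> Arr (abase D). Cod (abase D) f = b}"
    and "f \<in> hom (abase D) a b \<Longrightarrow> subst (cxl_of D) (aext D b A) f = aext D a (ares D f A)"
    and "f \<in> hom (abase D) a b \<Longrightarrow> lift (cxl_of D) (aext D b A) f = alift D f A"
  using assms ext_in ext_not_one
  by (auto simp: cxl_of_def Let_def into_parent_def last_ext hom_def)

lemma cxl_nonroot_cases: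
  assumes "B \<in> nonroot (cxl_of D)"
  obtains a A where "a \<in> Obj (abase D)" "A \<in> aty D a" "B = aext D a A"
  using assms nonroot_cases by (auto simp: cxl_of_simps)

lemma cxl_into_parent_hom:
  assumes "f \<in> into_parent (cxl_of D) (aext D b A)" "b \<in> Obj (abase D)" "A \<in> aty D b"
  shows "f \<in> hom (abase D) (Dom (abase D) f) b"
  using assms by (simp add: cxl_of_ext_simps hom_def)

lemma ext_nonroot: "a \<in> Obj (abase D) \<Longrightarrow> A \<in> aty D a \<Longrightarrow> aext D a A \<in> nonroot (cxl_of D)"
  by (simp add: cxl_of_simps ext_in ext_not_one)

text \<open>Writing each non-root object as \<open>aext D b A\<close> turns the axioms into those of
  \<open>attributes\<close>; only finite height needs an argument of its own.\<close>

lemma contextual_cxl_of: "contextual_category (cxl_of D)"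
proof -
  note S = cxl_of_simps cxl_of_ext_simps
  have "category (base (cxl_of D))" by (simp add: S category_axioms)
  moreover have "contextual_category_axioms (cxl_of D)"
  proof
    show "terminal (base (cxl_of D)) (one (cxl_of D))" by (simp add: S terminal_one)
    show "parent (cxl_of D) \<in> nonroot (cxl_of D) \<rightarrow>\<^sub>E Obj (base (cxl_of D))"
    proof (rule PiE_I)
      fix B assume "B \<in> nonroot (cxl_of D)"
      then show "parent (cxl_of D) B \<in> Obj (base (cxl_of D))"
        by (rule cxl_nonroot_cases) (simp add: S)
    qed (auto simp: cxl_of_def Let_def nonroot_def)
    show "prj (cxl_of D) \<in> extensional (nonroot (cxl_of D))"
      "subst (cxl_of D) \<in> extensional (nonroot (cxl_of D))"
      "lift (cxl_of D) \<in> extensional (nonroot (cxl_of D))"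
      by (simp_all add: cxl_of_def Let_def nonroot_def)
  next
    fix B assume B: "B \<in> Obj (base (cxl_of D))"
    \<comment> \<open>Passing to the parent removes the last type from the list, so induction on the
      list from its end yields the path to the root.\<close>
    have "(b, aone D) \<in> {(B, parent (cxl_of D) B) |B. B \<in> nonroot (cxl_of D)}\<^sup>*"
      if "iterated_ext (aty D) (aext D) (aone D) As b" for As b
      using that
    proof (induction As arbitrary: b rule: rev_induct)
      case (snoc A As)
      then obtain c where c: "iterated_ext (aty D) (aext D) (aone D) As c" "A \<in> aty D c" "b = aext D c A"
        by (auto simp: iterated_ext_snoc)
      have "c \<in> Obj (abase D)" using c list_Obj by auto
      then have "(b, c) \<in> {(B, parent (cxl_of D) B) |B. B \<in> nonroot (cxl_of D)}"
        using c ext_nonroot by (auto simp: S)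
      then show ?case using snoc.IH[OF c(1)] by (rule converse_rtrancl_into_rtrancl)
    qed simp
    then show "(B, one (cxl_of D)) \<in> {(B, parent (cxl_of D) B) |B. B \<in> nonroot (cxl_of D)}\<^sup>*"
      using unique_ext[of B] B unfolding S(1,2) by blast
  next
    fix B assume B: "B \<in> nonroot (cxl_of D)"
    then obtain b A where A: "b \<in> Obj (abase D)" "A \<in> aty D b" "B = aext D b A"
      by (rule cxl_nonroot_cases)
    show "prj (cxl_of D) B \<in> hom (base (cxl_of D)) B (parent (cxl_of D) B)"
      using A by (simp add: S prj_in)
    show "subst (cxl_of D) B \<in> into_parent (cxl_of D) B \<rightarrow>\<^sub>E nonroot (cxl_of D)"
    proof (rule PiE_I)
      fix f assume "f \<in> into_parent (cxl_of D) B"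
      then have f: "f \<in> hom (abase D) (Dom (abase D) f) b"
        using A cxl_into_parent_hom by blast
      then show "subst (cxl_of D) B f \<in> nonroot (cxl_of D)"
        using A res_in[OF f] hom_Obj[OF f] by (simp add: S ext_in ext_not_one)
    qed (use A B in \<open>auto simp: cxl_of_def into_parent_def Let_def nonroot_def\<close>)
    show "lift (cxl_of D) B \<in> extensional (into_parent (cxl_of D) B)"
      using A B by (auto simp: cxl_of_def into_parent_def Let_def nonroot_def)
    show "subst (cxl_of D) B (Id (base (cxl_of D)) (parent (cxl_of D) B)) = B"
      "lift (cxl_of D) B (Id (base (cxl_of D)) (parent (cxl_of D) B)) = Id (base (cxl_of D)) B"
      using A Id_type[OF A(1)] by (simp_all add: S res_Id lift_Id)
  next
    fix B f assume B: "B \<in> nonroot (cxl_of D)" "f \<in> into_parent (cxl_of D) B"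
    from B(1) obtain b A where A: "b \<in> Obj (abase D)" "A \<in> aty D b" "B = aext D b A"
      by (rule cxl_nonroot_cases)
    have f: "f \<in> hom (abase D) (Dom (abase D) f) b"
      using A B cxl_into_parent_hom by blast
    note f' = hom_Obj[OF f] res_in[OF f A(2)]
    show "parent (cxl_of D) (subst (cxl_of D) B f) = Dom (base (cxl_of D)) f"
      using A f f' by (simp add: S)
    show "lift (cxl_of D) B f \<in> hom (base (cxl_of D)) (subst (cxl_of D) B f) B"
      using A f f' lift_in by (simp add: S)
    show "pullback_square (base (cxl_of D)) (lift (cxl_of D) B f)
        (prj (cxl_of D) (subst (cxl_of D) B f)) (prj (cxl_of D) B) f"
      using A f f' pullback by (simp add: S)
    fix g assume "g \<in> Arr (base (cxl_of D))" "Cod (base (cxl_of D)) g = Dom (base (cxl_of D)) f"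
    then have g: "g \<in> hom (abase D) (Dom (abase D) g) (Dom (abase D) f)"
      by (simp add: S(1) hom_def)
    note g' = Comp_type[OF g f] res_in[OF g f'(3)] hom_Obj[OF g]
    show "subst (cxl_of D) B (Comp (base (cxl_of D)) f g) = subst (cxl_of D) (subst (cxl_of D) B f) g"
      using A f f' g g' by (simp add: S res_Comp[OF g f])
    show "lift (cxl_of D) B (Comp (base (cxl_of D)) f g)
      = Comp (base (cxl_of D)) (lift (cxl_of D) B f) (lift (cxl_of D) (subst (cxl_of D) B f) g)"
      using A f f' g g' by (simp add: S lift_Comp[OF g f])
  qed
  ultimately show ?thesis by (rule contextual_category.intro)
qed

text \<open>This is how surjectivity on objects is shown. Equal bases and roots give equal sets of
  non-root objects, all of which are extensions; comparing on extensions is then enough because both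
  sides are extensional.\<close>

lemma cxl_of_eqI:
  assumes "contextual_category X" and base: "base X = abase D" and one: "one X = aone D"
    and parent: "\<And>a A. a \<in> Obj (abase D) \<Longrightarrow> A \<in> aty D a \<Longrightarrow> parent X (aext D a A) = a"
    and prj: "\<And>a A. a \<in> Obj (abase D) \<Longrightarrow> A \<in> aty D a \<Longrightarrow> prj X (aext D a A) = aprj D a A"
    and subst: "\<And>f a b A. f \<in> hom (abase D) a b \<Longrightarrow> A \<in> aty D b \<Longrightarrow>
      subst X (aext D b A) f = aext D a (ares D f A)"
    and lift: "\<And>f a b A. f \<in> hom (abase D) a b \<Longrightarrow> A \<in> aty D b \<Longrightarrow>
      lift X (aext D b A) f = alift D f A"
  shows "cxl_of D = X"
proof -
  interpret X: contextual_category X by fact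
  interpret Y: contextual_category "cxl_of D" by (rule contextual_cxl_of)
  note S = cxl_of_simps cxl_of_ext_simps
  have nonroot: "nonroot (cxl_of D) = nonroot X" by (simp add: S base one nonroot_def)
  have ex: "\<exists>a A. a \<in> Obj (abase D) \<and> A \<in> aty D a \<and> B = aext D a A" if "B \<in> nonroot X" for B
    using that cxl_nonroot_cases nonroot by metis
  have par: "parent (cxl_of D) = parent X"
  proof (rule extensionalityI)
    show "parent (cxl_of D) \<in> extensional (nonroot X)" "parent X \<in> extensional (nonroot X)"
      using Y.parent_type X.parent_type by (auto simp: PiE_def nonroot)
    fix B assume "B \<in> nonroot X"
    from ex[OF this] show "parent (cxl_of D) B = parent X B" by (auto simp: S parent)
  qed
  have pr: "prj (cxl_of D) = prj X"
  proof (rule extensionalityI)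
    show "prj (cxl_of D) \<in> extensional (nonroot X)" "prj X \<in> extensional (nonroot X)"
      using Y.prj_ext X.prj_ext by (auto simp: nonroot)
    fix B assume "B \<in> nonroot X"
    from ex[OF this] show "prj (cxl_of D) B = prj X B" by (auto simp: S prj)
  qed
  have into: "into_parent (cxl_of D) = into_parent X"
    by (intro ext) (simp add: into_parent_def par base S(1))
  have hom: "f \<in> hom (abase D) (Dom (abase D) f) a"
    if "f \<in> into_parent X (aext D a A)" "a \<in> Obj (abase D)" "A \<in> aty D a" for f a A
    using that cxl_into_parent_hom into by simp
  have su: "subst (cxl_of D) B = subst X B" if B: "B \<in> nonroot X" for B
  proof (rule extensionalityI)
    show "subst (cxl_of D) B \<in> extensional (into_parent X B)" "subst X B \<in> extensional (into_parent X B)"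
      using Y.subst_type X.subst_type nonroot into B by (auto simp: PiE_def)
    fix f assume f: "f \<in> into_parent X B"
    obtain a A where A: "a \<in> Obj (abase D)" "A \<in> aty D a" "B = aext D a A"
      using ex[OF B] by blast
    have "f \<in> hom (abase D) (Dom (abase D) f) a" using hom f A by blast
    then show "subst (cxl_of D) B f = subst X B f" using A by (simp add: S subst)
  qed
  have li: "lift (cxl_of D) B = lift X B" if B: "B \<in> nonroot X" for B
  proof (rule extensionalityI)
    show "lift (cxl_of D) B \<in> extensional (into_parent X B)" "lift X B \<in> extensional (into_parent X B)"
      using Y.lift_ext X.lift_ext nonroot into B by auto
    fix f assume f: "f \<in> into_parent X B"
    obtain a A where A: "a \<in> Obj (abase D)" "A \<in> aty D a" "B = aext D a A"
      using ex[OF B] by blast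
    have "f \<in> hom (abase D) (Dom (abase D) f) a" using hom f A by blast
    then show "lift (cxl_of D) B f = lift X B f" using A by (simp add: S lift)
  qed
  have "subst (cxl_of D) = subst X" "lift (cxl_of D) = lift X"
    using su li Y.subst_ext X.subst_ext Y.lift_ext(1) X.lift_ext(1) nonroot
    by (auto intro: extensionalityI[where A = "nonroot X"])
  with par pr show ?thesis by (simp add: base one S(1,2))
qed

end

section \<open>Maps of attribute structures and homomorphisms of contextual categories\<close>

locale attributes_map = X: attributes X + Y: attributes Y + cat_functor "abase X" "abase Y" F
  for X :: "('o, 'm, 't) attr" and Y :: "('p, 'n, 's) attr" and F :: "('o, 'm, 'p, 'n) ftr" +
  fixes t :: "'o \<Rightarrow> 't \<Rightarrow> 's"
  assumes map_one: "fobj F (aone X) = aone Y"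
    and map_ty: "a \<in> Obj (abase X) \<Longrightarrow> A \<in> aty X a \<Longrightarrow> t a A \<in> aty Y (fobj F a)"
    and map_res: "f \<in> hom (abase X) a b \<Longrightarrow> A \<in> aty X b \<Longrightarrow>
      t a (ares X f A) = ares Y (farr F f) (t b A)"
    and map_ext: "a \<in> Obj (abase X) \<Longrightarrow> A \<in> aty X a \<Longrightarrow>
      fobj F (aext X a A) = aext Y (fobj F a) (t a A)"
    and map_prj: "a \<in> Obj (abase X) \<Longrightarrow> A \<in> aty X a \<Longrightarrow>
      farr F (aprj X a A) = aprj Y (fobj F a) (t a A)"
    and map_lift: "f \<in> hom (abase X) a b \<Longrightarrow> A \<in> aty X b \<Longrightarrow>
      farr F (alift X f A) = alift Y (farr F f) (t b A)"

text \<open>Preservation of \<open>subst\<close> is \<open>map_ext\<close> combined with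
  \<open>map_res\<close>; the other conditions come from one axiom each once objects are written as
  extensions.\<close>

lemma (in attributes_map) cxl_homomorphism: "cxl_homomorphism (cxl_of X) (cxl_of Y) F"
proof -
  note S = cxl_of_simps X.cxl_of_ext_simps Y.cxl_of_ext_simps
  have "cxl_homomorphism_axioms (cxl_of X) (cxl_of Y) F"
  proof
    show "fobj F (one (cxl_of X)) = one (cxl_of Y)" by (simp add: S map_one)
  next
    fix B assume "B \<in> nonroot (cxl_of X)"
    then obtain b A where A: "b \<in> Obj (abase X)" "A \<in> aty X b" "B = aext X b A"
      by (rule X.cxl_nonroot_cases)
    then show "fobj F B \<in> nonroot (cxl_of Y)"
      "fobj F (parent (cxl_of X) B) = parent (cxl_of Y) (fobj F B)"
      "farr F (prj (cxl_of X) B) = prj (cxl_of Y) (fobj F B)"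
      using map_ty fobj_in Y.ext_nonroot by (simp_all add: S map_ext map_prj)
    fix f assume "f \<in> into_parent (cxl_of X) B"
    then have f: "f \<in> hom (abase X) (Dom (abase X) f) b"
      using A X.cxl_into_parent_hom by blast
    show "fobj F (subst (cxl_of X) B f) = subst (cxl_of Y) (fobj F B) (farr F f)"
      "farr F (lift (cxl_of X) B f) = lift (cxl_of Y) (fobj F B) (farr F f)"
      using A f map_ty fobj_in farr_type[OF f] X.hom_Obj[OF f] X.res_in[OF f]
      by (simp_all add: S map_ext map_res[OF f] map_lift[OF f])
  qed
  then show ?thesis
    by (intro cxl_homomorphism.intro X.contextual_cxl_of Y.contextual_cxl_of)
      (simp_all add: S(1) cat_functor_axioms)
qed

text \<open>The source of fullness. A homomorphism sends \<open>aext X a A\<close> to a non-root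
  object with parent \<open>fobj F a\<close>, hence to an extension of \<open>fobj F a\<close> by a
  unique type, and that type has to be the image of \<open>A\<close>.\<close>

lemma attributes_map_of_homomorphism:
  assumes "attributes X" "attributes Y" "cxl_homomorphism (cxl_of X) (cxl_of Y) F"
  shows "attributes_map X Y F (\<lambda>a A. snd (last_ext Y (fobj F (aext X a A))))"
proof -
  define t where "t a A = snd (last_ext Y (fobj F (aext X a A)))" for a A
  interpret X: attributes X by fact
  interpret Y: attributes Y by fact
  interpret F: cxl_homomorphism "cxl_of X" "cxl_of Y" F by fact
  note S = cxl_of_simps X.cxl_of_ext_simps Y.cxl_of_ext_simps
  have F: "cat_functor (abase X) (abase Y) F"
    using F.cat_functor_axioms by (simp add: S(1))
  interpret F: cat_functor "abase X" "abase Y" F by fact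
  have ext: "t a A \<in> aty Y (fobj F a)" "fobj F (aext X a A) = aext Y (fobj F a) (t a A)"
    if A: "a \<in> Obj (abase X)" "A \<in> aty X a" for a A
  proof -
    have 1: "aext X a A \<in> nonroot (cxl_of X)" using X.ext_nonroot A by blast
    obtain b B where B: "b \<in> Obj (abase Y)" "B \<in> aty Y b" "fobj F (aext X a A) = aext Y b B"
      using F.preserves_nonroot[OF 1] by (rule Y.cxl_nonroot_cases)
    have "fobj F a = b" using F.preserves_parent[OF 1] A B by (simp add: S)
    with B show "t a A \<in> aty Y (fobj F a)" "fobj F (aext X a A) = aext Y (fobj F a) (t a A)"
      by (simp_all add: t_def Y.last_ext)
  qed
  have "attributes_map X Y F t"
  proof (intro attributes_map.intro attributes_map_axioms.intro assms F)
    show "fobj F (aone X) = aone Y" using F.preserves_one by (simp add: S(2))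
  next
    fix a A assume A: "a \<in> Obj (abase X)" "A \<in> aty X a"
    show "t a A \<in> aty Y (fobj F a)" "fobj F (aext X a A) = aext Y (fobj F a) (t a A)"
      using A ext by blast+
    show "farr F (aprj X a A) = aprj Y (fobj F a) (t a A)"
      using F.preserves_prj[OF X.ext_nonroot[OF A]] A ext[OF A] F.fobj_in by (simp add: S)
  next
    fix f a b A assume f: "f \<in> hom (abase X) a b" and A: "A \<in> aty X b"
    note o = X.hom_Obj[OF f] F.farr_type[OF f]
    have into: "f \<in> into_parent (cxl_of X) (aext X b A)"
      using f o A by (simp add: S hom_def)
    \<comment> \<open>Preservation of chosen pullbacks equates extensions of
      \<open>fobj F a\<close>; comparing their last types gives compatibility with
      restriction.\<close>
    have "fobj F (aext X a (ares X f A)) = aext Y (fobj F a) (ares Y (farr F f) (t b A))"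
      using F.preserves_subst[OF X.ext_nonroot into] o A f ext[of b A] F.fobj_in
      by (simp add: S)
    then show "t a (ares X f A) = ares Y (farr F f) (t b A)"
      using o A ext[of b A] F.fobj_in Y.res_in[OF o(3)] by (simp add: t_def[of a] Y.last_ext)
    show "farr F (alift X f A) = alift Y (farr F f) (t b A)"
      using F.preserves_lift[OF X.ext_nonroot into] o A f ext[of b A] F.fobj_in
      by (simp add: S)
  qed
  then show ?thesis by (simp add: t_def[abs_def])
qed

text \<open>The source of faithfulness: both types extend \<open>fobj F a\<close> to
  \<open>fobj F (aext X a A)\<close>, and extension is injective.\<close>

lemma attributes_map_unique:
  assumes "attributes_map X Y F t" "attributes_map X Y F t'" "a \<in> Obj (abase X)" "A \<in> aty X a"
  shows "t a A = t' a A"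
proof -
  interpret t: attributes_map X Y F t by fact
  interpret t': attributes_map X Y F t' by fact
  show ?thesis
    using t.Y.ext_inject[of "fobj F a" "t a A" "fobj F a" "t' a A"] assms
      t.map_ext t'.map_ext t.map_ty t'.map_ty t.fobj_in by simp
qed

text \<open>Mediates between plain functions on types and their restrictions, which are what strict
  maps, their identities and their composites consist of.\<close>

lemma attributes_map_cong:
  assumes "attributes_map X Y F t" "\<And>a A. a \<in> Obj (abase X) \<Longrightarrow> A \<in> aty X a \<Longrightarrow> t' a A = t a A"
  shows "attributes_map X Y F t'"
proof -
  interpret attributes_map X Y F t by fact
  show ?thesis
    by (intro attributes_map.intro attributes_map_axioms.intro X.attributes_axioms
        Y.attributes_axioms cat_functor_axioms)
      (simp_all add: assms(2) X.hom_Obj X.res_in map_one map_ty map_res map_ext map_prj map_lift)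
qed

lemma attributes_map_id:
  assumes "attributes X"
  shows "attributes_map X X (id_functor (abase X)) (\<lambda>a A. A)"
proof -
  interpret X: attributes X by fact
  show ?thesis
    by (intro attributes_map.intro attributes_map_axioms.intro assms cat_functor_id X.category_axioms)
      (auto simp: X.one_in X.ext_in homD(1) homD(1)[OF X.prj_in] homD(1)[OF X.lift_in] dest: X.hom_Obj)
qed

lemma attributes_map_comp:
  assumes "attributes_map X Y F t" "attributes_map Y Z G s"
  shows "attributes_map X Z (comp_functor (abase X) G F) (\<lambda>a A. s (fobj F a) (t a A))"
proof -
  interpret F: attributes_map X Y F t by fact
  interpret G: attributes_map Y Z G s by fact
  show ?thesis
  proof (intro attributes_map.intro attributes_map_axioms.intro F.X.attributes_axioms
      G.Y.attributes_axioms cat_functor_comp[OF F.cat_functor_axioms G.cat_functor_axioms])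
    fix f a b A assume f: "f \<in> hom (abase X) a b" and A: "A \<in> aty X b"
    note o = F.X.hom_Obj[OF f] F.farr_type[OF f] F.map_ty[OF _ A]
    show "s (fobj F a) (t a (ares X f A)) =
        ares Z (farr (comp_functor (abase X) G F) f) (s (fobj F b) (t b A))"
      using f A o by (simp add: homD F.map_res[OF f] G.map_res[OF o(3)])
    show "farr (comp_functor (abase X) G F) (alift X f A) =
        alift Z (farr (comp_functor (abase X) G F) f) (s (fobj F b) (t b A))"
      using f A o F.X.lift_in[OF f A] by (simp add: homD F.map_lift[OF f] G.map_lift[OF o(3)])
  qed (use F.X.one_in F.map_one G.map_one F.map_ty G.map_ty F.fobj_in in
      \<open>auto simp: homD(1)[OF F.X.prj_in] F.map_ext G.map_ext F.map_prj G.map_prj F.X.ext_in\<close>)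
qed

section \<open>Contextual categories\<close>

lemma cxl_homomorphism_id:
  assumes "contextual_category X"
  shows "cxl_homomorphism X X (id_functor (base X))"
proof -
  interpret contextual_category X by fact
  show ?thesis
  proof (intro cxl_homomorphism.intro cxl_homomorphism_axioms.intro assms cat_functor_id category_axioms)
    show "fobj (id_functor (base X)) (one X) = one X"
      using one_terminal by (simp add: terminal_def)
  next
    fix A assume A: "A \<in> nonroot X"
    then have o: "A \<in> Obj (base X)" by (simp add: nonroot_def)
    show "fobj (id_functor (base X)) A \<in> nonroot X"
      "fobj (id_functor (base X)) (parent X A) = parent X (fobj (id_functor (base X)) A)"
      "farr (id_functor (base X)) (prj X A) = prj X (fobj (id_functor (base X)) A)"
      using A o PiE_mem[OF parent_type A] by (simp_all add: homD(1)[OF prj_type])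
    fix f assume f: "f \<in> into_parent X A"
    then have "subst X A f \<in> Obj (base X)" "f \<in> Arr (base X)"
      using PiE_mem[OF subst_type[OF A] f] by (simp_all add: nonroot_def into_parent_def)
    then show "fobj (id_functor (base X)) (subst X A f) = subst X (fobj (id_functor (base X)) A) (farr (id_functor (base X)) f)"
      "farr (id_functor (base X)) (lift X A f) = lift X (fobj (id_functor (base X)) A) (farr (id_functor (base X)) f)"
      using A o f by (simp_all add: homD(1)[OF lift_type])
  qed
qed

lemma cxl_homomorphism_comp:
  assumes "cxl_homomorphism X Y F" "cxl_homomorphism Y Z G"
  shows "cxl_homomorphism X Z (comp_functor (base X) G F)"
proof -
  interpret F: cxl_homomorphism X Y F by fact
  interpret G: cxl_homomorphism Y Z G by fact
  show ?thesis
  proof (intro cxl_homomorphism.intro cxl_homomorphism_axioms.intro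
      cat_functor_comp[OF F.cat_functor_axioms G.cat_functor_axioms])
    show "contextual_category X" "contextual_category Z" by unfold_locales
    show "fobj (comp_functor (base X) G F) (one X) = one Z"
      using F.X.one_terminal F.preserves_one G.preserves_one by (simp add: terminal_def)
  next
    fix A assume A: "A \<in> nonroot X"
    then have o: "A \<in> Obj (base X)" by (simp add: nonroot_def)
    note FA = F.preserves_nonroot[OF A]
    show "fobj (comp_functor (base X) G F) A \<in> nonroot Z"
      "fobj (comp_functor (base X) G F) (parent X A) = parent Z (fobj (comp_functor (base X) G F) A)"
      "farr (comp_functor (base X) G F) (prj X A) = prj Z (fobj (comp_functor (base X) G F) A)"
      using o A FA PiE_mem[OF F.X.parent_type A] homD(1)[OF F.X.prj_type[OF A]]
      by (simp_all add: G.preserves_nonroot F.preserves_parent G.preserves_parent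
          F.preserves_prj G.preserves_prj)
    fix f assume f: "f \<in> into_parent X A"
    then have 1: "subst X A f \<in> Obj (base X)" "f \<in> Arr (base X)"
      using PiE_mem[OF F.X.subst_type[OF A] f] by (simp_all add: nonroot_def into_parent_def)
    have "farr F f \<in> into_parent Y (fobj F A)"
      using f A F.farr_simps[of f] by (simp add: into_parent_def F.preserves_parent)
    then show "fobj (comp_functor (base X) G F) (subst X A f)
        = subst Z (fobj (comp_functor (base X) G F) A) (farr (comp_functor (base X) G F) f)"
      "farr (comp_functor (base X) G F) (lift X A f)
        = lift Z (fobj (comp_functor (base X) G F) A) (farr (comp_functor (base X) G F) f)"
      using o A f 1 FA homD(1)[OF F.X.lift_type[OF A f]]
      by (simp_all add: F.preserves_subst G.preserves_subst F.preserves_lift G.preserves_lift)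
  qed
qed

lemma category_CxlCat: "category CxlCat"
  unfolding CxlCat_def
proof (rule structure_category_category)
  show "id_functor (base X) \<in> {F. cxl_homomorphism X X F}" if "X \<in> {X. contextual_category X}"
    for X :: "('o, 'm) cxl"
    using that cxl_homomorphism_id by auto
qed (auto intro: cxl_homomorphism_comp comp_functor_id_left comp_functor_id_right
    comp_functor_assoc cxl_homomorphism.axioms(3))

text \<open>Agreement is asked only on a set closed under extension, since presheaves and extension
  functors are \<open>undefined\<close> outside their domains.\<close>

lemma iterated_ext_cong:
  assumes "\<And>a. a \<in> S \<Longrightarrow> ty a = ty' a" "\<And>a A. a \<in> S \<Longrightarrow> A \<in> ty a \<Longrightarrow> ext a A = ext' a A"
    and "\<And>a A. a \<in> S \<Longrightarrow> A \<in> ty a \<Longrightarrow> ext a A \<in> S"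
  shows "a \<in> S \<Longrightarrow> iterated_ext ty ext a As b \<longleftrightarrow> iterated_ext ty' ext' a As b"
  by (induction As arbitrary: a) (use assms in auto)

section \<open>Ancestor paths and the infinitude of non-root objects\<close>

context contextual_category
begin

definition types_over :: "'o \<Rightarrow> 'o set" where
  "types_over a = {A \<in> nonroot X. parent X A = a}"

lemma one_Obj: "one X \<in> Obj (base X)"
  using one_terminal by (simp add: terminal_def)

lemma nonroot_Obj: "A \<in> nonroot X \<Longrightarrow> A \<in> Obj (base X)"
  by (simp add: nonroot_def)

lemma parent_Obj: "A \<in> nonroot X \<Longrightarrow> parent X A \<in> Obj (base X)"
  using PiE_mem[OF parent_type] .

lemma subst_nonroot: "A \<in> nonroot X \<Longrightarrow> f \<in> into_parent X A \<Longrightarrow> subst X A f \<in> nonroot X"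
  using PiE_mem[OF subst_type] .

text \<open>The list is the path from the root, excluded, to \<open>b\<close>, included. Any
  nonempty list reaching \<open>b\<close> ends with \<open>b\<close> itself, and what precedes it
  reaches the parent of \<open>b\<close>; a list reaching the root must be empty because its last
  entry would be non-root.\<close>

lemma unique_iterated_ext:
  assumes "b \<in> Obj (base X)"
  shows "\<exists>!As. iterated_ext types_over (\<lambda>_ A. A) (one X) As b"
proof (rule ex_ex1I)
  show "\<exists>As. iterated_ext types_over (\<lambda>_ A. A) (one X) As b"
    using finite_height[OF assms]
  proof (induction rule: converse_rtrancl_induct)
    case base
    then show ?case by (auto intro: exI[of _ "[]"])
  next
    case (step B C)
    then obtain As where "iterated_ext types_over (\<lambda>_ A. A) (one X) As C"
      "B \<in> nonroot X" "C = parent X B" by auto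
    then have "iterated_ext types_over (\<lambda>_ A. A) (one X) (As @ [B]) B"
      by (auto simp: iterated_ext_snoc types_over_def)
    then show ?case by blast
  qed
next
  fix As Bs
  assume "iterated_ext types_over (\<lambda>_ A. A) (one X) As b" "iterated_ext types_over (\<lambda>_ A. A) (one X) Bs b"
  then show "As = Bs"
  proof (induction As arbitrary: b Bs rule: rev_induct)
    case Nil
    then show ?case
      by (cases Bs rule: rev_cases) (auto simp: iterated_ext_snoc types_over_def nonroot_def)
  next
    case (snoc A As)
    then show ?case
      by (cases Bs rule: rev_cases) (auto simp: iterated_ext_snoc types_over_def nonroot_def)
  qed
qed

text \<open>
  Pulling back \<open>B\<close> along its own projection gives an object with parent \<open>B\<close>. If there were only
  finitely many non-root objects, this injection of them into themselves would be onto, so that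
  every non-root object would have a non-root parent.
\<close>

lemma infinite_nonroot:
  assumes "nonroot X \<noteq> {}"
  shows "infinite (nonroot X)"
proof
  assume fin: "finite (nonroot X)"
  define s where "s B = subst X B (prj X B)" for B
  have prj_into: "prj X B \<in> into_parent X B" if "B \<in> nonroot X" for B
    using prj_type[OF that] by (simp add: into_parent_def hom_def)
  have s: "s B \<in> nonroot X" "parent X (s B) = B" if "B \<in> nonroot X" for B
    using that prj_into subst_nonroot parent_subst[OF that prj_into[OF that]] prj_type[OF that]
    by (auto simp: s_def hom_def)
  have "inj_on s (nonroot X)"
    by (rule inj_on_inverseI[of _ "parent X"]) (rule s)
  then have onto: "s ` nonroot X = nonroot X"
    using fin s(1) by (intro endo_inj_surj) auto
  obtain A where A: "A \<in> nonroot X" using assms by blast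
  have "B \<in> nonroot X" if "(A, B) \<in> {(B, parent X B) | B. B \<in> nonroot X}\<^sup>*" for B
    using that
  proof induction
    case (step B C)
    then obtain D where "D \<in> nonroot X" "B = s D" "C = parent X B" using onto by blast
    then show ?case using s by simp
  qed (rule A)
  then have "one X \<in> nonroot X" using finite_height nonroot_Obj[OF A] by blast
  then show False by (simp add: nonroot_def)
qed

end

section \<open>Contextual categories with attributes\<close>

lemma elements_simps:
  "(a, x) \<in> Obj (elements C P) \<longleftrightarrow> a \<in> Obj C \<and> x \<in> sec P a"
  "(f, x) \<in> Arr (elements C P) \<longleftrightarrow> f \<in> Arr C \<and> x \<in> sec P (Cod C f)"
  "f \<in> Arr C \<Longrightarrow> x \<in> sec P (Cod C f) \<Longrightarrow> Dom (elements C P) (f, x) = (Dom C f, res P f x)"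
  "f \<in> Arr C \<Longrightarrow> x \<in> sec P (Cod C f) \<Longrightarrow> Cod (elements C P) (f, x) = (Cod C f, x)"
  "a \<in> Obj C \<Longrightarrow> x \<in> sec P a \<Longrightarrow> Id (elements C P) (a, x) = (Id C a, x)"
  "f \<in> Arr C \<Longrightarrow> g \<in> Arr C \<Longrightarrow> Cod C f = Dom C g \<Longrightarrow> res P g y \<in> sec P (Cod C f) \<Longrightarrow>
    y \<in> sec P (Cod C g) \<Longrightarrow> Comp (elements C P) (g, y) (f, res P g y) = (g \<cdot>\<^bsub>C\<^esub> f, y)"
  by (simp_all add: elements_def Let_def)

text \<open>An arrow carries the section over its target, while the section over its source is
  computed by restriction. So the target is split into a pair, and the components of the source are
  found.\<close>

lemma elements_hom:
  "u \<in> hom (elements C P) v (b, x) \<longleftrightarrow>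
    (\<exists>f a. f \<in> hom C a b \<and> x \<in> sec P b \<and> v = (a, res P f x) \<and> u = (f, x))"
  by (auto simp: elements_def Let_def hom_def)

lemma elements_proj_simps:
  "a \<in> Obj C \<Longrightarrow> x \<in> sec P a \<Longrightarrow> fobj (elements_proj C P) (a, x) = a"
  "f \<in> Arr C \<Longrightarrow> x \<in> sec P (Cod C f) \<Longrightarrow> farr (elements_proj C P) (f, x) = f"
  by (simp_all add: elements_proj_def elements_simps)

lemma elements_functor_simps:
  "a \<in> Obj C \<Longrightarrow> x \<in> sec P a \<Longrightarrow> fobj (elements_functor C P F t) (a, x) = (fobj F a, t a x)"
  "f \<in> Arr C \<Longrightarrow> x \<in> sec P (Cod C f) \<Longrightarrow>
    farr (elements_functor C P F t) (f, x) = (farr F f, t (Cod C f) x)"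
  by (simp_all add: elements_functor_def elements_simps)

context presheaf
begin

lemma res_in: "f \<in> hom C a b \<Longrightarrow> x \<in> sec P b \<Longrightarrow> res P f x \<in> sec P a"
  using PiE_mem[OF res_type] .

lemma category_elements: "category (elements C P)"
proof
  show "Dom (elements C P) \<in> Arr (elements C P) \<rightarrow>\<^sub>E Obj (elements C P)"
    "Cod (elements C P) \<in> Arr (elements C P) \<rightarrow>\<^sub>E Obj (elements C P)"
    using Dom_in Cod_in res_in[OF in_hom] by (auto simp: elements_def Let_def)
  show "Id (elements C P) \<in> extensional (Obj (elements C P))"
    by (auto simp: elements_def Let_def)
next
  fix a assume "a \<in> Obj (elements C P)"
  then show "Id (elements C P) a \<in> hom (elements C P) a a"
    by (cases a) (auto simp: elements_simps elements_hom res_Id intro!: exI[of _ "fst a"] Id_type)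
next
  fix f g assume "\<not> (f \<in> Arr (elements C P) \<and> g \<in> Arr (elements C P) \<and>
    Cod (elements C P) f = Dom (elements C P) g)"
  then show "Comp (elements C P) g f = undefined"
    by (cases f; cases g) (auto simp: elements_def Let_def)
next
  fix u v w z r assume uv: "u \<in> hom (elements C P) v w" "r \<in> hom (elements C P) w z"
  \<comment> \<open>Sections are restricted backwards from the target, so the second arrow is
    unpacked before the first.\<close>
  obtain c y where z: "z = (c, y)" by (cases z)
  obtain g b where g: "g \<in> hom C b c" "y \<in> sec P c" "w = (b, res P g y)" "r = (g, y)"
    using uv(2) unfolding z elements_hom by blast
  obtain f a where f: "f \<in> hom C a b" "v = (a, res P f (res P g y))" "u = (f, res P g y)"
    using uv(1) unfolding g elements_hom by blast
  show "Comp (elements C P) r u \<in> hom (elements C P) v z"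
    using f g res_in[OF g(1)] Comp_type[OF f(1) g(1)] res_Comp[OF f(1) g(1)]
    by (auto simp: z homD[OF f(1)] homD[OF g(1)] elements_simps elements_hom intro!: exI[of _ a])
next
  fix f a b assume "f \<in> hom (elements C P) a b"
  moreover obtain c x where b: "b = (c, x)" by (cases b)
  ultimately obtain g d where g: "g \<in> hom C d c" "x \<in> sec P c" "a = (d, res P g x)" "f = (g, x)"
    unfolding b elements_hom by blast
  note o = homD[OF g(1)] hom_Obj[OF g(1)]
  \<comment> \<open>The rule for composites matches only a section written as a restriction, hence
    \<open>res P (Id C c) x\<close> in place of \<open>x\<close>.\<close>
  have "Comp (elements C P) (Id C c, x) (g, res P (Id C c) x) = (Id C c \<cdot>\<^bsub>C\<^esub> g, x)"
    using g o by (intro elements_simps) (auto simp: Id_simps res_Id)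
  then show "Comp (elements C P) (Id (elements C P) b) f = f"
    using g o by (simp add: b elements_simps res_Id Id_left[OF g(1)])
  show "Comp (elements C P) f (Id (elements C P) a) = f"
    using g o by (simp add: elements_simps res_in[OF g(1)] Id_simps Id_right[OF g(1)])
next
  fix f a b g c h d
  assume "f \<in> hom (elements C P) a b" "g \<in> hom (elements C P) b c" and h: "h \<in> hom (elements C P) c d"
  obtain d' x where d: "d = (d', x)" by (cases d)
  obtain h' c' where h': "h' \<in> hom C c' d'" "x \<in> sec P d'" "c = (c', res P h' x)" "h = (h', x)"
    using h unfolding d elements_hom by blast
  obtain g' b' where g': "g' \<in> hom C b' c'" "b = (b', res P g' (res P h' x))" "g = (g', res P h' x)"
    using \<open>g \<in> _\<close> unfolding h' elements_hom by blast
  obtain f' a' where f': "f' \<in> hom C a' b'" "f = (f', res P g' (res P h' x))"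
    using \<open>f \<in> _\<close> unfolding g' elements_hom by blast
  note hs = homD[OF h'(1)] homD[OF g'(1)] homD[OF f'(1)]
  have r: "res P h' x \<in> sec P c'" "res P g' (res P h' x) \<in> sec P b'"
    "res P (h' \<cdot>\<^bsub>C\<^esub> g') x = res P g' (res P h' x)"
    using res_in[OF h'(1)] res_in[OF g'(1)] h'(2) res_Comp[OF g'(1) h'(1)] by auto
  have "Comp (elements C P) (h' \<cdot>\<^bsub>C\<^esub> g', x) (f', res P (h' \<cdot>\<^bsub>C\<^esub> g') x) = ((h' \<cdot>\<^bsub>C\<^esub> g') \<cdot>\<^bsub>C\<^esub> f', x)"
    using h' r hs by (intro elements_simps) (simp_all add: Comp_simps)
  then show "Comp (elements C P) (Comp (elements C P) h g) f = Comp (elements C P) h (Comp (elements C P) g f)"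
    using h' g' f' r hs Comp_assoc[OF f'(1) g'(1) h'(1)] by (simp add: elements_simps Comp_simps)
qed

lemma cat_functor_elements_proj: "cat_functor (elements C P) C (elements_proj C P)"
proof (intro cat_functor.intro cat_functor_axioms.intro category_elements category_axioms)
  show "fobj (elements_proj C P) \<in> Obj (elements C P) \<rightarrow>\<^sub>E Obj C"
    by (auto simp: elements_proj_def elements_simps)
  show "farr (elements_proj C P) \<in> extensional (Arr (elements C P))"
    by (simp add: elements_proj_def)
next
  fix f a b assume "f \<in> hom (elements C P) a b"
  then show "farr (elements_proj C P) f \<in> hom C (fobj (elements_proj C P) a) (fobj (elements_proj C P) b)"
    using hom_Obj res_in
    by (cases b) (fastforce simp: elements_hom elements_proj_simps homD)
next
  fix a assume "a \<in> Obj (elements C P)"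
  then show "farr (elements_proj C P) (Id (elements C P) a) = Id C (fobj (elements_proj C P) a)"
    by (cases a) (auto simp: elements_simps elements_proj_simps Id_simps)
next
  fix u v w r z assume uv: "u \<in> hom (elements C P) v w" "r \<in> hom (elements C P) w z"
  obtain c y where z: "z = (c, y)" by (cases z)
  obtain g b where g: "g \<in> hom C b c" "y \<in> sec P c" "w = (b, res P g y)" "r = (g, y)"
    using uv(2) unfolding z elements_hom by blast
  obtain f a where f: "f \<in> hom C a b" "v = (a, res P f (res P g y))" "u = (f, res P g y)"
    using uv(1) unfolding g elements_hom by blast
  show "farr (elements_proj C P) (Comp (elements C P) r u)
      = farr (elements_proj C P) r \<cdot>\<^bsub>C\<^esub> farr (elements_proj C P) u"
    using f g res_in[OF g(1)]
    by (simp add: homD[OF f(1)] homD[OF g(1)] elements_simps elements_proj_simps Comp_simps)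
qed

lemma presheaf_precomp:
  assumes "cat_functor B C F"
  shows "presheaf B (precomp_presheaf B P F)"
proof -
  interpret F: cat_functor B C F by fact
  show ?thesis
  proof (intro presheaf.intro presheaf_axioms.intro F.source.category_axioms)
    show "sec (precomp_presheaf B P F) \<in> extensional (Obj B)"
      "res (precomp_presheaf B P F) \<in> extensional (Arr B)"
      by (simp_all add: precomp_presheaf_def)
  next
    fix f a b assume f: "f \<in> hom B a b"
    show "res (precomp_presheaf B P F) f \<in> sec (precomp_presheaf B P F) b \<rightarrow>\<^sub>E sec (precomp_presheaf B P F) a"
      using res_type[OF F.farr_type[OF f]] F.source.hom_Obj[OF f] homD(1)[OF f]
      by (simp add: precomp_presheaf_def compose_eq)
  next
    fix a x assume "a \<in> Obj B" "x \<in> sec (precomp_presheaf B P F) a"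
    then show "res (precomp_presheaf B P F) (Id B a) x = x"
      by (simp add: precomp_presheaf_def compose_eq F.source.Id_simps F.farr_Id F.fobj_in res_Id)
  next
    fix f a b g c x assume f: "f \<in> hom B a b" and g: "g \<in> hom B b c"
      and x: "x \<in> sec (precomp_presheaf B P F) c"
    show "res (precomp_presheaf B P F) (g \<cdot>\<^bsub>B\<^esub> f) x
        = res (precomp_presheaf B P F) f (res (precomp_presheaf B P F) g x)"
      using x F.source.hom_Obj[OF g] homD(1)[OF f] homD(1)[OF g] homD(1)[OF F.source.Comp_type[OF f g]]
        F.farr_Comp[OF f g] res_Comp[OF F.farr_type[OF f] F.farr_type[OF g]]
      by (simp add: precomp_presheaf_def compose_eq)
  qed
qed

end

lemma precomp_presheaf_simps:
  "a \<in> Obj B \<Longrightarrow> sec (precomp_presheaf B P F) a = sec P (fobj F a)"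
  "f \<in> Arr B \<Longrightarrow> res (precomp_presheaf B P F) f = res P (farr F f)"
  by (simp_all add: precomp_presheaf_def compose_eq)

section \<open>From contextual categories with attributes to attribute structures\<close>

definition attr_of_cwa :: "('o, 'm, 't) cxl_cwa \<Rightarrow> ('o, 'm, 't) attr" where
  "attr_of_cwa X = \<lparr>abase = cbase X, aone = cone X, aty = sec (cty X), ares = res (cty X),
    aext = (\<lambda>a A. fobj (cext X) (a, A)), aprj = (\<lambda>a A. cprj X (a, A)),
    alift = (\<lambda>f A. farr (cext X) (f, A))\<rparr>"

lemma attr_of_cwa_simps [simp]:
  "abase (attr_of_cwa X) = cbase X" "aone (attr_of_cwa X) = cone X"
  "aty (attr_of_cwa X) = sec (cty X)" "ares (attr_of_cwa X) = res (cty X)"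
  "aext (attr_of_cwa X) a A = fobj (cext X) (a, A)" "aprj (attr_of_cwa X) a A = cprj X (a, A)"
  "alift (attr_of_cwa X) f A = farr (cext X) (f, A)"
  by (simp_all add: attr_of_cwa_def)

lemma attributes_attr_of_cwa:
  assumes "contextual_cwa X"
  shows "attributes (attr_of_cwa X)"
proof -
  interpret contextual_cwa X by fact
  note E = elements_simps elements_proj_simps
  have hom: "(f, A) \<in> hom (elements (cbase X) (cty X)) (a, res (cty X) f A) (b, A)"
    if "f \<in> hom (cbase X) a b" "A \<in> sec (cty X) b" for f a b A
    using that by (auto simp: elements_hom)
  show ?thesis
  proof (intro attributes.intro attributes_axioms.intro; simp)
    show "category (cbase X)" "terminal (cbase X) (cone X)"
      using one_terminal ty.category_axioms by auto
  next
    fix a A assume A: "a \<in> Obj (cbase X)" "A \<in> sec (cty X) a"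
    then show "fobj (cext X) (a, A) \<in> Obj (cbase X)"
      by (intro ext.fobj_in) (simp add: E)
    show "cprj X (a, A) \<in> hom (cbase X) (fobj (cext X) (a, A)) a"
      using A prj.component_type[of "(a, A)"] by (simp add: E)
    show "farr (cext X) (Id (cbase X) a, A) = Id (cbase X) (fobj (cext X) (a, A))"
      using A ext.farr_Id[of "(a, A)"] by (simp add: E)
    show "res (cty X) (Id (cbase X) a) A = A"
      using A by (simp add: ty.res_Id)
  next
    fix f a b A assume f: "f \<in> hom (cbase X) a b" and A: "A \<in> sec (cty X) b"
    show "res (cty X) f A \<in> sec (cty X) a" using ty.res_in f A .
    show "farr (cext X) (f, A) \<in> hom (cbase X) (fobj (cext X) (a, res (cty X) f A)) (fobj (cext X) (b, A))"
      using ext.farr_type[OF hom[OF f A]] .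
    show "pullback_square (cbase X) (farr (cext X) (f, A)) (cprj X (a, res (cty X) f A)) (cprj X (b, A)) f"
      using naturality_square_pullback[OF hom[OF f A]] A homD[OF f] by (simp add: E)
  next
    fix f a b g c A assume f: "f \<in> hom (cbase X) a b" and g: "g \<in> hom (cbase X) b c" and A: "A \<in> sec (cty X) c"
    show "res (cty X) (Comp (cbase X) g f) A = res (cty X) f (res (cty X) g A)"
      using ty.res_Comp[OF f g A] .
    show "farr (cext X) (Comp (cbase X) g f, A) =
        Comp (cbase X) (farr (cext X) (g, A)) (farr (cext X) (f, res (cty X) g A))"
      using ext.farr_Comp[OF hom[OF f ty.res_in[OF g A]] hom[OF g A]] A homD[OF f] homD[OF g]
        ty.res_in[OF g A]
      by (simp add: E)
  next
    fix b assume "b \<in> Obj (cbase X)"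
    from unique_iterated_ext[OF this]
    show "\<exists>!As. iterated_ext (sec (cty X)) (aext (attr_of_cwa X)) (cone X) As b"
      by (simp add: attr_of_cwa_def)
  qed
qed

text \<open>Evaluating the functor equation \<open>preserves_ext\<close> at objects and at arrows of
  the category of elements gives \<open>map_ext\<close> and \<open>map_lift\<close>. Conversely
  these give the equation, because both composites are \<open>undefined\<close> elsewhere. The
  extensionality of \<open>snd F\<close> is the part that the elementary form does not
  record.\<close>

lemma cxl_cwa_strict_map_iff:
  "cxl_cwa_strict_map X Y F \<longleftrightarrow> contextual_cwa X \<and> contextual_cwa Y \<and>
    attributes_map (attr_of_cwa X) (attr_of_cwa Y) (fst F) (snd F) \<and>
    snd F \<in> extensional (Obj (cbase X)) \<and> (\<forall>a \<in> Obj (cbase X). snd F a \<in> extensional (sec (cty X) a))"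
  (is "?L \<longleftrightarrow> ?R")
proof
  assume ?L
  then interpret cxl_cwa_strict_map X Y F .
  note E = elements_simps elements_functor_simps
  have "attributes_map (attr_of_cwa X) (attr_of_cwa Y) (fst F) (snd F)"
  proof (intro attributes_map.intro attributes_map_axioms.intro attributes_attr_of_cwa; simp?)
    show "contextual_cwa X" "contextual_cwa Y" "cat_functor (cbase X) (cbase Y) (fst F)" by unfold_locales
    show "fobj (fst F) (cone X) = cone Y" by (rule preserves_one)
  next
    fix a A assume A: "a \<in> Obj (cbase X)" "A \<in> sec (cty X) a"
    show "snd F a A \<in> sec (cty Y) (fobj (fst F) a)"
      using PiE_mem[OF types.map_type[OF A(1)] A(2)] A by (simp add: precomp_presheaf_simps)
    show "fobj (fst F) (fobj (cext X) (a, A)) = fobj (cext Y) (fobj (fst F) a, snd F a A)"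
      using A arg_cong[OF preserves_ext, of "\<lambda>G. fobj G (a, A)"] by (simp add: E)
    show "farr (fst F) (cprj X (a, A)) = cprj Y (fobj (fst F) a, snd F a A)"
      using A preserves_prj[of "(a, A)"] by (simp add: E)
  next
    fix f a b A assume f: "f \<in> hom (cbase X) a b" and A: "A \<in> sec (cty X) b"
    show "snd F a (res (cty X) f A) = res (cty Y) (farr (fst F) f) (snd F b A)"
      using types.map_natural[OF f A] homD[OF f] by (simp add: precomp_presheaf_simps)
    show "farr (fst F) (farr (cext X) (f, A)) = farr (cext Y) (farr (fst F) f, snd F b A)"
      using A homD[OF f] arg_cong[OF preserves_ext, of "\<lambda>G. farr G (f, A)"] by (simp add: E)
  qed
  then show ?R
    using types.map_ext PiE_ext types.map_type X.contextual_cwa_axioms Y.contextual_cwa_axioms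
    by (auto simp: PiE_def)
next
  assume R: ?R
  interpret X: contextual_cwa X using R by blast
  interpret Y: contextual_cwa Y using R by blast
  interpret m: attributes_map "attr_of_cwa X" "attr_of_cwa Y" "fst F" "snd F" using R by blast
  have F: "cat_functor (cbase X) (cbase Y) (fst F)" using m.cat_functor_axioms by simp
  note E = elements_simps elements_functor_simps
  note H = X.contextual_cwa_axioms Y.contextual_cwa_axioms X.category_with_attributes_axioms
    Y.category_with_attributes_axioms
  note M = m.map_one m.map_ty m.map_res m.map_ext m.map_prj m.map_lift
  note M = M[simplified]
  have "presheaf_map (cbase X) (cty X) (precomp_presheaf (cbase X) (cty Y) (fst F)) (snd F)"
  proof (intro presheaf_map.intro presheaf_map_axioms.intro X.ty.presheaf_axioms
      Y.ty.presheaf_precomp F)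
    show "snd F \<in> extensional (Obj (cbase X))" using R by blast
  next
    fix a assume a: "a \<in> Obj (cbase X)"
    then show "snd F a \<in> sec (cty X) a \<rightarrow>\<^sub>E sec (precomp_presheaf (cbase X) (cty Y) (fst F)) a"
      using R M(2) by (simp add: PiE_def precomp_presheaf_simps)
  next
    fix f a b A assume "f \<in> hom (cbase X) a b" "A \<in> sec (cty X) b"
    then show "snd F a (res (cty X) f A) = res (precomp_presheaf (cbase X) (cty Y) (fst F)) f (snd F b A)"
      using M(3) by (simp add: precomp_presheaf_simps homD(1))
  qed
  moreover have "cwa_strict_map_axioms X Y F"
  proof
    let ?E = "elements (cbase X) (cty X)"
    show "comp_functor ?E (cext Y) (elements_functor (cbase X) (cty X) (fst F) (snd F)) =
       comp_functor ?E (fst F) (cext X)" (is "?A = ?B")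
    proof -
      have "fobj ?A v = fobj ?B v" for v
        by (cases "v \<in> Obj ?E"; cases v) (auto simp: E M(4) comp_functor_def compose_def)
      moreover have "farr ?A u = farr ?B u" for u
      proof (cases "u \<in> Arr ?E")
        case True
        then obtain f A where u: "u = (f, A)" "f \<in> Arr (cbase X)" "A \<in> sec (cty X) (Cod (cbase X) f)"
          by (cases u) (auto simp: E)
        show ?thesis using True M(6)[OF X.ty.in_hom[OF u(2)] u(3)] u by (simp add: E)
      qed (simp add: comp_functor_def compose_def)
      ultimately have "fobj ?A = fobj ?B" "farr ?A = farr ?B" by blast+
      then show ?thesis by simp
    qed
  next
    fix v assume "v \<in> Obj (elements (cbase X) (cty X))"
    then show "cprj Y (fobj (elements_functor (cbase X) (cty X) (fst F) (snd F)) v) = farr (fst F) (cprj X v)"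
      by (cases v) (simp add: E M(5))
  qed
  ultimately show ?L
    using H F M(1)
    by (intro cxl_cwa_strict_map.intro cwa_strict_map.intro cxl_cwa_strict_map_axioms.intro)
qed

text \<open>The action on types is determined on its domain by the base functor and is
  \<open>undefined\<close> elsewhere. Besides faithfulness, this reduces the category laws for
  strict maps to those for functors.\<close>

lemma cxl_cwa_strict_map_eqI:
  assumes F: "cxl_cwa_strict_map X Y F" and G: "cxl_cwa_strict_map X Y G" and eq: "fst F = fst G"
  shows "F = G"
proof -
  have "snd F a A = snd G a A" if "a \<in> Obj (cbase X)" "A \<in> sec (cty X) a" for a A
    using attributes_map_unique[of "attr_of_cwa X" "attr_of_cwa Y" "fst F" "snd F" "snd G" a A] that F G eq
    by (simp add: cxl_cwa_strict_map_iff)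
  then have "snd F a = snd G a" if "a \<in> Obj (cbase X)" for a
    using F G that by (auto simp: cxl_cwa_strict_map_iff intro: extensionalityI[of _ "sec (cty X) a"])
  then have "snd F = snd G"
    using F G by (auto simp: cxl_cwa_strict_map_iff intro: extensionalityI[of _ "Obj (cbase X)"])
  with eq show ?thesis by (simp add: prod_eq_iff)
qed

lemma cxl_cwa_strict_map_id:
  assumes "contextual_cwa X"
  shows "cxl_cwa_strict_map X X (id_cwa_map X)"
  using assms attributes_map_cong[OF attributes_map_id[OF attributes_attr_of_cwa[OF assms]]]
  by (simp add: cxl_cwa_strict_map_iff id_cwa_map_def)

lemma cxl_cwa_strict_map_comp:
  assumes "cxl_cwa_strict_map X Y F" "cxl_cwa_strict_map Y Z G"
  shows "cxl_cwa_strict_map X Z (comp_cwa_map X G F)"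
proof -
  have "attributes_map (attr_of_cwa X) (attr_of_cwa Y) (fst F) (snd F)"
    "attributes_map (attr_of_cwa Y) (attr_of_cwa Z) (fst G) (snd G)"
    using assms by (simp_all add: cxl_cwa_strict_map_iff)
  from attributes_map_cong[OF attributes_map_comp[OF this]] show ?thesis
    using assms by (simp add: cxl_cwa_strict_map_iff comp_cwa_map_def)
qed

lemma cxl_cwa_strict_map_functor:
  assumes "cxl_cwa_strict_map X Y F"
  shows "cat_functor (cbase X) (cbase Y) (fst F)"
  using attributes_map.axioms(3)[of "attr_of_cwa X" "attr_of_cwa Y" "fst F" "snd F"] assms
  by (simp add: cxl_cwa_strict_map_iff)

lemma fst_cwa_map_simps [simp]:
  "fst (id_cwa_map X) = id_functor (cbase X)"
  "fst (comp_cwa_map X G F) = comp_functor (cbase X) (fst G) (fst F)"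
  by (simp_all add: id_cwa_map_def comp_cwa_map_def)

lemma category_CwA_cxl: "category CwA_cxl"
  unfolding CwA_cxl_def
proof (rule structure_category_category)
  fix X Y :: "('o, 'm, 't) cxl_cwa" and h
  assume XY: "X \<in> {X. contextual_cwa X}" "Y \<in> {X. contextual_cwa X}" "h \<in> {F. cxl_cwa_strict_map X Y F}"
  then have h: "cxl_cwa_strict_map X Y h" by simp
  show "comp_cwa_map X (id_cwa_map Y) h = h"
    by (rule cxl_cwa_strict_map_eqI[OF _ h])
      (use XY in \<open>auto intro: cxl_cwa_strict_map_comp cxl_cwa_strict_map_id
        comp_functor_id_left[OF cxl_cwa_strict_map_functor]\<close>)
  show "comp_cwa_map X h (id_cwa_map X) = h"
    by (rule cxl_cwa_strict_map_eqI[OF _ h])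
      (use XY in \<open>auto intro: cxl_cwa_strict_map_comp cxl_cwa_strict_map_id
        comp_functor_id_right[OF cxl_cwa_strict_map_functor]\<close>)
next
  fix X Y Z W :: "('o, 'm, 't) cxl_cwa" and h k l
  assume "h \<in> {F. cxl_cwa_strict_map X Y F}" "k \<in> {F. cxl_cwa_strict_map Y Z F}"
    "l \<in> {F. cxl_cwa_strict_map Z W F}"
  then show "comp_cwa_map X (comp_cwa_map Y l k) h = comp_cwa_map X l (comp_cwa_map X k h)"
    by (intro cxl_cwa_strict_map_eqI[of X W])
      (auto intro!: comp_functor_assoc intro: cxl_cwa_strict_map_comp cxl_cwa_strict_map_functor)
qed (auto intro: cxl_cwa_strict_map_id cxl_cwa_strict_map_comp)

lemma bij_betw_cwa_maps:
  assumes X: "contextual_cwa X" and Y: "contextual_cwa Y"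
  shows "bij_betw fst {F. cxl_cwa_strict_map X Y F}
    {F. cxl_homomorphism (cxl_of (attr_of_cwa X)) (cxl_of (attr_of_cwa Y)) F}"
  unfolding bij_betw_def
proof (intro conjI equalityI subsetI)
  show "inj_on fst {F. cxl_cwa_strict_map X Y F}"
    by (intro inj_onI cxl_cwa_strict_map_eqI) auto
next
  fix F assume "F \<in> fst ` {F. cxl_cwa_strict_map X Y F}"
  then show "F \<in> {F. cxl_homomorphism (cxl_of (attr_of_cwa X)) (cxl_of (attr_of_cwa Y)) F}"
    using attributes_map.cxl_homomorphism by (auto simp: cxl_cwa_strict_map_iff)
next
  fix F assume "F \<in> {F. cxl_homomorphism (cxl_of (attr_of_cwa X)) (cxl_of (attr_of_cwa Y)) F}"
  then obtain t where t: "attributes_map (attr_of_cwa X) (attr_of_cwa Y) F t"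
    using attributes_map_of_homomorphism[OF attributes_attr_of_cwa[OF X] attributes_attr_of_cwa[OF Y]]
    by blast
  \<comment> \<open>The function \<open>t\<close> is arbitrary away from the sections; restricting
    it makes it an admissible component of a strict map.\<close>
  then have "cxl_cwa_strict_map X Y (F, \<lambda>a \<in> Obj (cbase X). \<lambda>A \<in> sec (cty X) a. t a A)"
    using X Y attributes_map_cong[OF t] by (simp add: cxl_cwa_strict_map_iff)
  then show "F \<in> fst ` {F. cxl_cwa_strict_map X Y F}"
    by (force intro: image_eqI[of _ fst])
qed

section \<open>A contextual category as a category with attributes\<close>

context contextual_category
begin

definition types :: "('o, 'm, 'o) psh" where
  "types = \<lparr>sec = (\<lambda>a \<in> Obj (base X). types_over a),
    res = (\<lambda>f \<in> Arr (base X). \<lambda>A \<in> types_over (Cod (base X) f). subst X A f)\<rparr>"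

definition to_cwa :: "('o, 'm, 'o) cxl_cwa" where
  "to_cwa = \<lparr>cbase = base X, cty = types,
    cext = \<lparr>fobj = restrict snd (Obj (elements (base X) types)),
      farr = (\<lambda>(f, A) \<in> Arr (elements (base X) types). lift X A f)\<rparr>,
    cprj = (\<lambda>(a, A) \<in> Obj (elements (base X) types). prj X A),
    cone = one X\<rparr>"

lemma types_over_iff: "A \<in> types_over a \<longleftrightarrow> A \<in> nonroot X \<and> parent X A = a"
  by (simp add: types_over_def)

lemma types_over_Obj: "A \<in> types_over a \<Longrightarrow> A \<in> Obj (base X)"
  by (simp add: types_over_iff nonroot_Obj)

lemma into_parent_iff:
  "A \<in> types_over b \<Longrightarrow> f \<in> into_parent X A \<longleftrightarrow> f \<in> Arr (base X) \<and> Cod (base X) f = b"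
  by (auto simp: into_parent_def types_over_iff)

lemma types_simps:
  "a \<in> Obj (base X) \<Longrightarrow> sec types a = types_over a"
  "f \<in> hom (base X) a b \<Longrightarrow> A \<in> types_over b \<Longrightarrow> res types f A = subst X A f"
  by (auto simp: types_def hom_def)

lemma subst_types_over:
  "f \<in> hom (base X) a b \<Longrightarrow> A \<in> types_over b \<Longrightarrow> subst X A f \<in> types_over a"
  using subst_nonroot parent_subst into_parent_iff by (auto simp: types_over_iff hom_def)

lemma types_over_Id: "A \<in> types_over a \<Longrightarrow> subst X A (Id (base X) a) = A"
  "A \<in> types_over a \<Longrightarrow> lift X A (Id (base X) a) = Id (base X) A"
  using subst_Id lift_Id by (auto simp: types_over_iff)

lemma types_over_Comp:
  assumes "f \<in> hom (base X) a b" "g \<in> hom (base X) b c" "A \<in> types_over c"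
  shows "subst X A (g \<cdot>\<^bsub>base X\<^esub> f) = subst X (subst X A g) f"
    and "lift X A (g \<cdot>\<^bsub>base X\<^esub> f) = lift X A g \<cdot>\<^bsub>base X\<^esub> lift X (subst X A g) f"
  using subst_Comp[of A g f] lift_Comp[of A g f] into_parent_iff assms
  by (auto simp: types_over_iff hom_def)

lemma presheaf_types: "presheaf (base X) types"
proof (intro presheaf.intro presheaf_axioms.intro category_axioms)
  show "sec types \<in> extensional (Obj (base X))" "res types \<in> extensional (Arr (base X))"
    by (simp_all add: types_def)
next
  fix f a b assume f: "f \<in> hom (base X) a b"
  then show "res types f \<in> sec types b \<rightarrow>\<^sub>E sec types a"
    using hom_Obj[OF f] subst_types_over[OF f]
    by (auto simp: types_simps) (simp add: types_def homD)
next
  fix a A assume "a \<in> Obj (base X)" "A \<in> sec types a"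
  then show "res types (Id (base X) a) A = A"
    by (simp add: types_simps types_over_Id types_simps(2)[OF Id_type])
next
  fix f a b g c A assume f: "f \<in> hom (base X) a b" and g: "g \<in> hom (base X) b c" and "A \<in> sec types c"
  then have "A \<in> types_over c" using hom_Obj[OF g] by (simp add: types_simps)
  then show "res types (g \<cdot>\<^bsub>base X\<^esub> f) A = res types f (res types g A)"
    using types_over_Comp(1)[OF f g] Comp_type[OF f g] f g subst_types_over by (simp add: types_simps)
qed

lemma to_cwa_simps:
  "cbase to_cwa = base X" "cty to_cwa = types" "cone to_cwa = one X"
  "a \<in> Obj (base X) \<Longrightarrow> A \<in> types_over a \<Longrightarrow> fobj (cext to_cwa) (a, A) = A"
  "a \<in> Obj (base X) \<Longrightarrow> A \<in> types_over a \<Longrightarrow> cprj to_cwa (a, A) = prj X A"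
  "f \<in> hom (base X) a b \<Longrightarrow> A \<in> types_over b \<Longrightarrow> farr (cext to_cwa) (f, A) = lift X A f"
  by (auto simp: to_cwa_def elements_simps types_simps hom_def Cod_in)

lemma elements_types_hom:
  assumes "u \<in> hom (elements (base X) types) v w"
  obtains f a b A where "f \<in> hom (base X) a b" "A \<in> types_over b" "a \<in> Obj (base X)" "b \<in> Obj (base X)"
    "subst X A f \<in> types_over a" "v = (a, subst X A f)" "w = (b, A)" "u = (f, A)"
proof -
  obtain b A where w: "w = (b, A)" by (cases w)
  obtain f a where f: "f \<in> hom (base X) a b" "A \<in> sec types b" "v = (a, res types f A)" "u = (f, A)"
    using assms unfolding w elements_hom by blast
  have A: "A \<in> types_over b" using f(2) hom_Obj[OF f(1)] by (simp add: types_simps)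
  with that[OF f(1) A] f subst_types_over[OF f(1) A] hom_Obj[OF f(1)] w show ?thesis
    by (simp add: types_simps)
qed

text \<open>Strict functoriality of \<open>lift\<close> makes \<open>cext\<close> a functor, the
  chosen squares are the naturality squares of \<open>cprj\<close>, and the list reaching an object
  is its path of ancestors.\<close>

lemma contextual_to_cwa: "contextual_cwa to_cwa"
proof -
  let ?E = "elements (base X) types"
  interpret P: presheaf "base X" types by (rule presheaf_types)
  have ext: "cat_functor ?E (base X) (cext to_cwa)"
  proof (intro cat_functor.intro cat_functor_axioms.intro P.category_elements category_axioms)
    show "fobj (cext to_cwa) \<in> Obj ?E \<rightarrow>\<^sub>E Obj (base X)"
    proof (rule PiE_I)
      fix v assume "v \<in> Obj ?E"
      then show "fobj (cext to_cwa) v \<in> Obj (base X)"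
        by (cases v) (auto simp: elements_simps types_simps to_cwa_simps intro: types_over_Obj)
    qed (simp add: to_cwa_def)
    show "farr (cext to_cwa) \<in> extensional (Arr ?E)"
      by (simp add: to_cwa_def)
  next
    fix u v w assume "u \<in> hom ?E v w"
    then show "farr (cext to_cwa) u \<in> hom (base X) (fobj (cext to_cwa) v) (fobj (cext to_cwa) w)"
    proof (rule elements_types_hom)
      fix f a b A assume f: "f \<in> hom (base X) a b" "A \<in> types_over b" "a \<in> Obj (base X)"
        "b \<in> Obj (base X)" "subst X A f \<in> types_over a" "v = (a, subst X A f)" "w = (b, A)" "u = (f, A)"
      then show ?thesis
        using lift_type[of A f] into_parent_iff[OF f(2)]
        by (simp add: to_cwa_simps homD[OF f(1)] types_over_iff)
    qed
  next
    fix v assume "v \<in> Obj ?E"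
    then show "farr (cext to_cwa) (Id ?E v) = Id (base X) (fobj (cext to_cwa) v)"
      by (cases v) (auto simp: elements_simps types_simps to_cwa_simps types_over_Id to_cwa_simps(6)[OF Id_type])
  next
    fix u v w r z assume u: "u \<in> hom ?E v w" and r: "r \<in> hom ?E w z"
    obtain g b c A where g: "g \<in> hom (base X) b c" "A \<in> types_over c" "c \<in> Obj (base X)"
      "subst X A g \<in> types_over b" "w = (b, subst X A g)" "z = (c, A)" "r = (g, A)"
      using elements_types_hom[OF r] by metis
    obtain f a where f: "f \<in> hom (base X) a b" "u = (f, subst X A g)"
      using elements_types_hom[OF u] g(5) by (metis prod.inject)
    have "Comp ?E r u = (g \<cdot>\<^bsub>base X\<^esub> f, A)"
      using elements_simps(6)[of f "base X" g types A] f g homD[OF f(1)] homD[OF g(1)] hom_Obj[OF f(1)]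
      by (simp add: types_simps)
    then show "farr (cext to_cwa) (Comp ?E r u) = farr (cext to_cwa) r \<cdot>\<^bsub>base X\<^esub> farr (cext to_cwa) u"
      using f g types_over_Comp(2)[OF f(1) g(1,2)]
      by (simp add: to_cwa_simps(6)[OF Comp_type[OF f(1) g(1)]] to_cwa_simps(6)[OF f(1)] to_cwa_simps(6)[OF g(1)])
  qed
  have prj: "natural_transformation ?E (base X) (cext to_cwa) (elements_proj (base X) types) (cprj to_cwa)"
  proof (intro natural_transformation.intro natural_transformation_axioms.intro ext P.cat_functor_elements_proj)
    show "cprj to_cwa \<in> extensional (Obj ?E)" by (simp add: to_cwa_def)
  next
    fix v assume "v \<in> Obj ?E"
    then show "cprj to_cwa v \<in> hom (base X) (fobj (cext to_cwa) v) (fobj (elements_proj (base X) types) v)"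
      using prj_type by (cases v) (auto simp: elements_simps elements_proj_simps types_simps to_cwa_simps types_over_iff)
  next
    fix u v w assume "u \<in> hom ?E v w"
    then show "cprj to_cwa w \<cdot>\<^bsub>base X\<^esub> farr (cext to_cwa) u
        = farr (elements_proj (base X) types) u \<cdot>\<^bsub>base X\<^esub> cprj to_cwa v"
    proof (rule elements_types_hom)
      fix f a b A assume f: "f \<in> hom (base X) a b" "A \<in> types_over b" "a \<in> Obj (base X)"
        "b \<in> Obj (base X)" "subst X A f \<in> types_over a" "v = (a, subst X A f)" "w = (b, A)" "u = (f, A)"
      then show ?thesis
        using chosen_pullback[of A f] into_parent_iff[OF f(2)]
        by (simp add: to_cwa_simps homD[OF f(1)] types_over_iff elements_proj_simps types_simps pullback_square_def)
    qed
  qed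
  have pb: "pullback_square (base X) (farr (cext to_cwa) u) (cprj to_cwa v) (cprj to_cwa w)
      (farr (elements_proj (base X) types) u)" if u: "u \<in> hom ?E v w" for u v w
    using u
  proof (rule elements_types_hom)
    fix f a b A assume f: "f \<in> hom (base X) a b" "A \<in> types_over b" "a \<in> Obj (base X)"
      "b \<in> Obj (base X)" "subst X A f \<in> types_over a" "v = (a, subst X A f)" "w = (b, A)" "u = (f, A)"
    then show ?thesis
      using chosen_pullback[of A f] into_parent_iff[OF f(2)]
      by (simp add: to_cwa_simps homD[OF f(1)] types_over_iff elements_proj_simps types_simps)
  qed
  show ?thesis
  proof (intro contextual_cwa.intro category_with_attributes.intro contextual_cwa_axioms.intro
      category_with_attributes_axioms.intro; unfold to_cwa_simps(1-3))
    show "terminal (base X) (one X)" by (rule one_terminal)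
    fix b assume b: "b \<in> Obj (base X)"
    have "iterated_ext (sec types) (\<lambda>a A. fobj (cext to_cwa) (a, A)) (one X) As b
      \<longleftrightarrow> iterated_ext types_over (\<lambda>_ A. A) (one X) As b" for As
      by (rule iterated_ext_cong[where S = "Obj (base X)"])
        (auto simp: types_simps to_cwa_simps one_Obj intro: types_over_Obj)
    then show "\<exists>!As. iterated_ext (sec types) (\<lambda>a A. fobj (cext to_cwa) (a, A)) (one X) As b"
      using unique_iterated_ext[OF b] by simp
  qed (use presheaf_types ext prj pb in auto)
qed

text \<open>Extension by a type is that type itself, so nothing gets renamed and the equality is
  literal.\<close>

lemma cxl_of_to_cwa: "cxl_of (attr_of_cwa to_cwa) = X"
proof -
  note o = hom_Obj
  interpret attributes "attr_of_cwa to_cwa"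
    by (intro attributes_attr_of_cwa contextual_to_cwa)
  have X: "contextual_category X" by unfold_locales
  show ?thesis
  proof (rule cxl_of_eqI[OF X]; simp add: to_cwa_simps)
    fix a A assume a: "a \<in> Obj (base X)" "A \<in> sec types a"
    then show "parent X (fobj (cext to_cwa) (a, A)) = a"
      "prj X (fobj (cext to_cwa) (a, A)) = cprj to_cwa (a, A)"
      by (simp_all add: types_simps to_cwa_simps, simp_all add: types_over_iff)
  next
    fix f a b A assume f: "f \<in> hom (base X) a b" "A \<in> sec types b"
    then show "subst X (fobj (cext to_cwa) (b, A)) f = fobj (cext to_cwa) (a, res types f A)"
      "lift X (fobj (cext to_cwa) (b, A)) f = farr (cext to_cwa) (f, A)"
      using o[OF f(1)] subst_types_over[OF f(1), of A]
      by (simp_all add: types_simps to_cwa_simps)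
  qed
qed

end

text \<open>Types are taken from \<open>'o\<close> because the preimage \<open>to_cwa\<close> uses
  objects as types.\<close>

lemma equivalent_CxlCat_CwA_cxl:
  "equivalent_categories (CxlCat :: ('o, 'm) cxl_cat) (CwA_cxl :: ('o, 'm, 'o) cxl_cwa_cat)"
  unfolding CxlCat_def CwA_cxl_def
proof (rule equivalent_if_fully_faithful_surjective[where m = fst and q = "\<lambda>X. cxl_of (attr_of_cwa X)"])
  show "(\<lambda>X. cxl_of (attr_of_cwa X)) ` {X :: ('o, 'm, 'o) cxl_cwa. contextual_cwa X} = {X. contextual_category X}"
    using contextual_category.contextual_to_cwa contextual_category.cxl_of_to_cwa
      attributes.contextual_cxl_of[OF attributes_attr_of_cwa]
    by (auto simp: image_iff) metis
qed (use category_CxlCat category_CwA_cxl bij_betw_cwa_maps in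
    \<open>auto simp: CxlCat_def CwA_cxl_def cxl_of_simps\<close>)

section \<open>Discrete contextual comprehension categories\<close>

lemma arrow_category_hom:
  "u \<in> hom (arrow_category C) f g \<longleftrightarrow> f \<in> Arr C \<and> g \<in> Arr C \<and>
    (\<exists>h k. u = (f, (h, k), g) \<and> h \<in> hom C (Dom C f) (Dom C g) \<and> k \<in> hom C (Cod C f) (Cod C g) \<and>
      g \<cdot>\<^bsub>C\<^esub> h = k \<cdot>\<^bsub>C\<^esub> f)"
  by (auto simp: arrow_category_def structure_category_hom)

lemma arrow_category_simps:
  "Obj (arrow_category C) = Arr C"
  "f \<in> Arr C \<Longrightarrow> Id (arrow_category C) f = (f, (Id C (Dom C f), Id C (Cod C f)), f)"
  "(f, (h, k), g) \<in> Arr (arrow_category C) \<Longrightarrow> (g, (h', k'), l) \<in> Arr (arrow_category C) \<Longrightarrow>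
    Comp (arrow_category C) (g, (h', k'), l) (f, (h, k), g) = (f, (h' \<cdot>\<^bsub>C\<^esub> h, k' \<cdot>\<^bsub>C\<^esub> k), l)"
  by (auto simp: arrow_category_def structure_category_simps)

lemma (in category) category_arrow_category: "category (arrow_category C)"
  unfolding arrow_category_def
proof (rule structure_category_category, goal_cases)
  case (1 f)
  then show ?case
    using Id_type Dom_in Cod_in Id_left[OF in_hom] Id_right[OF in_hom] by auto
next
  case (2 f g l u v)
  then obtain h k h' k' where u: "u = (h, k)" "h \<in> hom C (Dom C f) (Dom C g)"
    "k \<in> hom C (Cod C f) (Cod C g)" "g \<cdot>\<^bsub>C\<^esub> h = k \<cdot>\<^bsub>C\<^esub> f" and v: "v = (h', k')"
    "h' \<in> hom C (Dom C g) (Dom C l)" "k' \<in> hom C (Cod C g) (Cod C l)" "l \<cdot>\<^bsub>C\<^esub> h' = k' \<cdot>\<^bsub>C\<^esub> g"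
    by auto
  have "l \<cdot>\<^bsub>C\<^esub> (h' \<cdot>\<^bsub>C\<^esub> h) = k' \<cdot>\<^bsub>C\<^esub> (g \<cdot>\<^bsub>C\<^esub> h)"
    using Comp_assoc[OF u(2) v(2) in_hom] Comp_assoc[OF u(2) in_hom v(3)] 2 v(4) by simp
  also have "\<dots> = (k' \<cdot>\<^bsub>C\<^esub> k) \<cdot>\<^bsub>C\<^esub> f"
    using Comp_assoc[OF in_hom u(3) v(3)] 2 u(4) by simp
  finally show ?case
    using u v Comp_type by auto
next
  case (3 f g u)
  then show ?case by (auto simp: Id_left)
next
  case (4 f g u)
  then show ?case by (auto simp: Id_right)
next
  case (5 f g l r u v w)
  then show ?case by (auto simp: Comp_assoc)
qed

section \<open>Discrete fibrations\<close>

definition unique_lift :: "('a, 'b) cat \<Rightarrow> ('a, 'b, 'o, 'm) ftr \<Rightarrow> 'm \<Rightarrow> 'a \<Rightarrow> 'b" where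
  "unique_lift T p f A = (THE u. u \<in> Arr T \<and> Cod T u = A \<and> farr p u = f)"

context discrete_fibration
begin

text \<open>The standard way below to prove an equation between arrows of a total category: compare
  targets and images in the base.\<close>

lemma lift_eqI:
  assumes "u \<in> Arr T" "v \<in> Arr T" "Cod T u = Cod T v" "farr p u = farr p v"
  shows "u = v"
proof -
  have "\<exists>!w. w \<in> Arr T \<and> Cod T w = Cod T v \<and> farr p w = farr p v"
    using assms source.Cod_in farr_simps[of v] by (intro unique_lift) auto
  with assms show ?thesis by blast
qed

lemma lift_simps:
  assumes "A \<in> Obj T" "f \<in> Arr C" "Cod C f = fobj p A"
  shows "unique_lift T p f A \<in> Arr T" "Cod T (unique_lift T p f A) = A" "farr p (unique_lift T p f A) = f"
  using theI'[OF unique_lift[OF assms]] by (simp_all add: unique_lift_def)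

lemma lift_of_arrow:
  assumes "u \<in> Arr T"
  shows "unique_lift T p (farr p u) (Cod T u) = u"
  using assms lift_simps[of "Cod T u" "farr p u"] source.Cod_in farr_simps
  by (intro lift_eqI) auto

text \<open>The candidate factor is the lift of \<open>w\<close> to the source of \<open>u\<close>.
  In the discrete case the cartesian conditions thus speak about all arrows, so that every arrow
  goes to a pullback square under \<open>kchi\<close>.\<close>

lemma all_cartesian:
  assumes u: "u \<in> Arr T"
  shows "cartesian T C p u"
  unfolding cartesian_def
proof (intro conjI ballI impI u)
  fix Z v w
  assume Z: "Z \<in> Obj T" and v: "v \<in> hom T Z (Cod T u)"
    and w: "w \<in> hom C (fobj p Z) (fobj p (Dom T u))" and eq: "farr p v = farr p u \<cdot>\<^bsub>C\<^esub> w"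
  have D: "Dom T u \<in> Obj T" using source.Dom_in u .
  define w' where "w' = unique_lift T p w (Dom T u)"
  have w': "w' \<in> Arr T" "Cod T w' = Dom T u" "farr p w' = w"
    unfolding w'_def using lift_simps[OF D] w by (auto simp: hom_def)
  \<comment> \<open>Both sides lift \<open>farr p v\<close> with the same target. Only this equation
    shows that the source of \<open>w'\<close> is \<open>Z\<close> and not just some object over the
    same base object.\<close>
  have "Comp T u w' = v"
    using w' u v eq by (intro lift_eqI) (simp_all add: source.Comp_simps farr_Comp' hom_def)
  moreover from this have "Dom T w' = Z"
    using source.Comp_simps(2)[OF w'(1) u] w' v by (simp add: hom_def)
  ultimately show "\<exists>!w'. w' \<in> hom T Z (Dom T u) \<and> Comp T u w' = v \<and> farr p w' = w"
    using w' by (intro ex1I[of _ w']) (auto simp: hom_def intro: lift_eqI)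
qed

lemma fibration: "fibration T C p"
proof (intro fibration.intro fibration_axioms.intro cat_functor_axioms)
  fix A f assume "A \<in> Obj T" "f \<in> Arr C" "Cod C f = fobj p A"
  from lift_simps[OF this] show "\<exists>u. cartesian T C p u \<and> Cod T u = A \<and> farr p u = f"
    using all_cartesian by blast
qed

end

section \<open>From discrete comprehension categories to attribute structures\<close>

definition chi_top :: "('o, 'm, 'a, 'b, 'z) compcat_scheme \<Rightarrow> 'b \<Rightarrow> 'm" where
  "chi_top X u = fst (fst (snd (farr (kchi X) u)))"

lemma (in comprehension_category) chi_Obj:
  assumes "A \<in> Obj (ktotal X)"
  shows "fobj (kchi X) A \<in> Arr (kbase X)" "Cod (kbase X) (fobj (kchi X) A) = fobj (kfib X) A"
proof -
  show *: "fobj (kchi X) A \<in> Arr (kbase X)"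
    using chi.fobj_in[OF assms] by (simp add: arrow_category_simps)
  have "fobj (comp_functor (ktotal X) (cod_functor (kbase X)) (kchi X)) A = fobj (kfib X) A"
    by (simp add: cod_chi)
  then show "Cod (kbase X) (fobj (kchi X) A) = fobj (kfib X) A"
    using assms * by (simp add: cod_functor_def arrow_category_simps)
qed

text \<open>Functoriality fixes the vertical sides of the square and \<open>cod_chi\<close> its
  bottom, so the top side is the only further datum that \<open>kchi\<close> gives on an
  arrow.\<close>

lemma (in comprehension_category) chi_Arr:
  assumes "u \<in> Arr (ktotal X)"
  shows "farr (kchi X) u = (fobj (kchi X) (Dom (ktotal X) u), (chi_top X u, farr (kfib X) u),
      fobj (kchi X) (Cod (ktotal X) u))"
    and "chi_top X u \<in> hom (kbase X) (Dom (kbase X) (fobj (kchi X) (Dom (ktotal X) u)))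
      (Dom (kbase X) (fobj (kchi X) (Cod (ktotal X) u)))"
proof -
  have u: "u \<in> hom (ktotal X) (Dom (ktotal X) u) (Cod (ktotal X) u)"
    using assms by (simp add: hom_def)
  from chi.farr_type[OF u] obtain h k where
    hk: "farr (kchi X) u = (fobj (kchi X) (Dom (ktotal X) u), (h, k), fobj (kchi X) (Cod (ktotal X) u))"
    "h \<in> hom (kbase X) (Dom (kbase X) (fobj (kchi X) (Dom (ktotal X) u)))
      (Dom (kbase X) (fobj (kchi X) (Cod (ktotal X) u)))"
    unfolding arrow_category_hom by blast
  have "farr (comp_functor (ktotal X) (cod_functor (kbase X)) (kchi X)) u = farr (kfib X) u"
    by (simp add: cod_chi)
  then have "k = farr (kfib X) u"
    using assms hk(1) chi.farr_simps(1)[OF assms] by (simp add: cod_functor_def)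
  with hk show "farr (kchi X) u = (fobj (kchi X) (Dom (ktotal X) u), (chi_top X u, farr (kfib X) u),
      fobj (kchi X) (Cod (ktotal X) u))"
    "chi_top X u \<in> hom (kbase X) (Dom (kbase X) (fobj (kchi X) (Dom (ktotal X) u)))
      (Dom (kbase X) (fobj (kchi X) (Cod (ktotal X) u)))"
    by (simp_all add: chi_top_def)
qed

lemma (in comprehension_category) chi_top_Id:
  "A \<in> Obj (ktotal X) \<Longrightarrow> chi_top X (Id (ktotal X) A) = Id (kbase X) (Dom (kbase X) (fobj (kchi X) A))"
  using chi.farr_Id[of A] chi_Obj by (simp add: chi_top_def arrow_category_simps)

lemma (in comprehension_category) chi_top_Comp:
  assumes "u \<in> Arr (ktotal X)" "v \<in> Arr (ktotal X)" "Cod (ktotal X) u = Dom (ktotal X) v"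
  shows "chi_top X (Comp (ktotal X) v u) = chi_top X v \<cdot>\<^bsub>kbase X\<^esub> chi_top X u"
  unfolding chi_top_def[of X "Comp (ktotal X) v u"] chi.farr_Comp'[OF assms]
  using chi_Arr(1)[OF assms(1)] chi_Arr(1)[OF assms(2)] chi.farr_simps(1)[OF assms(1)]
    chi.farr_simps(1)[OF assms(2)] assms(3)
  by (simp add: arrow_category_simps)

text \<open>An object of the total category determines the object it lies over, so
  \<open>aext\<close> and \<open>aprj\<close> ignore their first argument. Substitution takes the
  source of the unique lift.\<close>

definition attr_of_compcat :: "('o, 'm, 'a, 'b) cxl_compcat \<Rightarrow> ('o, 'm, 'a) attr" where
  "attr_of_compcat X = \<lparr>abase = kbase X, aone = kone X,
    aty = (\<lambda>a. {A \<in> Obj (ktotal X). fobj (kfib X) A = a}),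
    ares = (\<lambda>f A. Dom (ktotal X) (unique_lift (ktotal X) (kfib X) f A)),
    aext = (\<lambda>a A. Dom (kbase X) (fobj (kchi X) A)),
    aprj = (\<lambda>a A. fobj (kchi X) A),
    alift = (\<lambda>f A. chi_top X (unique_lift (ktotal X) (kfib X) f A))\<rparr>"

lemma attr_of_compcat_simps [simp]:
  "abase (attr_of_compcat X) = kbase X" "aone (attr_of_compcat X) = kone X"
  "A \<in> aty (attr_of_compcat X) a \<longleftrightarrow> A \<in> Obj (ktotal X) \<and> fobj (kfib X) A = a"
  "ares (attr_of_compcat X) f A = Dom (ktotal X) (unique_lift (ktotal X) (kfib X) f A)"
  "aext (attr_of_compcat X) a A = Dom (kbase X) (fobj (kchi X) A)"
  "aprj (attr_of_compcat X) a A = fobj (kchi X) A"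
  "alift (attr_of_compcat X) f A = chi_top X (unique_lift (ktotal X) (kfib X) f A)"
  by (simp_all add: attr_of_compcat_def)

text \<open>Uniqueness of lifts makes lifting strictly compatible with identities and composites
  (\<open>l_Id\<close>, \<open>l_Comp\<close>), and \<open>kchi\<close> transports this to the top
  maps.\<close>

lemma attributes_attr_of_compcat:
  assumes "discrete_contextual_compcat X"
  shows "attributes (attr_of_compcat X)"
proof -
  interpret discrete_contextual_compcat X by fact
  let ?l = "unique_lift (ktotal X) (kfib X)"
  have l: "?l f A \<in> Arr (ktotal X)" "Cod (ktotal X) (?l f A) = A" "farr (kfib X) (?l f A) = f"
    "Dom (ktotal X) (?l f A) \<in> Obj (ktotal X)" "fobj (kfib X) (Dom (ktotal X) (?l f A)) = a"
    if "f \<in> hom (kbase X) a b" "A \<in> Obj (ktotal X)" "fobj (kfib X) A = b" for f A a b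
    using that lift_simps[of A f] fib.farr_simps[of "?l f A"] fib.source.Dom_in
    by (auto simp: hom_def)
  have l_Id: "?l (Id (kbase X) a) A = Id (ktotal X) A"
    if "A \<in> Obj (ktotal X)" "fobj (kfib X) A = a" for A a
    using that l[OF fib.target.Id_type] fib.fobj_in[OF that(1)]
    by (intro lift_eqI) (auto simp: fib.source.Id_simps fib.farr_Id)
  have l_Comp: "?l (Comp (kbase X) g f) A = Comp (ktotal X) (?l g A) (?l f (Dom (ktotal X) (?l g A)))"
    if f: "f \<in> hom (kbase X) a b" and g: "g \<in> hom (kbase X) b c"
      and A: "A \<in> Obj (ktotal X)" "fobj (kfib X) A = c" for f g A a b c
    using l[OF g A] l[OF f l(4,5)[OF g A]] l[OF fib.target.Comp_type[OF f g] A]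
    by (intro lift_eqI) (simp_all add: fib.source.Comp_simps fib.farr_Comp')
  show ?thesis
  proof (intro attributes.intro attributes_axioms.intro; (unfold attr_of_compcat_simps)?)
    show "category (kbase X)" "terminal (kbase X) (kone X)"
      using one_terminal fib.target.category_axioms by auto
  next
    fix a A assume A: "A \<in> Obj (ktotal X) \<and> fobj (kfib X) A = a"
    then show "Dom (kbase X) (fobj (kchi X) A) \<in> Obj (kbase X)"
      "fobj (kchi X) A \<in> hom (kbase X) (Dom (kbase X) (fobj (kchi X) A)) a"
      using chi_Obj[of A] fib.target.Dom_in by (auto simp: hom_def)
    show "Dom (ktotal X) (?l (Id (kbase X) a) A) = A"
      "chi_top X (?l (Id (kbase X) a) A) = Id (kbase X) (Dom (kbase X) (fobj (kchi X) A))"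
      using A by (simp_all add: l_Id fib.source.Id_simps chi_top_Id)
  next
    fix f a b A assume f: "f \<in> hom (kbase X) a b" and "A \<in> Obj (ktotal X) \<and> fobj (kfib X) A = b"
    then have A: "A \<in> Obj (ktotal X)" "fobj (kfib X) A = b" by auto
    note L = l[OF f A]
    show "Dom (ktotal X) (?l f A) \<in> Obj (ktotal X) \<and> fobj (kfib X) (Dom (ktotal X) (?l f A)) = a"
      using L by simp
    show "chi_top X (?l f A) \<in> hom (kbase X) (Dom (kbase X) (fobj (kchi X) (Dom (ktotal X) (?l f A))))
        (Dom (kbase X) (fobj (kchi X) A))"
      using chi_Arr(2)[OF L(1)] L(2) by simp
    show "pullback_square (kbase X) (chi_top X (?l f A)) (fobj (kchi X) (Dom (ktotal X) (?l f A)))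
        (fobj (kchi X) A) f"
      using chi_cartesian[OF all_cartesian[OF L(1)]] L by (simp add: chi_Arr(1) is_pullback_square_def)
  next
    fix f a b g c A assume f: "f \<in> hom (kbase X) a b" and g: "g \<in> hom (kbase X) b c"
      and "A \<in> Obj (ktotal X) \<and> fobj (kfib X) A = c"
    then have A: "A \<in> Obj (ktotal X)" "fobj (kfib X) A = c" by auto
    note L = l_Comp[OF f g A] l[OF g A] l[OF f l(4,5)[OF g A]]
    show "Dom (ktotal X) (?l (Comp (kbase X) g f) A) = Dom (ktotal X) (?l f (Dom (ktotal X) (?l g A)))"
      using L by (simp add: fib.source.Comp_simps)
    show "chi_top X (?l (Comp (kbase X) g f) A) =
        Comp (kbase X) (chi_top X (?l g A)) (chi_top X (?l f (Dom (ktotal X) (?l g A))))"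
      using L by (simp add: chi_top_Comp)
  qed (use unique_iterated_ext in \<open>simp add: attr_of_compcat_def\<close>)
qed

text \<open>\<open>attributes_map\<close> does not see the action on arrows of the total category,
  so its functoriality and its lying over the base are listed separately. Every such arrow is the
  lift determined by its target and its image, which lets preservation of \<open>kchi\<close> on
  arrows correspond to \<open>map_lift\<close>.\<close>

lemma cxl_compcat_strict_map_iff:
  assumes "discrete_contextual_compcat X" "discrete_contextual_compcat Y"
  shows "cxl_compcat_strict_map X Y F \<longleftrightarrow>
    attributes_map (attr_of_compcat X) (attr_of_compcat Y) (fst F) (\<lambda>a. fobj (snd F)) \<and>
    cat_functor (ktotal X) (ktotal Y) (snd F) \<and>
    (\<forall>u \<in> Arr (ktotal X). farr (kfib Y) (farr (snd F) u) = farr (fst F) (farr (kfib X) u))"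
  (is "?L \<longleftrightarrow> ?R")
proof -
  interpret X: discrete_contextual_compcat X by fact
  interpret Y: discrete_contextual_compcat Y by fact
  let ?l = "unique_lift (ktotal X) (kfib X)"
  let ?l' = "unique_lift (ktotal Y) (kfib Y)"
  show ?thesis
  proof
    assume ?L
    then interpret cxl_compcat_strict_map X Y F .
    have over: "farr (kfib Y) (farr (snd F) u) = farr (fst F) (farr (kfib X) u)" if "u \<in> Arr (ktotal X)" for u
      using arg_cong[OF over_base, of "\<lambda>G. farr G u"] that by simp
    have lift: "?l f A \<in> Arr (ktotal X)" "farr (snd F) (?l f A) = ?l' (farr (fst F) f) (fobj (snd F) A)"
      "Cod (ktotal X) (?l f A) = A"
      if "f \<in> Arr (kbase X)" "A \<in> Obj (ktotal X)" "Cod (kbase X) f = fobj (kfib X) A" for f A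
    proof -
      note L = X.lift_simps[OF that(2,1,3)]
      show "?l f A \<in> Arr (ktotal X)" "Cod (ktotal X) (?l f A) = A" using L by auto
      \<comment> \<open>The image of a lift has the right target and lies over the right arrow, so
        it is the lift in \<open>Y\<close>.\<close>
      have "?l' (farr (kfib Y) (farr (snd F) (?l f A))) (Cod (ktotal Y) (farr (snd F) (?l f A)))
          = farr (snd F) (?l f A)"
        using L total.farr_simps by (intro Y.lift_of_arrow) auto
      then show "farr (snd F) (?l f A) = ?l' (farr (fst F) f) (fobj (snd F) A)"
        using L total.farr_simps over by simp
    qed
    have chi_obj: "fobj (kchi Y) (fobj (snd F) A) = farr (fst F) (fobj (kchi X) A)" if "A \<in> Obj (ktotal X)" for A
      using arg_cong[OF preserves_chi, of "\<lambda>G. fobj G A"] that X.chi_Obj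
      by (simp add: arrow_functor_def arrow_category_simps)
    have chi_arr: "chi_top Y (farr (snd F) u) = farr (fst F) (chi_top X u)" if "u \<in> Arr (ktotal X)" for u
      using arg_cong[OF preserves_chi, of "\<lambda>G. farr G u"] that X.chi_Arr(1)[OF that] X.chi.farr_simps(1)[OF that]
      by (simp add: arrow_functor_def chi_top_def[of Y])
    have "attributes_map (attr_of_compcat X) (attr_of_compcat Y) (fst F) (\<lambda>a. fobj (snd F))"
    proof (intro attributes_map.intro attributes_map_axioms.intro attributes_attr_of_compcat assms; (unfold attr_of_compcat_simps)?)
      show "cat_functor (kbase X) (kbase Y) (fst F)" by unfold_locales
      show "fobj (fst F) (kone X) = kone Y" by (rule preserves_one)
    next
      fix a A assume A: "a \<in> Obj (kbase X)" "A \<in> Obj (ktotal X) \<and> fobj (kfib X) A = a"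
      then show "fobj (snd F) A \<in> Obj (ktotal Y) \<and> fobj (kfib Y) (fobj (snd F) A) = fobj (fst F) a"
        using arg_cong[OF over_base, of "\<lambda>G. fobj G A"] total.fobj_in by simp
      show "farr (fst F) (fobj (kchi X) A) = fobj (kchi Y) (fobj (snd F) A)"
        "fobj (fst F) (Dom (kbase X) (fobj (kchi X) A)) = Dom (kbase Y) (fobj (kchi Y) (fobj (snd F) A))"
        using A X.chi_Obj base.farr_simps by (simp_all add: chi_obj)
    next
      fix f a b A assume "f \<in> hom (kbase X) a b" "A \<in> Obj (ktotal X) \<and> fobj (kfib X) A = b"
      then have f: "f \<in> Arr (kbase X)" "A \<in> Obj (ktotal X)" "Cod (kbase X) f = fobj (kfib X) A"
        by (auto simp: hom_def)
      note L = lift[OF f]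
      show "fobj (snd F) (Dom (ktotal X) (?l f A)) = Dom (ktotal Y) (?l' (farr (fst F) f) (fobj (snd F) A))"
        using L total.farr_simps(2)[OF L(1)] by simp
      show "farr (fst F) (chi_top X (?l f A)) = chi_top Y (?l' (farr (fst F) f) (fobj (snd F) A))"
        using L chi_arr by metis
    qed
    then show ?R using over total.cat_functor_axioms by blast
  next
    assume R: ?R
    interpret m: attributes_map "attr_of_compcat X" "attr_of_compcat Y" "fst F" "\<lambda>a. fobj (snd F)"
      using R by blast
    interpret total: cat_functor "ktotal X" "ktotal Y" "snd F" using R by blast
    have F: "cat_functor (kbase X) (kbase Y) (fst F)" using m.cat_functor_axioms by simp
    note M = m.map_one m.map_ty m.map_res m.map_ext m.map_prj m.map_lift
    note M = M[simplified]
    have over: "farr (kfib Y) (farr (snd F) u) = farr (fst F) (farr (kfib X) u)" if "u \<in> Arr (ktotal X)" for u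
      using R that by blast
    have over_obj: "fobj (kfib Y) (fobj (snd F) A) = fobj (fst F) (fobj (kfib X) A)" if "A \<in> Obj (ktotal X)" for A
      using that M(2) X.fib.fobj_in by blast
    have chi_obj: "fobj (kchi Y) (fobj (snd F) A) = farr (fst F) (fobj (kchi X) A)" if "A \<in> Obj (ktotal X)" for A
      using that M(5) X.fib.fobj_in by simp
    have chi_arr: "chi_top Y (farr (snd F) u) = farr (fst F) (chi_top X u)" if u: "u \<in> Arr (ktotal X)" for u
    proof -
      \<comment> \<open>Both \<open>u\<close> and its image are lifts, so \<open>map_lift\<close>
        applies to \<open>u\<close>.\<close>
      have "?l' (farr (fst F) (farr (kfib X) u)) (fobj (snd F) (Cod (ktotal X) u)) = farr (snd F) u"
        using Y.lift_of_arrow[of "farr (snd F) u"] total.farr_simps[OF u] over[OF u] by simp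
      then show ?thesis
        using M(6)[of "farr (kfib X) u" _ _ "Cod (ktotal X) u"] X.lift_of_arrow[OF u]
          X.fib.farr_simps[OF u] X.fib.source.Cod_in[OF u] by (simp add: hom_def)
    qed
    have 1: "comp_functor (ktotal X) (kfib Y) (snd F) = comp_functor (ktotal X) (fst F) (kfib X)"
      by (rule functor_eqI[OF cat_functor_comp cat_functor_comp])
        (use over over_obj F total.cat_functor_axioms X.fib.cat_functor_axioms Y.fib.cat_functor_axioms in auto)
    let ?A = "comp_functor (ktotal X) (kchi Y) (snd F)"
    let ?B = "comp_functor (ktotal X) (arrow_functor (kbase X) (fst F)) (kchi X)"
    have "fobj ?A A = fobj ?B A" for A
    proof (cases "A \<in> Obj (ktotal X)")
      case True
      then show ?thesis
        using X.chi_Obj by (simp add: chi_obj arrow_functor_def arrow_category_simps)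
    qed (simp add: comp_functor_def compose_def)
    moreover have "farr ?A u = farr ?B u" for u
    proof (cases "u \<in> Arr (ktotal X)")
      case True
      then show ?thesis
        using X.chi_Arr(1)[OF True] X.chi.farr_simps(1)[OF True] Y.chi_Arr(1)[OF total.farr_simps(1)[OF True]]
          total.farr_simps[OF True] X.fib.source.Dom_in[OF True] X.fib.source.Cod_in[OF True]
        by (simp add: arrow_functor_def chi_obj chi_arr over)
    qed (simp add: comp_functor_def compose_def)
    ultimately have "fobj ?A = fobj ?B" "farr ?A = farr ?B" by blast+
    then have 2: "?A = ?B" by simp
    have 3: "cartesian (ktotal Y) (kbase Y) (kfib Y) (farr (snd F) u)"
      if "cartesian (ktotal X) (kbase X) (kfib X) u" for u
      using that total.farr_simps(1) by (intro Y.all_cartesian) (auto simp: cartesian_def)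
    show ?L
      using F total.cat_functor_axioms 1 2 3 M(1) X.contextual_compcat_axioms Y.contextual_compcat_axioms
        X.comprehension_category_axioms Y.comprehension_category_axioms
      by (intro cxl_compcat_strict_map.intro compcat_strict_map.intro compcat_strict_map_axioms.intro
          cxl_compcat_strict_map_axioms.intro)
  qed
qed

lemma cxl_compcat_strict_map_functors:
  assumes "cxl_compcat_strict_map X Y F"
  shows "cat_functor (kbase X) (kbase Y) (fst F)" "cat_functor (ktotal X) (ktotal Y) (snd F)"
proof -
  interpret cxl_compcat_strict_map X Y F by fact
  show "cat_functor (kbase X) (kbase Y) (fst F)" "cat_functor (ktotal X) (ktotal Y) (snd F)"
    by unfold_locales
qed

lemma cxl_compcat_strict_map_id:
  assumes "discrete_contextual_compcat X"
  shows "cxl_compcat_strict_map X X (id_compcat_map X)"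
proof -
  interpret discrete_contextual_compcat X by fact
  show ?thesis
    unfolding cxl_compcat_strict_map_iff[OF assms assms]
    using attributes_map_cong[OF attributes_map_id[OF attributes_attr_of_compcat[OF assms]],
        of "\<lambda>a. fobj (id_functor (ktotal X))"] cat_functor_id[OF fib.source.category_axioms]
    by (auto simp: id_compcat_map_def fib.farr_simps)
qed

lemma cxl_compcat_strict_map_comp:
  assumes X: "discrete_contextual_compcat X" and Y: "discrete_contextual_compcat Y"
    and Z: "discrete_contextual_compcat Z"
    and F: "cxl_compcat_strict_map X Y F" and G: "cxl_compcat_strict_map Y Z G"
  shows "cxl_compcat_strict_map X Z (comp_compcat_map X G F)"
proof -
  interpret X: discrete_contextual_compcat X by fact
  have f: "attributes_map (attr_of_compcat X) (attr_of_compcat Y) (fst F) (\<lambda>a. fobj (snd F))"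
    "attributes_map (attr_of_compcat Y) (attr_of_compcat Z) (fst G) (\<lambda>a. fobj (snd G))"
    "\<forall>u \<in> Arr (ktotal X). farr (kfib Y) (farr (snd F) u) = farr (fst F) (farr (kfib X) u)"
    "\<forall>u \<in> Arr (ktotal Y). farr (kfib Z) (farr (snd G) u) = farr (fst G) (farr (kfib Y) u)"
    using F G cxl_compcat_strict_map_iff[OF X Y] cxl_compcat_strict_map_iff[OF Y Z] by auto
  note s = cxl_compcat_strict_map_functors[OF F] cxl_compcat_strict_map_functors[OF G]
  have "attributes_map (attr_of_compcat X) (attr_of_compcat Z) (comp_functor (kbase X) (fst G) (fst F))
    (\<lambda>a. fobj (comp_functor (ktotal X) (snd G) (snd F)))"
    using attributes_map_cong[OF attributes_map_comp[OF f(1,2)]] by simp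
  then show ?thesis
    unfolding cxl_compcat_strict_map_iff[OF X Z]
    using cat_functor_comp[OF s(2,4)] f(3,4) cat_functor.farr_simps(1)[OF s(2)] X.fib.farr_simps(1)
    by (simp add: comp_compcat_map_def)
qed

lemma category_CompCat_disc_cxl: "category (CompCat_disc_cxl :: ('o, 'm, 'a, 'b) cxl_compcat_cat)"
  unfolding CompCat_disc_cxl_def
proof (rule structure_category_category)
  fix X Y :: "('o, 'm, 'a, 'b) cxl_compcat" and h
  assume "h \<in> {F. cxl_compcat_strict_map X Y F}"
  then have h: "cxl_compcat_strict_map X Y h" by simp
  note s = cxl_compcat_strict_map_functors[OF h]
  show "comp_compcat_map X (id_compcat_map Y) h = h" "comp_compcat_map X h (id_compcat_map X) = h"
    using s by (simp_all add: comp_compcat_map_def id_compcat_map_def prod_eq_iff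
        comp_functor_id_left comp_functor_id_right)
next
  fix X Y Z W :: "('o, 'm, 'a, 'b) cxl_compcat" and h k l
  assume "h \<in> {F. cxl_compcat_strict_map X Y F}" "k \<in> {F. cxl_compcat_strict_map Y Z F}"
    "l \<in> {F. cxl_compcat_strict_map Z W F}"
  then have "cxl_compcat_strict_map X Y h" "cxl_compcat_strict_map Y Z k" "cxl_compcat_strict_map Z W l"
    by auto
  note s = this[THEN cxl_compcat_strict_map_functors(1)] this[THEN cxl_compcat_strict_map_functors(2)]
  show "comp_compcat_map X (comp_compcat_map Y l k) h = comp_compcat_map X l (comp_compcat_map X k h)"
    using comp_functor_assoc[OF s(1-3)] comp_functor_assoc[OF s(4-6)]
    by (simp add: comp_compcat_map_def)
qed (auto intro: cxl_compcat_strict_map_id cxl_compcat_strict_map_comp)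

text \<open>On objects of the total category this is \<open>attributes_map_unique\<close>; on arrows
  the two images have the same target and lie over the same arrow.\<close>

lemma cxl_compcat_strict_map_eqI:
  assumes X: "discrete_contextual_compcat X" and Y: "discrete_contextual_compcat Y"
    and F: "cxl_compcat_strict_map X Y F" and G: "cxl_compcat_strict_map X Y G" and eq: "fst F = fst G"
  shows "F = G"
proof -
  interpret X: discrete_contextual_compcat X by fact
  interpret Y: discrete_contextual_compcat Y by fact
  note s = cxl_compcat_strict_map_functors(2)[OF F] cxl_compcat_strict_map_functors(2)[OF G]
  have o: "fobj (snd F) A = fobj (snd G) A" if "A \<in> Obj (ktotal X)" for A
    using attributes_map_unique[of "attr_of_compcat X" "attr_of_compcat Y" "fst F" "\<lambda>a. fobj (snd F)"
        "\<lambda>a. fobj (snd G)" "fobj (kfib X) A" A] F G eq that X.fib.fobj_in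
    by (simp add: cxl_compcat_strict_map_iff[OF X Y])
  have "farr (snd F) u = farr (snd G) u" if u: "u \<in> Arr (ktotal X)" for u
  proof (rule Y.lift_eqI)
    show "farr (kfib Y) (farr (snd F) u) = farr (kfib Y) (farr (snd G) u)"
      using F G eq u by (simp add: cxl_compcat_strict_map_iff[OF X Y])
  qed (use cat_functor.farr_simps[OF s(1) u] cat_functor.farr_simps[OF s(2) u] o X.fib.source.Cod_in[OF u] in auto)
  with o have "snd F = snd G" by (intro functor_eqI[OF s])
  with eq show ?thesis by (simp add: prod_eq_iff)
qed

text \<open>Fullness asks for more than with attributes: a functor between total categories must be
  built from a map of types.\<close>

lemma bij_betw_compcat_maps:
  assumes X: "discrete_contextual_compcat X" and Y: "discrete_contextual_compcat Y"
  shows "bij_betw fst {F. cxl_compcat_strict_map X Y F}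
    {F. cxl_homomorphism (cxl_of (attr_of_compcat X)) (cxl_of (attr_of_compcat Y)) F}"
  unfolding bij_betw_def
proof (intro conjI equalityI subsetI)
  show "inj_on fst {F. cxl_compcat_strict_map X Y F}"
    by (intro inj_onI cxl_compcat_strict_map_eqI[OF X Y]) auto
next
  fix F assume "F \<in> fst ` {F. cxl_compcat_strict_map X Y F}"
  then show "F \<in> {F. cxl_homomorphism (cxl_of (attr_of_compcat X)) (cxl_of (attr_of_compcat Y)) F}"
    using attributes_map.cxl_homomorphism by (auto simp: cxl_compcat_strict_map_iff[OF X Y])
next
  fix F assume "F \<in> {F. cxl_homomorphism (cxl_of (attr_of_compcat X)) (cxl_of (attr_of_compcat Y)) F}"
  then obtain t where t: "attributes_map (attr_of_compcat X) (attr_of_compcat Y) F t"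
    using attributes_map_of_homomorphism[OF attributes_attr_of_compcat[OF X] attributes_attr_of_compcat[OF Y]]
    by blast
  interpret X: discrete_contextual_compcat X by fact
  interpret Y: discrete_contextual_compcat Y by fact
  interpret t: attributes_map "attr_of_compcat X" "attr_of_compcat Y" F t by fact
  note M = t.map_ty t.map_res
  note M = M[simplified]
  interpret F: cat_functor "kbase X" "kbase Y" F using t.cat_functor_axioms by simp
  let ?T = "ktotal X" and ?p = "kfib X" and ?T' = "ktotal Y" and ?p' = "kfib Y"
  let ?l' = "unique_lift ?T' ?p'"
  define s where "s A = t (fobj ?p A) A" for A
  \<comment> \<open>Since \<open>u\<close> is a lift, its image is forced to be the lift of
    \<open>farr F (farr ?p u)\<close> with target \<open>s (Cod ?T u)\<close>.\<close>
  define G where "G = \<lparr>fobj = restrict s (Obj ?T),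
    farr = (\<lambda>u \<in> Arr ?T. ?l' (farr F (farr ?p u)) (s (Cod ?T u)))\<rparr>"
  have s: "s A \<in> Obj ?T'" "fobj ?p' (s A) = fobj F (fobj ?p A)" if "A \<in> Obj ?T" for A
    using M(1)[of "fobj ?p A" A] that X.fib.fobj_in by (auto simp: s_def)
  have G: "farr G u \<in> Arr ?T'" "Cod ?T' (farr G u) = s (Cod ?T u)" "farr ?p' (farr G u) = farr F (farr ?p u)"
    if "u \<in> Arr ?T" for u
    using Y.lift_simps[of "s (Cod ?T u)" "farr F (farr ?p u)"] that s[OF X.fib.source.Cod_in[OF that]]
      X.fib.farr_simps F.farr_simps by (auto simp: G_def)
  \<comment> \<open>The target of \<open>farr G u\<close> is right by construction; that its source
    is right is \<open>map_res\<close>.\<close>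
  have D: "Dom ?T' (farr G u) = s (Dom ?T u)" if u: "u \<in> Arr ?T" for u
    using M(2)[of "farr ?p u" "fobj ?p (Dom ?T u)" "fobj ?p (Cod ?T u)" "Cod ?T u"]
      X.fib.farr_simps[OF u] X.fib.source.Cod_in[OF u] X.lift_of_arrow[OF u] u
    by (simp add: G_def s_def hom_def)
  have G_functor: "cat_functor ?T ?T' G"
  proof (intro cat_functor.intro cat_functor_axioms.intro X.fib.source.category_axioms Y.fib.source.category_axioms)
    show "fobj G \<in> Obj ?T \<rightarrow>\<^sub>E Obj ?T'" "farr G \<in> extensional (Arr ?T)"
      using s by (auto simp: G_def)
  next
    fix f a b assume "f \<in> hom ?T a b"
    then show "farr G f \<in> hom ?T' (fobj G a) (fobj G b)"
      using G[of f] D[of f] X.fib.source.hom_Obj[of f a b] by (simp add: hom_def) (simp add: G_def)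
  next
    fix a assume a: "a \<in> Obj ?T"
    \<comment> \<open>Identities and composites are preserved because both sides are lifts of the
      same arrow with the same target.\<close>
    have "farr G (Id ?T a) = Id ?T' (s a)"
      using a G[of "Id ?T a"] s[OF a] X.fib.fobj_in[OF a]
      by (intro Y.lift_eqI) (simp_all add: X.fib.source.Id_simps Y.fib.source.Id_simps X.fib.farr_Id Y.fib.farr_Id F.farr_Id)
    then show "farr G (Id ?T a) = Id ?T' (fobj G a)"
      using a by (simp add: G_def)
  next
    fix f a b g c assume "f \<in> hom ?T a b" "g \<in> hom ?T b c"
    then have fg: "f \<in> Arr ?T" "g \<in> Arr ?T" "Cod ?T f = Dom ?T g" by (auto simp: hom_def)
    note c = X.fib.source.Comp_simps[OF fg]
    show "farr G (Comp ?T g f) = Comp ?T' (farr G g) (farr G f)"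
      using fg G[OF fg(1)] G[OF fg(2)] D[OF fg(1)] D[OF fg(2)] G[OF c(1)] c X.fib.farr_simps[of f] X.fib.farr_simps[of g]
      by (intro Y.lift_eqI) (simp_all add: Y.fib.source.Comp_simps X.fib.farr_Comp' Y.fib.farr_Comp' F.farr_Comp')
  qed
  have "attributes_map (attr_of_compcat X) (attr_of_compcat Y) F (\<lambda>a. fobj G)"
    by (rule attributes_map_cong[OF t]) (auto simp: G_def s_def)
  then have "cxl_compcat_strict_map X Y (F, G)"
    using G_functor G by (simp add: cxl_compcat_strict_map_iff[OF X Y])
  then show "F \<in> fst ` {F. cxl_compcat_strict_map X Y F}"
    by (force intro: image_eqI[of _ fst])
qed

section \<open>A contextual category as a discrete comprehension category\<close>

text \<open>
  An arrow of the total category with target \<open>A\<close> over \<open>f\<close> is the pair \<open>(f, A)\<close>, transported along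
  an injection \<open>e\<close> into the given type of arrows.
\<close>

locale coded_contextual_category = contextual_category X
  for X :: "('o, 'm) cxl" +
  fixes e :: "'m \<times> 'o \<Rightarrow> 'b"
  assumes inj_code: "inj_on e {(f, A). A \<in> nonroot X \<and> f \<in> into_parent X A}"
begin

definition pairs :: "('m \<times> 'o) set" where
  "pairs = {(f, A). A \<in> nonroot X \<and> f \<in> into_parent X A}"

definition decode :: "'b \<Rightarrow> 'm \<times> 'o" where
  "decode = inv_into pairs e"

text \<open>The category of elements of the presheaf \<open>types\<close>, with an object
  \<open>(a, A)\<close> shortened to \<open>A\<close>, which determines its parent \<open>a\<close>,
  and with arrows renamed along \<open>e\<close>.\<close>

definition total :: "('o, 'b) cat" where
  "total = \<lparr>Obj = nonroot X,
    Arr = e ` pairs,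
    Dom = (\<lambda>u \<in> e ` pairs. subst X (snd (decode u)) (fst (decode u))),
    Cod = (\<lambda>u \<in> e ` pairs. snd (decode u)),
    Id = (\<lambda>A \<in> nonroot X. e (Id (base X) (parent X A), A)),
    Comp = (\<lambda>v u. if u \<in> e ` pairs \<and> v \<in> e ` pairs \<and>
        snd (decode u) = subst X (snd (decode v)) (fst (decode v))
      then e (fst (decode v) \<cdot>\<^bsub>base X\<^esub> fst (decode u), snd (decode v)) else undefined)\<rparr>"

text \<open>\<open>parent X\<close> and \<open>prj X\<close> are already \<open>undefined\<close>
  off the non-root objects and can serve as object maps as they stand. \<open>kchi\<close> sends the
  code of \<open>(f, A)\<close> to the chosen pullback square of \<open>prj X A\<close> along
  \<open>f\<close>.\<close>

definition to_compcat :: "('o, 'm, 'o, 'b) cxl_compcat" where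
  "to_compcat = \<lparr>kbase = base X, ktotal = total,
    kfib = \<lparr>fobj = parent X, farr = (\<lambda>u \<in> e ` pairs. fst (decode u))\<rparr>,
    kchi = \<lparr>fobj = prj X,
      farr = (\<lambda>u \<in> e ` pairs. case decode u of (f, A) \<Rightarrow> (prj X (subst X A f), (lift X A f, f), prj X A))\<rparr>,
    kone = one X\<rparr>"

lemma to_compcat_simps:
  "kbase to_compcat = base X" "ktotal to_compcat = total" "kone to_compcat = one X"
  "fobj (kfib to_compcat) = parent X" "fobj (kchi to_compcat) = prj X" "Obj total = nonroot X"
  by (simp_all add: to_compcat_def total_def)

lemma pairs_iff:
  "(f, A) \<in> pairs \<longleftrightarrow> A \<in> nonroot X \<and> f \<in> Arr (base X) \<and> Cod (base X) f = parent X A"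
  by (auto simp: pairs_def into_parent_def)

lemma pairs_into: "(f, A) \<in> pairs \<Longrightarrow> A \<in> nonroot X \<and> f \<in> into_parent X A"
  by (simp add: pairs_def)

lemma decode [simp]: "v \<in> pairs \<Longrightarrow> decode (e v) = v"
  using inj_code by (simp add: decode_def pairs_def)

lemma total_Arr: "u \<in> Arr total \<longleftrightarrow> (\<exists>f A. (f, A) \<in> pairs \<and> u = e (f, A))"
  by (auto simp: total_def)

lemma pair_simps:
  assumes "(f, A) \<in> pairs"
  shows "e (f, A) \<in> Arr total" "Dom total (e (f, A)) = subst X A f" "Cod total (e (f, A)) = A"
    "farr (kfib to_compcat) (e (f, A)) = f"
    "farr (kchi to_compcat) (e (f, A)) = (prj X (subst X A f), (lift X A f, f), prj X A)"
    "subst X A f \<in> nonroot X" "parent X (subst X A f) = Dom (base X) f"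
  using assms subst_nonroot parent_subst by (auto simp: total_def to_compcat_def pairs_into)

lemma pair_Id:
  assumes "A \<in> nonroot X"
  shows "(Id (base X) (parent X A), A) \<in> pairs" "Id total A = e (Id (base X) (parent X A), A)"
  using assms Id_simps[OF parent_Obj[OF assms]] by (simp_all add: pairs_iff total_def)

lemma pair_Comp:
  assumes "(f, subst X A g) \<in> pairs" "(g, A) \<in> pairs"
  shows "Cod (base X) f = Dom (base X) g" "(g \<cdot>\<^bsub>base X\<^esub> f, A) \<in> pairs"
    "Comp total (e (g, A)) (e (f, subst X A g)) = e (g \<cdot>\<^bsub>base X\<^esub> f, A)"
    "subst X A (g \<cdot>\<^bsub>base X\<^esub> f) = subst X (subst X A g) f"
    "lift X A (g \<cdot>\<^bsub>base X\<^esub> f) = lift X A g \<cdot>\<^bsub>base X\<^esub> lift X (subst X A g) f"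
proof -
  show 1: "Cod (base X) f = Dom (base X) g"
    using assms pair_simps(7)[OF assms(2)] by (simp add: pairs_iff)
  show "(g \<cdot>\<^bsub>base X\<^esub> f, A) \<in> pairs"
    using assms 1 Comp_simps[of f g] by (simp add: pairs_iff)
  show "Comp total (e (g, A)) (e (f, subst X A g)) = e (g \<cdot>\<^bsub>base X\<^esub> f, A)"
    using assms by (simp add: total_def)
  show "subst X A (g \<cdot>\<^bsub>base X\<^esub> f) = subst X (subst X A g) f"
    "lift X A (g \<cdot>\<^bsub>base X\<^esub> f) = lift X A g \<cdot>\<^bsub>base X\<^esub> lift X (subst X A g) f"
    using assms 1 pairs_into subst_Comp[of A g f] lift_Comp[of A g f] by (auto simp: pairs_iff)
qed

lemma total_hom:
  "u \<in> hom total B A \<longleftrightarrow> (\<exists>f. (f, A) \<in> pairs \<and> B = subst X A f \<and> u = e (f, A))"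
  using pair_simps by (auto simp: hom_def total_Arr)

lemma total_hom_comp:
  assumes "u \<in> hom total A B" "v \<in> hom total B D"
  obtains f g where "(f, subst X D g) \<in> pairs" "(g, D) \<in> pairs" "B = subst X D g"
    "A = subst X (subst X D g) f" "u = e (f, subst X D g)" "v = e (g, D)"
  using assms unfolding total_hom by blast

lemma category_total: "category total"
proof
  have "Dom total u \<in> Obj total" "Cod total u \<in> Obj total" if u: "u \<in> Arr total" for u
  proof -
    obtain f A where f: "(f, A) \<in> pairs" "u = e (f, A)" using u by (auto simp: total_Arr)
    then show "Dom total u \<in> Obj total" "Cod total u \<in> Obj total"
      using pair_simps[OF f(1)] by (auto simp: to_compcat_simps pairs_iff)
  qed
  moreover have "Dom total \<in> extensional (Arr total)" "Cod total \<in> extensional (Arr total)"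
    by (simp_all add: total_def)
  ultimately show "Dom total \<in> Arr total \<rightarrow>\<^sub>E Obj total" "Cod total \<in> Arr total \<rightarrow>\<^sub>E Obj total"
    by (auto simp: PiE_def)
  show "Id total \<in> extensional (Obj total)"
    by (simp add: total_def)
next
  fix A assume "A \<in> Obj total"
  then have "A \<in> nonroot X" by (simp add: to_compcat_simps)
  from pair_Id[OF this] subst_Id[OF this] show "Id total A \<in> hom total A A"
    by (auto simp: total_hom)
next
  fix f g assume "\<not> (f \<in> Arr total \<and> g \<in> Arr total \<and> Cod total f = Dom total g)"
  then show "Comp total g f = undefined"
    by (auto simp: total_def)
next
  fix u v A B D assume uv: "u \<in> hom total A B" "v \<in> hom total B D"
  then show "Comp total v u \<in> hom total A D"
  proof (rule total_hom_comp)
    fix f g assume a: "(f, subst X D g) \<in> pairs" "(g, D) \<in> pairs" "A = subst X (subst X D g) f"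
      "u = e (f, subst X D g)" "v = e (g, D)"
    with pair_Comp[OF a(1,2)] show ?thesis unfolding total_hom by metis
  qed
next
  fix u A B assume "u \<in> hom total A B"
  then obtain f where f: "(f, B) \<in> pairs" "A = subst X B f" "u = e (f, B)"
    by (auto simp: total_hom)
  then have B: "B \<in> nonroot X" "f \<in> hom (base X) (Dom (base X) f) (parent X B)"
    by (auto simp: pairs_iff hom_def)
  have "A \<in> nonroot X" "parent X A = Dom (base X) f" using f pair_simps by auto
  then show "Comp total u (Id total A) = u"
    using pair_Comp(3)[of "Id (base X) (Dom (base X) f)" B f] pair_Id[of A] f Id_right[OF B(2)] by simp
  show "Comp total (Id total B) u = u"
    using pair_Comp(3)[of f B "Id (base X) (parent X B)"] pair_Id[OF B(1)] f subst_Id[OF B(1)]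
      Id_left[OF B(2)] by simp
next
  fix u v w A B D E
  assume u: "u \<in> hom total A B" and v: "v \<in> hom total B D" and w: "w \<in> hom total D E"
  obtain h where h: "(h, E) \<in> pairs" "D = subst X E h" "w = e (h, E)"
    using w by (auto simp: total_hom)
  obtain f g where fg: "(f, subst X D g) \<in> pairs" "(g, D) \<in> pairs" "u = e (f, subst X D g)" "v = e (g, D)"
    using total_hom_comp[OF u v] by metis
  note c = pair_Comp[OF fg(1,2)] pair_Comp[OF fg(2)[unfolded h(2)] h(1)]
  have "Comp total (e (h \<cdot>\<^bsub>base X\<^esub> g, E)) u = e ((h \<cdot>\<^bsub>base X\<^esub> g) \<cdot>\<^bsub>base X\<^esub> f, E)"
    using pair_Comp(3)[of f E "h \<cdot>\<^bsub>base X\<^esub> g"] fg h c by simp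
  moreover have "Comp total w (e (g \<cdot>\<^bsub>base X\<^esub> f, D)) = e (h \<cdot>\<^bsub>base X\<^esub> (g \<cdot>\<^bsub>base X\<^esub> f), E)"
    using pair_Comp(3)[of "g \<cdot>\<^bsub>base X\<^esub> f" E h] h c by simp
  moreover have "(h \<cdot>\<^bsub>base X\<^esub> g) \<cdot>\<^bsub>base X\<^esub> f = h \<cdot>\<^bsub>base X\<^esub> (g \<cdot>\<^bsub>base X\<^esub> f)"
    using fg h c(1) c(6) by (intro Comp_assoc[OF in_hom]) (auto simp: pairs_iff hom_def)
  ultimately show "Comp total (Comp total w v) u = Comp total w (Comp total v u)"
    using c fg h by simp
qed

text \<open>By construction \<open>e (f, A)\<close> is the only arrow with target \<open>A\<close>
  over \<open>f\<close>.\<close>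

lemma discrete_fibration_total: "discrete_fibration total (base X) (kfib to_compcat)"
proof (intro discrete_fibration.intro cat_functor.intro cat_functor_axioms.intro
    discrete_fibration_axioms.intro category_total category_axioms; (unfold to_compcat_simps)?)
  show "parent X \<in> nonroot X \<rightarrow>\<^sub>E Obj (base X)" by (rule parent_type)
  show "farr (kfib to_compcat) \<in> extensional (Arr total)"
    by (simp add: to_compcat_def total_def)
next
  fix u A B assume "u \<in> hom total A B"
  then show "farr (kfib to_compcat) u \<in> hom (base X) (parent X A) (parent X B)"
    by (auto simp: total_hom pair_simps) (simp add: pairs_iff hom_def)
next
  fix A assume A: "A \<in> nonroot X"
  show "farr (kfib to_compcat) (Id total A) = Id (base X) (parent X A)"
    using pair_Id[OF A] pair_simps by simp
next
  fix u v A B D assume uv: "u \<in> hom total A B" "v \<in> hom total B D"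
  then show "farr (kfib to_compcat) (Comp total v u) = farr (kfib to_compcat) v \<cdot>\<^bsub>base X\<^esub> farr (kfib to_compcat) u"
    by (rule total_hom_comp) (simp add: pair_Comp pair_simps)
next
  fix A f assume "A \<in> nonroot X" "f \<in> Arr (base X)" "Cod (base X) f = parent X A"
  then have "(f, A) \<in> pairs" by (simp add: pairs_iff)
  then show "\<exists>!u. u \<in> Arr total \<and> Cod total u = A \<and> farr (kfib to_compcat) u = f"
    by (intro ex1I[of _ "e (f, A)"]) (auto simp: pair_simps total_Arr)
qed

lemma pairs_pullback:
  assumes "(f, A) \<in> pairs"
  shows "pullback_square (base X) (lift X A f) (prj X (subst X A f)) (prj X A) f"
  using chosen_pullback assms pairs_into by blast

lemma pair_square:
  assumes p: "(f, A) \<in> pairs"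
  shows "(prj X (subst X A f), (lift X A f, f), prj X A)
    \<in> hom (arrow_category (base X)) (prj X (subst X A f)) (prj X A)"
proof -
  have A: "A \<in> nonroot X" "f \<in> hom (base X) (Dom (base X) f) (parent X A)" "f \<in> into_parent X A"
    using p by (auto simp: pairs_iff hom_def into_parent_def)
  note q = homD[OF prj_type[OF A(1)]] homD[OF prj_type[OF pair_simps(6)[OF p]]] pair_simps(7)[OF p]
  show ?thesis
    unfolding arrow_category_hom
    using q A(2) lift_type[OF A(1,3)] pairs_pullback[OF p] by (simp add: pullback_square_def)
qed

lemma cat_functor_chi: "cat_functor total (arrow_category (base X)) (kchi to_compcat)"
proof (intro cat_functor.intro cat_functor_axioms.intro category_total category_arrow_category;
    (unfold to_compcat_simps arrow_category_simps)?)
  show "prj X \<in> nonroot X \<rightarrow>\<^sub>E Arr (base X)"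
    using prj_ext prj_type by (auto simp: PiE_def hom_def)
  show "farr (kchi to_compcat) \<in> extensional (Arr total)"
    by (simp add: to_compcat_def total_def)
next
  fix u A B assume "u \<in> hom total A B"
  then obtain f where f: "(f, B) \<in> pairs" "A = subst X B f" "u = e (f, B)"
    by (auto simp: total_hom)
  then show "farr (kchi to_compcat) u \<in> hom (arrow_category (base X)) (prj X A) (prj X B)"
    using pair_square[OF f(1)] pair_simps(5)[OF f(1)] by simp
next
  fix A assume A: "A \<in> nonroot X"
  then show "farr (kchi to_compcat) (Id total A) = Id (arrow_category (base X)) (prj X A)"
    using pair_Id[OF A] pair_simps prj_type[OF A]
    by (simp add: subst_Id lift_Id arrow_category_simps hom_def)
next
  fix u v A B D assume uv: "u \<in> hom total A B" "v \<in> hom total B D"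
  then obtain f g where a: "(f, subst X D g) \<in> pairs" "(g, D) \<in> pairs" "B = subst X D g"
    "A = subst X (subst X D g) f" "u = e (f, subst X D g)" "v = e (g, D)"
    by (rule total_hom_comp)
  show "farr (kchi to_compcat) (Comp total v u)
      = Comp (arrow_category (base X)) (farr (kchi to_compcat) v) (farr (kchi to_compcat) u)"
    using a pair_Comp[OF a(1,2)] homD(1)[OF pair_square[OF a(1)]] homD(1)[OF pair_square[OF a(2)]]
    by (simp add: pair_simps arrow_category_simps)
qed

lemma discrete_contextual_to_compcat: "discrete_contextual_compcat to_compcat"
proof -
  interpret p: discrete_fibration total "base X" "kfib to_compcat" by (rule discrete_fibration_total)
  interpret chi: cat_functor total "arrow_category (base X)" "kchi to_compcat" by (rule cat_functor_chi)
  have cod: "comp_functor total (cod_functor (base X)) (kchi to_compcat) = kfib to_compcat"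
  proof -
    have "fobj (comp_functor total (cod_functor (base X)) (kchi to_compcat)) = fobj (kfib to_compcat)"
      by (rule extensionalityI[of _ "nonroot X"])
        (use parent_type prj_type in \<open>auto simp: comp_functor_def cod_functor_def to_compcat_simps
          compose_def arrow_category_simps hom_def PiE_def\<close>)
    moreover have "farr (comp_functor total (cod_functor (base X)) (kchi to_compcat)) = farr (kfib to_compcat)"
    proof (rule extensionalityI[of _ "Arr total"])
      fix u assume u: "u \<in> Arr total"
      then show "farr (comp_functor total (cod_functor (base X)) (kchi to_compcat)) u = farr (kfib to_compcat) u"
        using chi.farr_simps(1)[OF u] by (auto simp: total_Arr pair_simps cod_functor_def)
    qed (simp_all add: comp_functor_def p.farr_ext)
    ultimately show ?thesis by simp
  qed
  show ?thesis
  proof (intro discrete_contextual_compcat.intro contextual_compcat.intro comprehension_category.intro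
      comprehension_category_axioms.intro contextual_compcat_axioms.intro;
      (unfold to_compcat_simps)?)
    show "is_pullback_square (base X) (farr (kchi to_compcat) u)"
      if "cartesian total (base X) (kfib to_compcat) u" for u
      using that pairs_pullback by (auto simp: cartesian_def total_Arr pair_simps is_pullback_square_def)
    fix b assume b: "b \<in> Obj (base X)"
    have "iterated_ext (\<lambda>a. {A \<in> nonroot X. parent X A = a}) (\<lambda>a A. Dom (base X) (prj X A)) (one X) As b
      \<longleftrightarrow> iterated_ext types_over (\<lambda>_ A. A) (one X) As b" for As
      by (rule iterated_ext_cong[where S = "Obj (base X)"])
        (use prj_type in \<open>auto simp: types_over_def hom_def nonroot_Obj one_Obj\<close>)
    then show "\<exists>!As. iterated_ext (\<lambda>a. {A \<in> nonroot X. parent X A = a}) (\<lambda>a A. Dom (base X) (prj X A)) (one X) As b"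
      using unique_iterated_ext[OF b] by simp
  qed (use p.fibration cat_functor_chi cod one_terminal discrete_fibration_total in auto)
qed

text \<open>The code \<open>e\<close> only names arrows of the total category. The resulting
  contextual category sees these through their sources and their squares, so \<open>e\<close>
  disappears from it.\<close>

lemma cxl_of_to_compcat: "cxl_of (attr_of_compcat to_compcat) = X"
proof -
  note o = hom_Obj
  interpret p: discrete_fibration total "base X" "kfib to_compcat" by (rule discrete_fibration_total)
  interpret attributes "attr_of_compcat to_compcat"
    by (intro attributes_attr_of_compcat discrete_contextual_to_compcat)
  have X: "contextual_category X" by unfold_locales
  show ?thesis
  proof (rule cxl_of_eqI[OF X]; (unfold attr_of_compcat_simps to_compcat_simps)?)
    fix a A assume "A \<in> nonroot X \<and> parent X A = a"
    then show "parent X (Dom (base X) (prj X A)) = a" "prj X (Dom (base X) (prj X A)) = prj X A"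
      using prj_type[of A] by (auto simp: hom_def)
  next
    fix f a b A assume f: "f \<in> hom (base X) a b" and A: "A \<in> nonroot X \<and> parent X A = b"
    then have p: "(f, A) \<in> pairs" by (auto simp: pairs_iff hom_def)
    have l: "unique_lift total (kfib to_compcat) f A = e (f, A)"
      using p.lift_of_arrow[of "e (f, A)"] pair_simps[OF p] by simp
    show "subst X (Dom (base X) (prj X A)) f
        = Dom (base X) (prj X (Dom total (unique_lift total (kfib to_compcat) f A)))"
      "lift X (Dom (base X) (prj X A)) f = chi_top to_compcat (unique_lift total (kfib to_compcat) f A)"
      unfolding l using A pair_simps[OF p] prj_type[of A] prj_type[of "subst X A f"]
      by (simp_all add: chi_top_def hom_def)
  qed simp_all
qed

end

text \<open>
  A contextual category with a non-root object is infinite, so that its type has room for pairs; one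
  without has an empty total category.
\<close>

lemma contextual_category_code:
  fixes X :: "('u, 'u) cxl"
  assumes "contextual_category X"
  shows "\<exists>e :: 'u \<times> 'u \<Rightarrow> 'u. inj_on e {(f, A). A \<in> nonroot X \<and> f \<in> into_parent X A}"
proof (cases "nonroot X = {}")
  case False
  then have "infinite (UNIV :: 'u set)"
    using infinite_super[OF subset_UNIV contextual_category.infinite_nonroot[OF assms]] by simp
  then obtain e where "bij_betw e ((UNIV :: 'u set) \<times> (UNIV :: 'u set)) (UNIV :: 'u set)"
    using iffD2[OF card_of_ordIso card_of_Times_same_infinite] by metis
  then have "inj_on e UNIV" by (simp add: bij_betw_def)
  then show ?thesis using inj_on_subset[OF _ subset_UNIV] by metis
qed simp

text \<open>With one type \<open>'u\<close> for objects and arrows, infinitely many objects leave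
  room among the arrows for pairs of an arrow and an object.\<close>

lemma equivalent_CxlCat_CompCat_disc_cxl:
  "equivalent_categories (CxlCat :: ('u, 'u) cxl_cat) (CompCat_disc_cxl :: ('u, 'u, 'u, 'u) cxl_compcat_cat)"
  unfolding CxlCat_def CompCat_disc_cxl_def
proof (rule equivalent_if_fully_faithful_surjective[where m = fst and q = "\<lambda>X. cxl_of (attr_of_compcat X)"])
  have "X \<in> (\<lambda>X. cxl_of (attr_of_compcat X)) ` {X :: ('u, 'u, 'u, 'u) cxl_compcat. discrete_contextual_compcat X}"
    if X: "contextual_category X" for X :: "('u, 'u) cxl"
  proof -
    \<comment> \<open>The code may vary with \<open>X\<close>, since it only has to produce some
      preimage of \<open>X\<close>.\<close>
    obtain e :: "'u \<times> 'u \<Rightarrow> 'u" where e: "inj_on e {(f, A). A \<in> nonroot X \<and> f \<in> into_parent X A}"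
      using contextual_category_code[OF X] by blast
    interpret coded_contextual_category X e
      using X e by (simp add: coded_contextual_category_def coded_contextual_category_axioms_def)
    show ?thesis
      using discrete_contextual_to_compcat cxl_of_to_compcat by (auto simp: image_iff)
  qed
  then show "(\<lambda>X. cxl_of (attr_of_compcat X)) ` {X :: ('u, 'u, 'u, 'u) cxl_compcat. discrete_contextual_compcat X}
      = {X. contextual_category X}"
    using attributes.contextual_cxl_of[OF attributes_attr_of_compcat] by blast
qed (use category_CxlCat[unfolded CxlCat_def] category_CompCat_disc_cxl[unfolded CompCat_disc_cxl_def]
    bij_betw_compcat_maps in \<open>simp_all add: cxl_of_simps id_compcat_map_def comp_compcat_map_def\<close>)

theorem proposition45:
  shows "equivalent_categories (CxlCat :: ('u, 'u) cxl_cat) (CwA_cxl :: ('u, 'u, 'u) cxl_cwa_cat) \<and>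
    equivalent_categories (CxlCat :: ('u, 'u) cxl_cat)
      (CompCat_disc_cxl :: ('u, 'u, 'u, 'u) cxl_compcat_cat)"
  using equivalent_CxlCat_CwA_cxl equivalent_CxlCat_CompCat_disc_cxl by blast

end
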